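(* Fix integers $n\ge 2$ and $1\le k\le n$. Let $B\subset\mathbb{R}^k$ be a region whose boundary consists of a finite number of algebraic surfaces. Then, as $Q\to\infty$, $$ \Phi_k(Q;B) = \frac{(2Q)^{n+1}}{2\zeta(n+1)} \int_{B} \rho_k(\mathbf{x})\,d\mathbf{x} + O\left(Q^n \log^{l(n)} Q \right), $$ where $l(n)=1$ if $n=2$ and $l(n)=0$ if $n\ge 3$, and the implicit constant in the $O$-term depends only on $n$, the number of algebraic surfaces forming the boundary of $B$, and their maximal degree.
   Context: Height of an integral polynomial: the maximum of the absolute values of its coefficients. $\mathcal{P}(Q)$ denotes the set of all integral polynomials of degree at most $n$ and height at most $Q$. An integral polynomial is called prime if it is irreducible over $\mathbb{Q}$, primitive (the gcd of its coefficients is $1$), and has positive leading coefficient; $\mathcal{P}^*(Q)$ is the set of prime polynomials in $\mathcal{P}(Q)$. For a Borel set $B\subset\mathbb{R}^k$, $\Phi_k(Q;B)$ is the number of ordered $k$-tuples $(\alpha_1,\dots,\alpha_k)\in B$ of pairwise distinct real numbers such that there exists $p\in\mathcal{P}^*(Q)$ with $p(\alpha_1)=\dots=p(\alpha_k)=0$ (i.e. ordered $k$-tuples in $B$ of distinct real conjugate algebraic numbers of degree $\le n$ and height $\le Q$). $\zeta$ is the Riemann zeta function. For $\mathbf{x}=(x_1,\dots,x_k)\in\mathbb{R}^k$, $\sigma_0(\mathbf{x})=1$, $\sigma_i(\mathbf{x})=\sum_{1\le j_1<\dots<j_i\le k}x_{j_1}\cdots x_{j_i}$ for $1\le i\le k$,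 and $\sigma_i(\mathbf{x})=0$ for $i<0$ or $i>k$. The function $\rho_k$ is defined by $$ \rho_k(\mathbf{x}) =2^{-n-1} \prod_{1\le i < j \le k} |x_i - x_j|\int_{D_{\mathbf{x}}} \prod_{i=1}^k \left|\sum_{j=0}^{n-k} t_j x_i^j\right| \, dt_0\cdots dt_{n-k}, $$ where $D_{\mathbf{x}}=\{(t_0,\dots,t_{n-k})\in\mathbb{R}^{n-k+1} : \max_{0\le i\le n}|\sum_{j=0}^{n-k}(-1)^j\sigma_{k-i+j}(\mathbf{x})t_j|\le 1\}$. *)

theory Defs
  imports "HOL-Analysis.Analysis" "HOL-Computational_Algebra.Polynomial"
begin

definition prime_poly :: "int poly \<Rightarrow> bool" where
  "prime_poly p \<longleftrightarrow> irreducible (map_poly rat_of_int p) \<and> content p = 1 \<and> lead_coeff p > 0"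

definition Pstar :: "nat \<Rightarrow> real \<Rightarrow> int poly set" where
  "Pstar n Q = {p. degree p \<le> n \<and> (\<forall>i. real_of_int \<bar>coeff p i\<bar> \<le> Q) \<and> prime_poly p}"

definition Phi :: "nat \<Rightarrow> real \<Rightarrow> (real^'k::finite) set \<Rightarrow> nat" where
  "Phi n Q B = card {x \<in> B. inj (\<lambda>i. x $ i) \<and>
      (\<exists>p\<in>Pstar n Q. \<forall>i. poly (map_poly real_of_int p) (x $ i) = 0)}"

definition esym :: "real^'k::finite \<Rightarrow> int \<Rightarrow> real" where
  "esym x i = (if i < 0 \<or> i > int CARD('k) then 0
      else (\<Sum>S\<in>{S::'k set. card S = nat i}. \<Prod>j\<in>S. x $ j))"

definition Dset :: "nat \<Rightarrow> real^'k::finite \<Rightarrow> (nat \<Rightarrow> real) set" where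
  "Dset n x = {t \<in> PiE {..n - CARD('k)} (\<lambda>_. UNIV).
      \<forall>i\<le>n. \<bar>\<Sum>j\<le>n - CARD('k). (-1)^j * esym x (int CARD('k) - int i + int j) * t j\<bar> \<le> 1}"

definition rho :: "nat \<Rightarrow> real^'k::{finite,linorder} \<Rightarrow> real" where
  "rho n x = inverse (2 ^ (n + 1)) * (\<Prod>i\<in>UNIV. \<Prod>j\<in>{j. i < j}. \<bar>x $ i - x $ j\<bar>) *
      (LINT t : Dset n x | (\<Pi>\<^sub>M j\<in>{..n - CARD('k)}. lborel).
          \<Prod>i\<in>UNIV. \<bar>\<Sum>j\<le>n - CARD('k). t j * (x $ i) ^ j\<bar>)"

definition zeta_nat :: "nat \<Rightarrow> real" where
  "zeta_nat s = (\<Sum>m. 1 / (real (Suc m)) ^ s)"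

(* multivariate real polynomials in k variables: finitely supported coefficient maps *)
definition mpoly_eval :: "(('k::finite \<Rightarrow> nat) \<Rightarrow> real) \<Rightarrow> real^'k \<Rightarrow> real" where
  "mpoly_eval c x = (\<Sum>\<alpha>\<in>{\<alpha>. c \<alpha> \<noteq> 0}. c \<alpha> * (\<Prod>i\<in>UNIV. (x $ i) ^ (\<alpha> i)))"

definition alg_poly :: "(('k::finite \<Rightarrow> nat) \<Rightarrow> real) \<Rightarrow> nat \<Rightarrow> bool" where
  "alg_poly c d \<longleftrightarrow> finite {\<alpha>. c \<alpha> \<noteq> 0} \<and> {\<alpha>. c \<alpha> \<noteq> 0} \<noteq> {} \<and>
      (\<forall>\<alpha>. c \<alpha> \<noteq> 0 \<longrightarrow> (\<Sum>i\<in>UNIV. \<alpha> i) \<le> d)"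

definition lexp :: "nat \<Rightarrow> nat" where
  "lexp n = (if n = 2 then 1 else 0)"

end

(*
  Identify polynomials of degree at most n with coefficient vectors in R^(n+1). The number of k-tuples of
  distinct real roots lying in B is a bounded function of the vector, invariant under positive scaling. It is
  locally constant off the hypersurfaces where the leading coefficient vanishes, where there is a double root,
  or where a root tuple lies on the boundary of B; all of them lie in zero sets of polynomials of degree
  bounded in terms of n and d, by a dimension count. A generic axis-parallel line meets these boundedly often,
  so shifting the integer grid by at most 1/2 in every coordinate changes the sum of the counting function over
  the integer points of [-q, q]^(n+1) by O(q^n), and averaging over the shifts compares that sum with
  (q + 1/2)^(n+1) times the integral over the unit cube.

  The integral is computed by the area formula for (x, t) |-> coefficients of prod (X - x_i) * sum t_j X^j, one
  root at a time: splitting off a root is a translation of the constant term followed by a unipotent shear.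

  Non-primitive polynomials are removed by inverting the sum over the content, which costs the factor
  zeta(n+1), and reducible ones by counting pairs of factors with the bound H(f) H(g) << H(f g); for n = 2
  that count has the harmonic sum that produces the logarithm.
*)
theory Submission
  imports Defs "HOL-Probability.Probability" "HOL-Computational_Algebra.Fundamental_Theorem_Algebra"
begin

subsection \<open>Functions polynomial in each coordinate\<close>

text \<open>The obstacle is uniformity: the error constant may see only n, the number m of boundary
  polynomials and their degree d. That a root tuple lies on the boundary is a statement about roots,
  and elimination by resultants would be laborious. Instead, the roots x and the cofactor t form n +
  1 parameters, a boundary equation P x = 0 removes one degree of freedom, and linear algebra over a
  grid yields a nonzero F of degree at most N^N * d in each variable, N = n + 1, that vanishes on
  the coefficient vectors to be avoided. The same device with P = x_1 - x_2 stands in for the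
  discriminant. Such an F is only ever restricted to axis-parallel lines; hence
  \<open>sepoly\<close> records nothing but the degree in each variable, all other coordinates being
  frozen. Lines contained in a wall are exceptional: a Schwartz-Zippel count leaves O(q^(n-1)) of
  them, each costing O(q). On a segment that meets no wall, roots can neither escape to infinity nor
  merge nor cross the boundary, which is what makes the count constant there.\<close>

definition sepoly :: "'i set \<Rightarrow> nat \<Rightarrow> (('i \<Rightarrow> real) \<Rightarrow> real) \<Rightarrow> bool" where
  "sepoly I D f \<longleftrightarrow> (\<forall>i\<in>I. \<forall>a. \<exists>p::real poly. degree p \<le> D \<and> (\<forall>s. f (a(i := s)) = poly p s))"

lemma sepolyI:
  assumes "\<And>i a. i \<in> I \<Longrightarrow> \<exists>p::real poly. degree p \<le> D \<and> (\<forall>s. f (a(i := s)) = poly p s)"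
  shows "sepoly I D f"
  using assms unfolding sepoly_def by blast

lemma sepolyE:
  assumes "sepoly I D f" "i \<in> I"
  obtains p :: "real poly" where "degree p \<le> D" "\<And>s. f (a(i := s)) = poly p s"
  using assms unfolding sepoly_def by blast

lemma sepoly_mono: "sepoly I D f \<Longrightarrow> D \<le> E \<Longrightarrow> J \<subseteq> I \<Longrightarrow> sepoly J E f"
  unfolding sepoly_def by (meson order_trans subsetD)

lemma sepoly_const: "sepoly I D (\<lambda>a. c)"
  by (rule sepolyI, rule exI[of _ "[:c:]"]) simp

lemma sepoly_coord: "1 \<le> D \<Longrightarrow> sepoly I D (\<lambda>a. a j)"
proof (rule sepolyI, goal_cases)
  case (1 i a)
  show ?case
  proof (cases "j = i")
    case True
    then show ?thesis using 1 by (intro exI[of _ "[:0, 1:]"]) simp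
  next
    case False
    then show ?thesis by (intro exI[of _ "[:a j:]"]) simp
  qed
qed

lemma sepoly_add:
  assumes "sepoly I D f" "sepoly I D g"
  shows "sepoly I D (\<lambda>a. f a + g a)"
proof (rule sepolyI, goal_cases)
  case (1 i a)
  obtain p where p: "degree p \<le> D" "\<And>s. f (a(i := s)) = poly p s"
    using sepolyE[OF assms(1) 1] by blast
  obtain q where q: "degree q \<le> D" "\<And>s. g (a(i := s)) = poly q s"
    using sepolyE[OF assms(2) 1] by blast
  show ?case using p q by (intro exI[of _ "p + q"]) (simp add: degree_add_le)
qed

lemma sepoly_mult:
  assumes "sepoly I D f" "sepoly I E g"
  shows "sepoly I (D + E) (\<lambda>a. f a * g a)"
proof (rule sepolyI, goal_cases)
  case (1 i a)
  obtain p where p: "degree p \<le> D" "\<And>s. f (a(i := s)) = poly p s"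
    using sepolyE[OF assms(1) 1] by blast
  obtain q where q: "degree q \<le> E" "\<And>s. g (a(i := s)) = poly q s"
    using sepolyE[OF assms(2) 1] by blast
  show ?case using p q degree_mult_le[of p q] by (intro exI[of _ "p * q"]) simp
qed

lemma sepoly_uminus: "sepoly I D f \<Longrightarrow> sepoly I D (\<lambda>a. - f a)"
  using sepoly_mult[OF sepoly_const[of I 0 "-1"], of D f] by simp

lemma sepoly_diff:
  "sepoly I D f \<Longrightarrow> sepoly I D g \<Longrightarrow> sepoly I D (\<lambda>a. f a - g a)"
  using sepoly_add[of I D f "\<lambda>a. - g a"] sepoly_uminus[of I D g] by simp

lemma sepoly_sum:
  assumes "\<And>x. x \<in> A \<Longrightarrow> sepoly I D (f x)"
  shows "sepoly I D (\<lambda>a. \<Sum>x\<in>A. f x a)"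
  using assms
  by (induction A rule: infinite_finite_induct) (auto intro: sepoly_const sepoly_add)

lemma sepoly_prod:
  assumes "\<And>x. x \<in> A \<Longrightarrow> sepoly I D (f x)"
  shows "sepoly I (card A * D) (\<lambda>a. \<Prod>x\<in>A. f x a)"
  using assms
  by (induction A rule: infinite_finite_induct) (auto intro: sepoly_const sepoly_mult)

lemma sepoly_poly_comp:
  assumes "sepoly I D f" "degree q \<le> e"
  shows "sepoly I (e * D) (\<lambda>a. poly q (f a))"
proof (rule sepolyI, goal_cases)
  case (1 i a)
  obtain p where p: "degree p \<le> D" "\<And>s. f (a(i := s)) = poly p s"
    using sepolyE[OF assms(1) 1] by blast
  have "degree (pcompose q p) \<le> e * D"
    using p(1) assms(2) degree_pcompose_le[of q p] by (meson mult_le_mono order_trans)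
  then show ?case using p by (intro exI[of _ "pcompose q p"]) (simp add: poly_pcompose)
qed

lemma sepoly_slice:
  assumes "sepoly (insert i I) D f" "i \<notin> I"
  shows "sepoly I D (\<lambda>a. f (a(i := s)))"
proof (rule sepolyI, goal_cases)
  case (1 j a)
  obtain p where "degree p \<le> D" "\<And>t. f ((a(i := s))(j := t)) = poly p t"
    using sepolyE[OF assms(1), of j "a(i := s)"] 1 by blast
  moreover have "(a(j := t))(i := s) = (a(i := s))(j := t)" for t
    using 1 assms(2) by (intro fun_upd_twist) auto
  ultimately show ?case by (intro exI[of _ p]) simp
qed

subsection \<open>Grids\<close>

text \<open>Coordinates outside \<open>I\<close> are frozen to those of \<open>a\<close>, so grids
  over smaller index sets keep the same type, and a slice is obtained by changing
  \<open>a\<close>.\<close>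

definition grid :: "'i set \<Rightarrow> ('i \<Rightarrow> real set) \<Rightarrow> ('i \<Rightarrow> real) \<Rightarrow> ('i \<Rightarrow> real) set" where
  "grid I S a = {b. (\<forall>j\<in>I. b j \<in> S j) \<and> (\<forall>j. j \<notin> I \<longrightarrow> b j = a j)}"

lemma grid_empty [simp]: "grid {} S a = {a}"
  by (auto simp: grid_def)

lemma grid_insert:
  assumes "i \<notin> I"
  shows "grid (insert i I) S a = (\<Union>s\<in>S i. grid I S (a(i := s)))"
  using assms by (auto simp: grid_def fun_eq_iff)

lemma grid_coord: "i \<notin> I \<Longrightarrow> b \<in> grid I S (a(i := s)) \<Longrightarrow> b i = s"
  by (auto simp: grid_def)

lemma finite_grid:
  assumes "finite I" "\<And>i. i \<in> I \<Longrightarrow> finite (S i)"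
  shows "finite (grid I S a)"
  using assms
proof (induction I arbitrary: a)
  case (insert i I)
  then show ?case by (simp add: grid_insert)
qed simp

lemma sum_grid_insert:
  assumes "finite I" "i \<notin> I" "\<And>j. j \<in> insert i I \<Longrightarrow> finite (S j)"
  shows "sum f (grid (insert i I) S a) = (\<Sum>s\<in>S i. sum f (grid I S (a(i := s))))"
  unfolding grid_insert[OF assms(2)]
proof (rule sum.UNION_disjoint)
  show "finite (S i)" using assms(3) by simp
  show "\<forall>s\<in>S i. finite (grid I S (a(i := s)))"
    using assms(1,3) by (simp add: finite_grid)
  show "\<forall>s\<in>S i. \<forall>t\<in>S i. s \<noteq> t \<longrightarrow> grid I S (a(i := s)) \<inter> grid I S (a(i := t)) = {}"
    using grid_coord[OF assms(2)] by blast
qed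

lemma sum_grid_shift:
  assumes "i \<notin> I"
  shows "sum f (grid I S (a(i := s))) = (\<Sum>b\<in>grid I S a. f (b(i := s)))"
proof -
  have "grid I S (a(i := s)) = (\<lambda>b. b(i := s)) ` grid I S a"
  proof (intro equalityI subsetI)
    fix b assume b: "b \<in> grid I S (a(i := s))"
    have "b(i := a i) \<in> grid I S a" "b = (b(i := a i))(i := s)"
      using b assms by (auto simp: grid_def fun_eq_iff)
    then show "b \<in> (\<lambda>b. b(i := s)) ` grid I S a" by blast
  qed (use assms in \<open>auto simp: grid_def\<close>)
  moreover have "inj_on (\<lambda>b. b(i := s)) (grid I S a)"
  proof (rule inj_onI)
    fix b c assume bc: "b \<in> grid I S a" "c \<in> grid I S a" "b(i := s) = c(i := s)"
    have "b j = c j" for j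
      using bc(1,2) assms fun_cong[OF bc(3), of j] unfolding grid_def by (cases "j = i") simp_all
    then show "b = c" by blast
  qed
  ultimately show ?thesis by (simp add: sum.reindex)
qed

text \<open>The form in which one-dimensional estimates enter: \<open>b\<close> runs over the lines
  parallel to axis \<open>i\<close>, the inner sum over the points of one line.\<close>

lemma sum_grid_lines:
  assumes "finite I" "i \<notin> I" "\<And>j. j \<in> insert i I \<Longrightarrow> finite (S j)"
  shows "sum f (grid (insert i I) S a) = (\<Sum>b\<in>grid I S a. \<Sum>s\<in>S i. f (b(i := s)))"
proof -
  have "sum f (grid (insert i I) S a) = (\<Sum>s\<in>S i. sum f (grid I S (a(i := s))))"
    by (rule sum_grid_insert) (use assms in auto)
  also have "\<dots> = (\<Sum>s\<in>S i. \<Sum>b\<in>grid I S a. f (b(i := s)))"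
    by (simp add: sum_grid_shift[OF assms(2)])
  also have "\<dots> = (\<Sum>b\<in>grid I S a. \<Sum>s\<in>S i. f (b(i := s)))" by (rule sum.swap)
  finally show ?thesis .
qed

lemma card_grid:
  assumes "finite I" "\<And>i. i \<in> I \<Longrightarrow> finite (S i)" "\<And>i. i \<in> I \<Longrightarrow> card (S i) = T"
  shows "card (grid I S a) = T ^ card I"
  using assms
proof (induction I arbitrary: a)
  case (insert i I)
  have "card (grid (insert i I) S a) = (\<Sum>s\<in>S i. card (grid I S (a(i := s))))"
    using sum_grid_insert[of I i S "\<lambda>_. 1::nat" a] insert.hyps insert.prems(1) by simp
  also have "\<dots> = (\<Sum>s\<in>S i. T ^ card I)"
    by (intro sum.cong refl insert.IH) (use insert.prems in auto)
  finally show ?case using insert.hyps insert.prems(2) by simp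
qed simp

lemma card_roots_le:
  fixes p :: "real poly"
  assumes "p \<noteq> 0" "degree p \<le> D"
  shows "card {s. poly p s = 0} \<le> D"
  using card_poly_roots_bound[OF assms(1)] assms(2) by linarith

text \<open>Induction on the axes. On the line through the witness \<open>a0\<close> in direction
  \<open>i\<close>, \<open>F\<close> has at most \<open>D\<close> zeros; for any other
  \<open>s\<close> the point \<open>a0(i := s)\<close> is a witness for the slice at height
  \<open>s\<close>, and the exceptional slices are counted in full. The factor \<open>T\<close> on
  the left avoids the exponent \<open>card I - 1\<close>.\<close>

lemma schwartz_zippel:
  assumes "finite I" "sepoly I D F"
    and "\<And>i. i \<in> I \<Longrightarrow> finite (S i)" "\<And>i. i \<in> I \<Longrightarrow> card (S i) = T"
    and "\<And>j. j \<notin> I \<Longrightarrow> a0 j = a j" "F a0 \<noteq> 0"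
  shows "T * card {b \<in> grid I S a. F b = 0} \<le> card I * D * T ^ card I"
  using assms
proof (induction I arbitrary: a a0)
  case empty
  then have "a0 = a" by auto
  with empty show ?case by simp
next
  case (insert i I)
  obtain p where p: "degree p \<le> D" "\<And>s. F (a0(i := s)) = poly p s"
    using sepolyE[OF insert.prems(1), of i a0] by blast
  have p0: "p \<noteq> 0" using insert.prems(5) p(2)[of "a0 i"] by (metis fun_upd_triv poly_0)
  define R where "R = {s. poly p s = 0}"
  have R: "finite R" "card R \<le> D"
    using p0 p(1) unfolding R_def by (auto intro: poly_roots_finite card_roots_le)
  have fS: "finite (S i)" "card (S i) = T" using insert.prems(2,3) by auto
  have "{b \<in> grid (insert i I) S a. F b = 0} = (\<Union>s\<in>S i. {b \<in> grid I S (a(i := s)). F b = 0})"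
    using insert.hyps by (auto simp: grid_insert)
  then have "card {b \<in> grid (insert i I) S a. F b = 0} \<le> (\<Sum>s\<in>S i. card {b \<in> grid I S (a(i := s)). F b = 0})"
    using card_UN_le[OF fS(1)] by simp
  then have "T * card {b \<in> grid (insert i I) S a. F b = 0}
      \<le> (\<Sum>s\<in>S i. T * card {b \<in> grid I S (a(i := s)). F b = 0})"
    by (simp add: sum_distrib_left[symmetric])
  also have "\<dots> \<le> (\<Sum>s\<in>S i. card I * D * T ^ card I + (if s \<in> R then T * T ^ card I else 0))"
  proof (rule sum_mono)
    fix s assume "s \<in> S i"
    show "T * card {b \<in> grid I S (a(i := s)). F b = 0}
        \<le> card I * D * T ^ card I + (if s \<in> R then T * T ^ card I else 0)"
    proof (cases "s \<in> R")
      case False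
      have "sepoly I D F" using insert.prems(1) sepoly_mono by blast
      moreover have "F (a0(i := s)) \<noteq> 0" using False p(2)[of s] by (simp add: R_def)
      moreover have "(a0(i := s)) j = (a(i := s)) j" if "j \<notin> I" for j
        using insert.prems(4)[of j] that by auto
      ultimately have "T * card {b \<in> grid I S (a(i := s)). F b = 0} \<le> card I * D * T ^ card I"
        using insert.prems(2,3) by (intro insert.IH[where ?a0.0 = "a0(i := s)"]) blast+
      then show ?thesis by simp
    next
      case True
      have "card {b \<in> grid I S (a(i := s)). F b = 0} \<le> card (grid I S (a(i := s)))"
        using insert.prems(2) insert.hyps by (intro card_mono finite_grid) auto
      also have "\<dots> = T ^ card I" using insert.prems(2,3) insert.hyps by (intro card_grid) auto
      finally show ?thesis using True by (simp add: trans_le_add2)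
    qed
  qed
  also have "\<dots> = T * (card I * D * T ^ card I) + card (S i \<inter> R) * (T * T ^ card I)"
    using fS by (simp add: sum.distrib sum.If_cases Int_def)
  also have "\<dots> \<le> T * (card I * D * T ^ card I) + D * (T * T ^ card I)"
    using R card_mono[OF R(1), of "S i \<inter> R"] by (intro add_left_mono mult_right_mono) auto
  also have "\<dots> = card (insert i I) * D * T ^ card (insert i I)"
    using insert.hyps by (simp add: algebra_simps)
  finally show ?case .
qed

subsection \<open>Comparison of shifted lattice sums\<close>

text \<open>A term can be nonzero only if the segment from \<open>s\<close> to \<open>s + u\<close>
  meets \<open>Z\<close>; charge it to such a point. Segments of length at most 1/2 that start at
  distinct integers in the same direction are disjoint, so no point of \<open>Z\<close> is charged
  twice.\<close>

lemma line_shift_bound: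
  fixes g :: "real \<Rightarrow> real"
  assumes g: "\<And>s. 0 \<le> g s" "\<And>s. g s \<le> K"
    and Z: "finite Z" and S: "S \<subseteq> \<int>" "finite S" and u: "\<bar>u\<bar> \<le> 1/2"
    and const: "\<And>s. closed_segment s (s + u) \<inter> Z = {} \<Longrightarrow> g (s + u) = g s"
  shows "\<bar>\<Sum>s\<in>S. g s - g (s + u)\<bar> \<le> K * card Z"
proof -
  define Bd where "Bd = {s \<in> S. closed_segment s (s + u) \<inter> Z \<noteq> {}}"
  have fB: "finite Bd" using S by (simp add: Bd_def)
  have K: "0 \<le> K" using g[of 0] by linarith
  have "\<forall>s\<in>Bd. \<exists>x. x \<in> closed_segment s (s + u) \<inter> Z" by (auto simp: Bd_def)
  then obtain r where "\<forall>s\<in>Bd. r s \<in> closed_segment s (s + u) \<inter> Z" by (rule bchoice[THEN exE])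
  then have r: "r s \<in> closed_segment s (s + u)" "r s \<in> Z" if "s \<in> Bd" for s using that by auto
  have "inj_on r Bd"
  proof (rule inj_onI)
    fix s t assume st: "s \<in> Bd" "t \<in> Bd" "r s = r t"
    have st_Ints: "s \<in> \<int>" "t \<in> \<int>" using st(1,2) S(1) by (auto simp: Bd_def)
    have "s \<le> r s \<and> r s \<le> s + u \<or> s + u \<le> r s \<and> r s \<le> s"
         "t \<le> r t \<and> r t \<le> t + u \<or> t + u \<le> r t \<and> r t \<le> t"
      using r(1)[OF st(1)] r(1)[OF st(2)] by (auto simp: closed_segment_eq_real_ivl split: if_splits)
    then have "\<bar>s - t\<bar> < 1" using u st(3) by linarith
    then show "s = t" using Ints_eq_abs_less1[OF st_Ints] by simp
  qed
  then have cB: "card Bd \<le> card Z"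
    using r(2) by (intro card_inj_on_le[of r] Z) auto
  have "\<bar>\<Sum>s\<in>S. g s - g (s + u)\<bar> \<le> (\<Sum>s\<in>S. \<bar>g s - g (s + u)\<bar>)" by (rule sum_abs)
  also have "\<dots> \<le> (\<Sum>s\<in>S. if s \<in> Bd then K else 0)"
  proof (rule sum_mono)
    fix s assume "s \<in> S"
    then show "\<bar>g s - g (s + u)\<bar> \<le> (if s \<in> Bd then K else 0)"
      using const[of s] g(1)[of s] g(2)[of s] g(1)[of "s+u"] g(2)[of "s+u"] by (auto simp: Bd_def)
  qed
  also have "\<dots> = K * card Bd"
  proof -
    have "S \<inter> {s. s \<in> Bd} = Bd" by (auto simp: Bd_def)
    then show ?thesis using S by (simp add: sum.If_cases)
  qed
  also have "\<dots> \<le> K * card Z" using cB K by (intro mult_left_mono) auto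
  finally show ?thesis .
qed

text \<open>\<open>f\<close> may jump along a coordinate segment only where it crosses one of the hypersurfaces \<open>F l = 0\<close>.
  On most lines these are met boundedly often, which is what the shift estimates below use.\<close>

locale wall_function =
  fixes I :: "'i set" and L :: "'l set" and F :: "'l \<Rightarrow> ('i \<Rightarrow> real) \<Rightarrow> real"
    and D :: nat and f :: "('i \<Rightarrow> real) \<Rightarrow> real" and K :: real
  assumes finI: "finite I" and finL: "finite L"
    and sep: "\<And>l. l \<in> L \<Longrightarrow> sepoly I D (F l)"
    and nz: "\<And>l. l \<in> L \<Longrightarrow> \<exists>a. (\<forall>j. j \<notin> I \<longrightarrow> a j = 0) \<and> F l a \<noteq> 0"
    and f0: "\<And>a. 0 \<le> f a" and fK: "\<And>a. f a \<le> K"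
    and const: "\<And>b i u. \<lbrakk>\<And>j. j \<notin> I \<Longrightarrow> b j = 0; i \<in> I;
        \<And>s l. s \<in> closed_segment (b i) (b i + u) \<Longrightarrow> l \<in> L \<Longrightarrow> F l (b(i := s)) \<noteq> 0\<rbrakk>
        \<Longrightarrow> f (b(i := b i + u)) = f b"
begin

text \<open>Sum along the lines parallel to axis \<open>i\<close>. On a line where no
  \<open>F l\<close> vanishes identically there are at most \<open>card L * D\<close> zeros, so
  \<open>line_shift_bound\<close> applies; the remaining lines get the trivial bound
  \<open>T * K\<close>, and they are rarer than all lines by a factor \<open>T\<close>. There are
  \<open>T ^ (card I - 1)\<close> lines.\<close>

lemma shift_step:
  assumes i: "i \<in> I" and S: "\<And>j. j \<in> I \<Longrightarrow> finite (S j)" "\<And>j. j \<in> I \<Longrightarrow> card (S j) = T"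
    and Si: "S i \<subseteq> \<int>" and u: "\<bar>u\<bar> \<le> 1/2"
  shows "\<bar>sum f (grid I S (\<lambda>_. 0)) - sum f (grid I (S(i := (\<lambda>s. s + u) ` S i)) (\<lambda>_. 0))\<bar>
      \<le> K * card L * D * card I * real T ^ (card I - 1)"
proof -
  define J where "J = I - {i}"
  have J: "finite J" "i \<notin> J" "I = insert i J" "card I = Suc (card J)"
    using finI i card.remove[OF finI i] by (auto simp: J_def)
  let ?o = "\<lambda>_. 0 :: real"
  define G where "G = grid J S ?o"
  have fJ: "j \<in> I" if "j \<in> J" for j using that J(3) by simp
  have G: "finite G" "card G = T ^ card J"
    unfolding G_def by (rule finite_grid card_grid; simp add: J(1) S fJ)+
  have K: "0 \<le> K" by (rule order_trans[OF f0 fK])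
  have GS: "grid J (S(i := (\<lambda>s. s + u) ` S i)) ?o = G"
    using J by (auto simp: G_def grid_def)
  define S' where "S' = S(i := (\<lambda>s. s + u) ` S i)"
  have fS': "finite (S' j)" if "j \<in> insert i J" for j
    using that S(1) J(3) by (auto simp: S'_def)
  have "sum f (grid I S' ?o) = (\<Sum>b\<in>grid J S' ?o. \<Sum>s\<in>S' i. f (b(i := s)))"
    unfolding J(3) by (rule sum_grid_lines[OF J(1,2) fS'])
  also have "\<dots> = (\<Sum>b\<in>G. \<Sum>s\<in>(\<lambda>s. s + u) ` S i. f (b(i := s)))"
    by (simp add: GS S'_def)
  also have "\<dots> = (\<Sum>b\<in>G. \<Sum>s\<in>S i. f (b(i := s + u)))"
    by (subst sum.reindex) (auto simp: inj_on_def)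
  finally have S': "sum f (grid I S' ?o) = (\<Sum>b\<in>G. \<Sum>s\<in>S i. f (b(i := s + u)))" .
  have "sum f (grid I S ?o) = (\<Sum>b\<in>G. \<Sum>s\<in>S i. f (b(i := s)))"
    unfolding J(3) G_def by (rule sum_grid_lines[OF J(1,2)]) (use S(1) J(3) in auto)
  with S' have 1: "sum f (grid I S ?o) - sum f (grid I (S(i := (\<lambda>s. s + u) ` S i)) ?o)
      = (\<Sum>b\<in>G. \<Sum>s\<in>S i. f (b(i := s)) - f (b(i := s + u)))"
    by (simp add: sum_subtractf S'_def)
  \<comment> \<open>The exceptional lines: those contained in some wall.\<close>
  define BB where "BB = (\<Union>l\<in>L. {b \<in> G. \<forall>s. F l (b(i := s)) = 0})"
  have fBB: "finite BB" using finL G by (auto simp: BB_def)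
  have BBl: "T * card {b \<in> G. \<forall>s. F l (b(i := s)) = 0} \<le> card J * D * T ^ card J" if l: "l \<in> L" for l
  proof -
    obtain a where a: "\<And>j. j \<notin> I \<Longrightarrow> a j = 0" "F l a \<noteq> 0" using nz[OF l] by blast
    \<comment> \<open>A line inside the wall vanishes in particular at height \<open>a i\<close>,
      where the witness \<open>a\<close> shows that the slice of \<open>F l\<close> is not
      identically zero.\<close>
    have "T * card {b \<in> grid J S ?o. F l (b(i := a i)) = 0} \<le> card J * D * T ^ card J"
    proof (rule schwartz_zippel[where ?a0.0 = "a(i := 0)"])
      show "sepoly J D (\<lambda>b. F l (b(i := a i)))"
        using sep[OF l] J by (intro sepoly_slice) auto
      show "F l ((a(i := 0))(i := a i)) \<noteq> 0" using a(2) by simp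
      show "(a(i := 0)) j = 0" if "j \<notin> J" for j
        using that a(1)[of j] J(3) by auto
      show "finite J" by (rule J(1))
      show "finite (S j)" "card (S j) = T" if "j \<in> J" for j
        using that J(3) S[of j] by simp_all
    qed
    moreover have "T * card {b \<in> G. \<forall>s. F l (b(i := s)) = 0} \<le> T * card {b \<in> G. F l (b(i := a i)) = 0}"
      using G(1) by (intro mult_le_mono2 card_mono) auto
    ultimately show ?thesis unfolding G_def by linarith
  qed
  have "T * card BB \<le> (\<Sum>l\<in>L. T * card {b \<in> G. \<forall>s. F l (b(i := s)) = 0})"
    unfolding BB_def sum_distrib_left[symmetric] by (rule mult_le_mono2[OF card_UN_le[OF finL]])
  also have "\<dots> \<le> (\<Sum>l\<in>L. card J * D * T ^ card J)" by (intro sum_mono BBl)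
  finally have BB: "T * card BB \<le> card L * (card J * D * T ^ card J)" by simp
  define h where "h b = (\<Sum>s\<in>S i. f (b(i := s)) - f (b(i := s + u)))" for b
  define w where "w b = (if b \<in> BB then T * K else 0) + K * (card L * D)" for b
  have hw: "(\<Sum>b\<in>G. \<bar>h b\<bar>) \<le> (\<Sum>b\<in>G. w b)"
  proof (rule sum_mono)
    fix b assume b: "b \<in> G"
    have "\<bar>\<Sum>s\<in>S i. f (b(i := s)) - f (b(i := s + u))\<bar> \<le> (if b \<in> BB then T * K else 0) + K * (card L * D)"
    proof (cases "b \<in> BB")
      \<comment> \<open>On an exceptional line each of the \<open>T\<close> terms is at most
        \<open>K\<close>, as \<open>f\<close> has values between 0 and \<open>K\<close>.\<close>
      case True
      have "\<bar>\<Sum>s\<in>S i. f (b(i := s)) - f (b(i := s + u))\<bar> \<le> (\<Sum>s\<in>S i. K)"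
      proof (rule order_trans[OF sum_abs sum_mono])
        fix s
        show "\<bar>f (b(i := s)) - f (b(i := s + u))\<bar> \<le> K"
          using f0[of "b(i := s)"] fK[of "b(i := s)"] f0[of "b(i := s + u)"] fK[of "b(i := s + u)"] by linarith
      qed
      then show ?thesis using True S(2)[OF i] K by (simp add: add_increasing2)
    next
      case False
      define Z where "Z = (\<Union>l\<in>L. {s. F l (b(i := s)) = 0})"
      have Zl: "finite {s. F l (b(i := s)) = 0} \<and> card {s. F l (b(i := s)) = 0} \<le> D" if l: "l \<in> L" for l
      proof -
        obtain p where p: "degree p \<le> D" "\<And>s. F l (b(i := s)) = poly p s"
          using sepolyE[OF sep[OF l] i, of b] by blast
        have "p \<noteq> 0" using False b l p by (auto simp: BB_def)
        then show ?thesis using p card_roots_le by (auto simp: poly_roots_finite)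
      qed
      have "card Z \<le> (\<Sum>l\<in>L. D)"
        unfolding Z_def using Zl by (intro order_trans[OF card_UN_le[OF finL] sum_mono]) auto
      then have cZ: "card Z \<le> card L * D" by simp
      have "\<bar>\<Sum>s\<in>S i. f (b(i := s)) - f (b(i := s + u))\<bar> \<le> K * card Z"
      proof (rule line_shift_bound[where g = "\<lambda>s. f (b(i := s))"])
        show "S i \<subseteq> \<int>" "finite (S i)" "\<bar>u\<bar> \<le> 1/2" by (fact Si S(1)[OF i] u)+
        show "0 \<le> f (b(i := s))" "f (b(i := s)) \<le> K" for s by (rule f0 fK)+
        show "finite Z" using Zl finL by (auto simp: Z_def)
        fix s assume s: "closed_segment s (s + u) \<inter> Z = {}"
        have "f ((b(i := s))(i := (b(i := s)) i + u)) = f (b(i := s))"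
        proof (rule const[OF _ i])
          fix j assume "j \<notin> I"
          then show "(b(i := s)) j = 0" using b i by (auto simp: G_def grid_def J_def)
        next
          fix t l assume "t \<in> closed_segment ((b(i := s)) i) ((b(i := s)) i + u)" "l \<in> L"
          then show "F l ((b(i := s))(i := t)) \<noteq> 0" using s by (auto simp: Z_def)
        qed
        then show "f (b(i := s + u)) = f (b(i := s))" by simp
      qed
      also have "\<dots> \<le> K * (card L * D)" using of_nat_mono[OF cZ, where 'a = real] K by (simp add: mult_left_mono)
      finally show ?thesis using False by simp
    qed
    then show "\<bar>h b\<bar> \<le> w b" by (simp only: h_def w_def)
  qed
  have "G \<inter> {b. b \<in> BB} = BB" by (auto simp: BB_def)
  then have "(\<Sum>b\<in>G. w b) = card BB * (T * K) + card G * (K * (card L * D))"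
    using G(1) by (simp add: w_def sum.distrib sum.If_cases)
  then have w: "(\<Sum>b\<in>G. w b) = K * (real (T * card BB) + real (T ^ card J) * (card L * D))"
    unfolding G(2) by (simp add: algebra_simps)
  have "K * (real (T * card BB) + real (T ^ card J) * (card L * D))
      \<le> K * (real (card L * (card J * D * T ^ card J)) + real (T ^ card J) * (card L * D))"
    by (intro mult_left_mono add_right_mono of_nat_mono BB K)
  moreover have "K * (real (card L * (card J * D * T ^ card J)) + real (T ^ card J) * (card L * D))
      = K * card L * D * card I * real T ^ (card I - 1)"
    unfolding J(4) by (simp add: algebra_simps)
  moreover have "\<bar>\<Sum>b\<in>G. h b\<bar> \<le> (\<Sum>b\<in>G. \<bar>h b\<bar>)" by (rule sum_abs)
  ultimately show ?thesis using hw w unfolding 1 h_def[symmetric] by linarith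
qed

text \<open>The axes are shifted one after another. An intermediate grid has some axes already off
  the integers, but \<open>shift_step\<close> asks for integer nodes only on the axis that it
  moves.\<close>

lemma shift_bound:
  assumes u: "\<And>i. i \<in> I \<Longrightarrow> \<bar>u i\<bar> \<le> 1/2" and S: "S \<subseteq> \<int>" "finite S"
  shows "\<bar>sum f (grid I (\<lambda>_. S) (\<lambda>_. 0)) - sum f (grid I (\<lambda>i. (\<lambda>s. s + u i) ` S) (\<lambda>_. 0))\<bar>
      \<le> card I * (K * card L * D * card I * real (card S) ^ (card I - 1))"
proof -
  define E where "E = K * card L * D * card I * real (card S) ^ (card I - 1)"
  define \<Sigma> where "\<Sigma> J = sum f (grid I (\<lambda>i. if i \<in> J then (\<lambda>s. s + u i) ` S else S) (\<lambda>_. 0))" for J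
  have "\<bar>\<Sigma> {} - \<Sigma> J\<bar> \<le> card J * E" if "finite J" "J \<subseteq> I" for J
    using that
  proof (induction J)
    case (insert i J)
    define T where "T = (\<lambda>i. if i \<in> J then (\<lambda>s. s + u i) ` S else S)"
    have c: "card ((\<lambda>s. s + c) ` S) = card S" for c :: real
      by (rule card_image) (auto simp: inj_on_def)
    have i: "i \<in> I" "T i = S" using insert by (auto simp: T_def)
    have "\<bar>sum f (grid I T (\<lambda>_. 0)) - sum f (grid I (T(i := (\<lambda>s. s + u i) ` T i)) (\<lambda>_. 0))\<bar> \<le> E"
      unfolding E_def
    proof (rule shift_step[OF i(1), where S = T and u = "u i" and T = "card S"])
      show "finite (T j)" "card (T j) = card S" if "j \<in> I" for j using that S(2) c by (simp_all add: T_def)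
      show "T i \<subseteq> \<int>" using i(2) S(1) by simp
      show "\<bar>u i\<bar> \<le> 1/2" by (rule u[OF i(1)])
    qed
    moreover have "T(i := (\<lambda>s. s + u i) ` T i) = (\<lambda>j. if j \<in> insert i J then (\<lambda>s. s + u j) ` S else S)"
      using i by (auto simp: fun_eq_iff T_def)
    ultimately have "\<bar>\<Sigma> J - \<Sigma> (insert i J)\<bar> \<le> E" by (simp only: \<Sigma>_def T_def)
    moreover have "\<bar>\<Sigma> {} - \<Sigma> J\<bar> \<le> card J * E" using insert by simp
    ultimately have "\<bar>\<Sigma> {} - \<Sigma> (insert i J)\<bar> \<le> E + card J * E" by linarith
    then show ?case using insert.hyps by (simp add: algebra_simps)
  qed simp
  from this[OF finI order_refl] have "\<bar>\<Sigma> {} - \<Sigma> I\<bar> \<le> card I * E" .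
  moreover have "\<Sigma> {} = sum f (grid I (\<lambda>_. S) (\<lambda>_. 0))" by (simp add: \<Sigma>_def)
  moreover have "\<Sigma> I = sum f (grid I (\<lambda>i. (\<lambda>s. s + u i) ` S) (\<lambda>_. 0))"
    by (simp add: \<Sigma>_def grid_def)
  ultimately show ?thesis unfolding E_def by simp
qed

end

subsection \<open>Elimination\<close>

text \<open>Gaussian elimination: if equation \<open>j\<close> has a nonzero entry at
  \<open>i0\<close>, solve it for that unknown and substitute into the others, which removes one
  equation and one unknown.\<close>

lemma homogeneous_system:
  fixes A :: "'j \<Rightarrow> 'i \<Rightarrow> real"
  assumes "finite J" "finite I" "card J < card I"
  shows "\<exists>c. (\<exists>i\<in>I. c i \<noteq> 0) \<and> (\<forall>j\<in>J. (\<Sum>i\<in>I. A j i * c i) = 0)"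
  using assms
proof (induction J arbitrary: I A)
  case empty
  then obtain i where "i \<in> I" by (metis card.empty all_not_in_conv less_irrefl)
  then show ?case by (intro exI[of _ "\<lambda>_. 1"]) auto
next
  case (insert j J)
  show ?case
  proof (cases "\<forall>i\<in>I. A j i = 0")
    case True
    obtain c where "\<exists>i\<in>I. c i \<noteq> 0" "\<forall>j\<in>J. (\<Sum>i\<in>I. A j i * c i) = 0"
      using insert.IH[of I A] insert.prems insert.hyps by auto
    then show ?thesis using True by (intro exI[of _ c]) simp
  next
    case False
    then obtain i0 where i0: "i0 \<in> I" "A j i0 \<noteq> 0" by blast
    define I' where "I' = I - {i0}"
    have I': "finite I'" "card J < card I'" "i0 \<notin> I'" "I = insert i0 I'"
      using i0(1) insert.prems insert.hyps by (auto simp: I'_def)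
    obtain c where c: "\<exists>i\<in>I'. c i \<noteq> 0"
        "\<forall>j'\<in>J. (\<Sum>i\<in>I'. (A j' i - A j' i0 * A j i / A j i0) * c i) = 0"
      using insert.IH[OF I'(1,2), of "\<lambda>j' i. A j' i - A j' i0 * A j i / A j i0"] by blast
    define e where "e = - (\<Sum>i\<in>I'. A j i * c i) / A j i0"
    define c' where "c' = c(i0 := e)"
    have sum: "(\<Sum>i\<in>I. A j' i * c' i) = A j' i0 * e + (\<Sum>i\<in>I'. A j' i * c i)" for j'
    proof -
      have "(\<Sum>i\<in>I'. A j' i * c' i) = (\<Sum>i\<in>I'. A j' i * c i)"
        using I'(3) by (intro sum.cong) (auto simp: c'_def)
      then show ?thesis using I' by (simp add: c'_def)
    qed
    have "(\<Sum>i\<in>I. A j i * c' i) = 0" using i0 unfolding sum by (simp add: e_def)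
    moreover have "(\<Sum>i\<in>I. A j' i * c' i) = 0" if "j' \<in> J" for j'
    proof -
      have "0 = (\<Sum>i\<in>I'. A j' i * c i - (A j' i0 / A j i0) * (A j i * c i))"
        using c(2) that by (simp add: algebra_simps)
      also have "\<dots> = (\<Sum>i\<in>I'. A j' i * c i) - (A j' i0 / A j i0) * (\<Sum>i\<in>I'. A j i * c i)"
        by (simp add: sum_subtractf sum_distrib_left)
      finally show ?thesis unfolding sum by (simp add: e_def)
    qed
    moreover have "\<exists>i\<in>I. c' i \<noteq> 0"
      using c(1) I'(3,4) by (metis c'_def fun_upd_other insertCI)
    ultimately show ?thesis by (intro exI[of _ c']) auto
  qed
qed

text \<open>The unknown polynomials of the elimination are expanded in the Lagrange basis at the
  nodes 0, ..., D instead of monomials: a coefficient is then a value at a grid point, so a nonzero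
  coefficient vector gives a nonzero function at once.\<close>

definition lagrange_basis :: "nat \<Rightarrow> nat \<Rightarrow> real poly" where
  "lagrange_basis D e = (\<Prod>j\<in>{..D} - {e}. smult (1 / (real e - real j)) [:- real j, 1:])"

lemma degree_lagrange_basis: "e \<le> D \<Longrightarrow> degree (lagrange_basis D e) \<le> D"
proof -
  assume e: "e \<le> D"
  have "degree (lagrange_basis D e) \<le> (\<Sum>j\<in>{..D} - {e}. degree (smult (1 / (real e - real j)) [:- real j, 1:]))"
    unfolding lagrange_basis_def by (rule degree_prod_sum_le[simplified comp_def]) simp
  also have "\<dots> \<le> (\<Sum>j\<in>{..D} - {e}. 1)" by (rule sum_mono) simp
  also have "\<dots> = D" using e by simp
  finally show ?thesis .
qed

lemma poly_lagrange_basis: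
  assumes "e' \<le> D"
  shows "poly (lagrange_basis D e) (real e') = (if e' = e then 1 else 0)"
proof (cases "e' = e")
  case True
  then show ?thesis
    unfolding lagrange_basis_def poly_prod by (auto intro!: prod.neutral simp: divide_simps)
next
  case False
  then show ?thesis
    unfolding lagrange_basis_def poly_prod using assms by (auto intro!: prod_zero bexI[of _ e'])
qed

lemma prod_lagrange_basis:
  assumes "finite I" "\<And>i. i \<in> I \<Longrightarrow> \<gamma> i \<le> D" "\<beta> \<in> extensional I" "\<gamma> \<in> extensional I"
    "\<And>i. i \<in> I \<Longrightarrow> b i = real (\<gamma> i)"
  shows "(\<Prod>i\<in>I. poly (lagrange_basis D (\<beta> i)) (b i)) = (if \<beta> = \<gamma> then 1 else 0)"
proof (cases "\<beta> = \<gamma>")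
  case True
  then show ?thesis using assms by (auto intro!: prod.neutral simp: poly_lagrange_basis)
next
  case False
  then obtain i where "i \<in> I" "\<beta> i \<noteq> \<gamma> i" using assms(3,4) extensionalityI by metis
  then show ?thesis using assms False by (auto intro!: prod_zero bexI[of _ i] simp: poly_lagrange_basis)
qed

lemma sepoly_prod_coords:
  assumes "finite I" "\<And>i. i \<in> I \<Longrightarrow> degree (q i) \<le> E"
  shows "sepoly I E (\<lambda>a. \<Prod>i\<in>I. poly (q i) (a i))"
proof (rule sepolyI, goal_cases)
  case (1 i a)
  have "(\<Prod>j\<in>I. poly (q j) ((a(i := s)) j)) = poly (smult (\<Prod>j\<in>I - {i}. poly (q j) (a j)) (q i)) s" for s
  proof -
    have "(\<Prod>j\<in>I. poly (q j) ((a(i := s)) j)) = poly (q i) s * (\<Prod>j\<in>I - {i}. poly (q j) ((a(i := s)) j))"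
      using prod.remove[OF assms(1) 1, of "\<lambda>j. poly (q j) ((a(i := s)) j)"] by simp
    also have "(\<Prod>j\<in>I - {i}. poly (q j) ((a(i := s)) j)) = (\<Prod>j\<in>I - {i}. poly (q j) (a j))"
      by (rule prod.cong) auto
    finally show ?thesis by simp
  qed
  then show ?case using assms(2)[OF 1]
    by (intro exI[of _ "smult (\<Prod>j\<in>I - {i}. poly (q j) (a j)) (q i)"]) (simp add: degree_smult_le order_trans)
qed

text \<open>One variable of degree at most \<open>M\<close> is determined by \<open>M + 1\<close>
  nodes; the others follow slice by slice.\<close>

lemma sepoly_vanishes:
  assumes "finite I" "sepoly I M f" "\<And>b. b \<in> grid I (\<lambda>_. real ` {..M}) a \<Longrightarrow> f b = 0"
    and "\<And>j. j \<notin> I \<Longrightarrow> b j = a j"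
  shows "f b = 0"
  using assms
proof (induction I arbitrary: a b)
  case empty
  then have "b = a" by auto
  with empty show ?case by simp
next
  case (insert i I)
  obtain p where p: "degree p \<le> M" "\<And>s. f (b(i := s)) = poly p s"
    using sepolyE[OF insert.prems(1), of i b] by blast
  have "poly p s = 0" if s: "s \<in> real ` {..M}" for s
    unfolding p(2)[symmetric]
  proof (rule insert.IH[of "a(i := s)"])
    show "sepoly I M f" using insert.prems(1) by (rule sepoly_mono) auto
    show "f c = 0" if "c \<in> grid I (\<lambda>_. real ` {..M}) (a(i := s))" for c
      using that s insert.prems(2)[of c] unfolding grid_insert[OF insert.hyps(2)] by blast
    show "(b(i := s)) j = (a(i := s)) j" if "j \<notin> I" for j
      using insert.prems(3)[of j] that by simp
  qed
  then have sub: "real ` {..M} \<subseteq> {s. poly p s = 0}" by blast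
  have "p = 0"
  proof (rule ccontr)
    assume "p \<noteq> 0"
    then have "card (real ` {..M}) \<le> M"
      using card_mono[OF poly_roots_finite sub] card_roots_le[OF _ p(1)] by force
    moreover have "card (real ` {..M}) = M + 1" by (subst card_image) (auto simp: inj_on_def)
    ultimately show False by simp
  qed
  then show ?case using p(2)[of "b i"] by simp
qed

text \<open>Stands for the absence of zero divisors. The witnesses for \<open>f\<close> and
  \<open>g\<close> may differ; they are merged one coordinate at a time by choosing a value outside
  the finitely many roots of both restrictions.\<close>

lemma sepoly_common_nonzero:
  assumes "finite I" "sepoly I D f" "sepoly I E g"
    and "\<And>j. j \<notin> I \<Longrightarrow> b j = a j" "f b \<noteq> 0" "\<And>j. j \<notin> I \<Longrightarrow> c j = a j" "g c \<noteq> 0"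
  shows "\<exists>y. (\<forall>j. j \<notin> I \<longrightarrow> y j = a j) \<and> f y \<noteq> 0 \<and> g y \<noteq> 0"
  using assms
proof (induction I arbitrary: a b c)
  case empty
  then have "b = a" "c = a" by auto
  with empty show ?case by blast
next
  case (insert i I)
  obtain p where p: "\<And>s. f (b(i := s)) = poly p s"
    using sepolyE[OF insert.prems(1), of i b] by blast
  obtain q where q: "\<And>s. g (c(i := s)) = poly q s"
    using sepolyE[OF insert.prems(2), of i c] by blast
  have "p \<noteq> 0" using p[of "b i"] insert.prems(4) by (metis fun_upd_triv poly_0)
  moreover have "q \<noteq> 0" using q[of "c i"] insert.prems(6) by (metis fun_upd_triv poly_0)
  ultimately have "finite {s. poly (p * q) s = 0}" by (intro poly_roots_finite) simp
  then obtain s where s: "poly (p * q) s \<noteq> 0"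
    using infinite_UNIV_char_0 by (metis (mono_tags, lifting) UNIV_I finite_subset mem_Collect_eq subsetI)
  have "\<exists>y. (\<forall>j. j \<notin> I \<longrightarrow> y j = (a(i := s)) j) \<and> f y \<noteq> 0 \<and> g y \<noteq> 0"
  proof (rule insert.IH[where b = "b(i := s)" and c = "c(i := s)"])
    show "sepoly I D f" by (rule sepoly_mono[OF insert.prems(1)]) auto
    show "sepoly I E g" by (rule sepoly_mono[OF insert.prems(2)]) auto
    show "(b(i := s)) j = (a(i := s)) j" if "j \<notin> I" for j using insert.prems(3)[of j] that by simp
    show "(c(i := s)) j = (a(i := s)) j" if "j \<notin> I" for j using insert.prems(5)[of j] that by simp
    show "f (b(i := s)) \<noteq> 0" "g (c(i := s)) \<noteq> 0" using s p q by auto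
  qed
  then obtain y where y: "\<And>j. j \<notin> I \<Longrightarrow> y j = (a(i := s)) j" "f y \<noteq> 0" "g y \<noteq> 0" by blast
  have "y j = a j" if "j \<notin> insert i I" for j using y(1)[of j] that by simp
  with y show ?case by blast
qed

section \<open>Choice of degrees and elimination of the roots\<close>

lemma power_drop_le:
  fixes x d :: nat
  assumes "d \<le> x"
  shows "x ^ Suc N \<le> (x - d) ^ Suc N + Suc N * d * x ^ N"
proof (induction N)
  case (Suc N)
  have "x ^ Suc (Suc N) \<le> x * ((x - d) ^ Suc N + Suc N * d * x ^ N)" using Suc by simp
  also have "\<dots> = (x - d + d) * (x - d) ^ Suc N + Suc N * d * x ^ Suc N"
    using assms by (simp add: distrib_left)
  also have "\<dots> = (x - d) * (x - d) ^ Suc N + d * (x - d) ^ Suc N + Suc N * d * x ^ Suc N"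
    by (simp only: distrib_right)
  also have "\<dots> \<le> (x - d) * (x - d) ^ Suc N + d * x ^ Suc N + Suc N * d * x ^ Suc N"
    by (intro add_mono mult_le_mono power_mono) auto
  finally show ?case by (simp add: algebra_simps)
qed (use assms in simp)

text \<open>On the left stands the number of grid points with \<open>N * D + 1\<close> nodes per
  axis, on the right the number of coefficients of F and of the cofactor of P. The cofactor falls
  short of the grid by at most N * d * (N * (D + 1))^(N - 1), and the choice D = N^N * d makes this
  D * (D + 1)^(N - 1), which is below (D + 1)^N.\<close>

lemma unknowns_exceed_equations:
  fixes N d :: nat
  assumes "N > 0" and D: "D = N ^ N * d"
  shows "(N * D + 1) ^ N < (D + 1) ^ N + (N * D - d + 1) ^ N"
proof -
  obtain m where m: "N = Suc m" using assms gr0_implies_Suc by blast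
  have dD: "d \<le> N * D" unfolding D using \<open>N > 0\<close> by simp
  have "(N * D + 1) ^ N \<le> (N * D + 1 - d) ^ N + N * d * (N * D + 1) ^ m"
    unfolding m using dD power_drop_le[of d "N * D + 1" m] m by simp
  also have "N * d * (N * D + 1) ^ m \<le> N * d * (N * (D + 1)) ^ m"
    using m by (intro mult_le_mono power_mono) auto
  also have "N * d * (N * (D + 1)) ^ m = D * (D + 1) ^ m"
  proof -
    have "N ^ N = N * N ^ m" unfolding m by simp
    then have "D = N * N ^ m * d" using D by simp
    then show ?thesis by (simp only: power_mult_distrib mult_ac)
  qed
  also have "D * (D + 1) ^ m < (D + 1) ^ N" unfolding m by simp
  finally show ?thesis using dD by (simp add: Suc_diff_le)
qed

text \<open>Eliminating \<open>y\<close>: polynomials \<open>F\<close> of bounded degree in the image coordinates and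
  multiples \<open>P \<cdot> h\<close> together have more coefficients than \<open>F \<circ> \<phi> + P \<cdot> h\<close> has grid values.\<close>

proposition elimination:
  fixes \<phi> :: "('i \<Rightarrow> real) \<Rightarrow> 'j \<Rightarrow> real"
  assumes I: "finite I" "card I = N" and J: "finite J" "card J = N" and N: "N > 0"
    and \<phi>: "\<And>j. j \<in> J \<Longrightarrow> sepoly I 1 (\<lambda>y. \<phi> y j)"
    and P: "sepoly I d P" "\<And>i. i \<notin> I \<Longrightarrow> y0 i = 0" "P y0 \<noteq> 0"
  shows "\<exists>F. sepoly J (N ^ N * d) F \<and> (\<exists>a. (\<forall>j. j \<notin> J \<longrightarrow> a j = 0) \<and> F a \<noteq> 0) \<and>
    (\<forall>y. (\<forall>i. i \<notin> I \<longrightarrow> y i = 0) \<longrightarrow> P y = 0 \<longrightarrow> F (\<phi> y) = 0) \<and>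
    (\<forall>a b. (\<forall>j\<in>J. a j = b j) \<longrightarrow> F a = F b)"
proof -
  define D where "D = N ^ N * d"
  \<comment> \<open>Each \<open>\<phi> y j\<close> has degree at most 1 in every variable, so
    composing a polynomial of degree \<open>D\<close> in each of \<open>N\<close> coordinates gives
    degree at most \<open>N * D\<close>; the cofactor of \<open>P\<close> may then have degree
    \<open>M - d\<close>.\<close>
  define M where "M = N * D"
  have dM: "d \<le> M" unfolding M_def D_def using N by simp
  \<comment> \<open>The unknowns: coefficients of F on the left of the disjoint sum, of the cofactor
    on the right.\<close>
  define U where "U = (PiE J (\<lambda>_. {..D})) <+> (PiE I (\<lambda>_. {..M - d}))"
  define G where "G = grid I (\<lambda>_. real ` {..M}) (\<lambda>_. 0)"
  have cardU: "card U = (D + 1) ^ N + (M - d + 1) ^ N" and finU: "finite U"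
    unfolding U_def using I J by (auto simp: card_Plus card_PiE finite_PiE)
  have cardG: "card G = (M + 1) ^ N" and finG: "finite G"
    unfolding G_def using I by (auto simp: card_image inj_on_def intro!: card_grid finite_grid)
  define LF where "LF \<gamma> a = (\<Prod>j\<in>J. poly (lagrange_basis D (\<gamma> j)) (a j))" for \<gamma> and a :: "'j \<Rightarrow> real"
  define LH where "LH \<beta> y = (\<Prod>i\<in>I. poly (lagrange_basis (M - d) (\<beta> i)) (y i))" for \<beta> and y :: "'i \<Rightarrow> real"
  have "card G < card U"
    unfolding cardU cardG M_def by (rule unknowns_exceed_equations[OF N D_def])
  from homogeneous_system[OF finG finU this, of "\<lambda>g u. case u of Inl \<gamma> \<Rightarrow> LF \<gamma> (\<phi> g) | Inr \<beta> \<Rightarrow> P g * LH \<beta> g"]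
  obtain c where c: "\<exists>u\<in>U. c u \<noteq> 0"
    "\<And>g. g \<in> G \<Longrightarrow> (\<Sum>u\<in>U. (case u of Inl \<gamma> \<Rightarrow> LF \<gamma> (\<phi> g) | Inr \<beta> \<Rightarrow> P g * LH \<beta> g) * c u) = 0"
    by blast
  define F where "F a = (\<Sum>\<gamma>\<in>PiE J (\<lambda>_. {..D}). LF \<gamma> a * c (Inl \<gamma>))" for a
  define H where "H y = (\<Sum>\<beta>\<in>PiE I (\<lambda>_. {..M - d}). LH \<beta> y * c (Inr \<beta>))" for y
  have FH0: "F (\<phi> g) + P g * H g = 0" if "g \<in> G" for g
    using c(2)[OF that] I J unfolding U_def F_def H_def
    by (simp add: sum.Plus finite_PiE sum_distrib_left mult.assoc)
  have sepLF: "sepoly J D (LF \<gamma>)" if "\<gamma> \<in> PiE J (\<lambda>_. {..D})" for \<gamma>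
    unfolding LF_def using that J by (intro sepoly_prod_coords degree_lagrange_basis) (auto simp: PiE_iff)
  have sepLH: "sepoly I (M - d) (LH \<beta>)" if "\<beta> \<in> PiE I (\<lambda>_. {..M - d})" for \<beta>
    unfolding LH_def using that I by (intro sepoly_prod_coords degree_lagrange_basis) (auto simp: PiE_iff)
  have sepLF\<phi>: "sepoly I M (\<lambda>y. LF \<gamma> (\<phi> y))" if "\<gamma> \<in> PiE J (\<lambda>_. {..D})" for \<gamma>
  proof -
    have "sepoly I (D * 1) (\<lambda>y. poly (lagrange_basis D (\<gamma> j)) (\<phi> y j))" if "j \<in> J" for j
      using \<open>\<gamma> \<in> _\<close> that by (intro sepoly_poly_comp \<phi> degree_lagrange_basis) (auto simp: PiE_iff)
    then have "sepoly I (card J * (D * 1)) (\<lambda>y. LF \<gamma> (\<phi> y))"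
      unfolding LF_def by (rule sepoly_prod)
    then show ?thesis by (simp add: J M_def)
  qed
  have sepF: "sepoly J D F"
    unfolding F_def using sepoly_mult[OF sepLF sepoly_const[of J 0]] by (intro sepoly_sum) simp
  have sepH: "sepoly I (M - d) H"
    unfolding H_def using sepoly_mult[OF sepLH sepoly_const[of I 0]] by (intro sepoly_sum) simp
  have "sepoly I M (\<lambda>y. F (\<phi> y))"
    unfolding F_def using sepoly_mult[OF sepLF\<phi> sepoly_const[of I 0]] by (intro sepoly_sum) simp
  moreover have "sepoly I M (\<lambda>y. P y * H y)"
    using sepoly_mult[OF P(1) sepH] dM by simp
  ultimately have sepFH: "sepoly I M (\<lambda>y. F (\<phi> y) + P y * H y)" by (rule sepoly_add)
  have FH: "F (\<phi> y) + P y * H y = 0" if "\<And>i. i \<notin> I \<Longrightarrow> y i = 0" for y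
    \<comment> \<open>The linear system only gives vanishing on the grid; the degree bound
      \<open>M\<close> extends it to every \<open>y\<close> that is 0 outside
      \<open>I\<close>.\<close>
    by (rule sepoly_vanishes[OF I(1) sepFH, of "\<lambda>_. 0"]) (use FH0 that in \<open>auto simp: G_def\<close>)
  have F\<gamma>: "F (\<lambda>j. if j \<in> J then real (\<gamma> j) else 0) = c (Inl \<gamma>)" if \<gamma>: "\<gamma> \<in> PiE J (\<lambda>_. {..D})" for \<gamma>
  proof -
    have "F (\<lambda>j. if j \<in> J then real (\<gamma> j) else 0)
        = (\<Sum>\<beta>\<in>PiE J (\<lambda>_. {..D}). (if \<beta> = \<gamma> then 1 else 0) * c (Inl \<beta>))"
      unfolding F_def LF_def using \<gamma> J(1)
      by (intro sum.cong refl arg_cong2[where f = "(*)"] prod_lagrange_basis) (auto simp: PiE_iff)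
    also have "\<dots> = (\<Sum>\<beta>\<in>PiE J (\<lambda>_. {..D}). if \<beta> = \<gamma> then c (Inl \<beta>) else 0)"
      by (rule sum.cong) auto
    finally show ?thesis using \<gamma> J by (simp add: finite_PiE)
  qed
  have H\<beta>: "H (\<lambda>i. if i \<in> I then real (\<beta> i) else 0) = c (Inr \<beta>)" if \<beta>: "\<beta> \<in> PiE I (\<lambda>_. {..M - d})" for \<beta>
  proof -
    have "H (\<lambda>i. if i \<in> I then real (\<beta> i) else 0)
        = (\<Sum>\<gamma>\<in>PiE I (\<lambda>_. {..M - d}). (if \<gamma> = \<beta> then 1 else 0) * c (Inr \<gamma>))"
      unfolding H_def LH_def using \<beta> I(1)
      by (intro sum.cong refl arg_cong2[where f = "(*)"] prod_lagrange_basis) (auto simp: PiE_iff)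
    also have "\<dots> = (\<Sum>\<gamma>\<in>PiE I (\<lambda>_. {..M - d}). if \<gamma> = \<beta> then c (Inr \<gamma>) else 0)"
      by (rule sum.cong) auto
    finally show ?thesis using \<beta> I by (simp add: finite_PiE)
  qed
  \<comment> \<open>Otherwise F is zero and the cofactor is not, so the product of two nonzero
    polynomials P and H would vanish identically.\<close>
  have "\<exists>\<gamma>\<in>PiE J (\<lambda>_. {..D}). c (Inl \<gamma>) \<noteq> 0"
  proof (rule ccontr)
    assume no: "\<not> ?thesis"
    then have F0: "F a = 0" for a by (simp add: F_def)
    obtain \<beta> where \<beta>: "\<beta> \<in> PiE I (\<lambda>_. {..M - d})" "c (Inr \<beta>) \<noteq> 0"
      using c(1) no unfolding U_def by blast
    have "\<exists>y. (\<forall>j. j \<notin> I \<longrightarrow> y j = 0) \<and> P y \<noteq> 0 \<and> H y \<noteq> 0"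
      by (rule sepoly_common_nonzero[OF I(1) P(1) sepH,
          where b = y0 and c = "\<lambda>i. if i \<in> I then real (\<beta> i) else 0"]) (use P \<beta> H\<beta> in auto)
    then obtain y where y: "\<And>j. j \<notin> I \<Longrightarrow> y j = 0" "P y \<noteq> 0" "H y \<noteq> 0" by blast
    show False using FH[of y] y F0[of "\<phi> y"] by simp
  qed
  then obtain \<gamma> where \<gamma>: "\<gamma> \<in> PiE J (\<lambda>_. {..D})" "c (Inl \<gamma>) \<noteq> 0" by blast
  show ?thesis
  proof (rule exI[of _ F], intro conjI allI impI)
    show "sepoly J (N ^ N * d) F" using sepF by (simp add: D_def)
    have "F (\<lambda>j. if j \<in> J then real (\<gamma> j) else 0) \<noteq> 0" using F\<gamma>[OF \<gamma>(1)] \<gamma>(2) by simp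
    then show "\<exists>a. (\<forall>j. j \<notin> J \<longrightarrow> a j = 0) \<and> F a \<noteq> 0"
      by (intro exI[of _ "\<lambda>j. if j \<in> J then real (\<gamma> j) else 0"]) simp
    fix y assume "\<forall>i. i \<notin> I \<longrightarrow> y i = 0" "P y = 0"
    then show "F (\<phi> y) = 0" using FH[of y] by simp
  next
    fix a b :: "'j \<Rightarrow> real" assume "\<forall>j\<in>J. a j = b j"
    then show "F a = F b" by (simp add: F_def LF_def cong: prod.cong)
  qed
qed

subsection \<open>Lattice sums and integrals\<close>

interpretation lborel_prod: product_sigma_finite "\<lambda>_. lborel :: real measure"
  by standard

lemma measurable_PiM_coordwise:
  assumes "\<And>i. i \<in> I \<Longrightarrow> g i \<in> borel_measurable borel"
  shows "(\<lambda>a. \<lambda>i\<in>I. g i (a i)) \<in> measurable (PiM I (\<lambda>_. lborel :: real measure)) (PiM I (\<lambda>_. lborel :: real measure))"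
proof (rule measurable_restrict)
  fix i assume i: "i \<in> I"
  have "(\<lambda>a. a i) \<in> measurable (PiM I (\<lambda>_. lborel :: real measure)) borel"
    using measurable_component_singleton[OF i, of "\<lambda>_. lborel :: real measure"] by simp
  from measurable_compose[OF this assms[OF i]]
  show "(\<lambda>a. g i (a i)) \<in> measurable (PiM I (\<lambda>_. lborel)) lborel" by simp
qed

lemma nn_integral_PiM_affine:
  fixes c e :: "'i \<Rightarrow> real"
  assumes "finite I" and g: "g \<in> borel_measurable (PiM I (\<lambda>_. lborel))" and c: "\<And>i. i \<in> I \<Longrightarrow> c i \<noteq> 0"
  shows "(\<integral>\<^sup>+a. g a \<partial>PiM I (\<lambda>_. lborel)) =
    ennreal (\<Prod>i\<in>I. \<bar>c i\<bar>) * (\<integral>\<^sup>+a. g (\<lambda>i\<in>I. e i + c i * a i) \<partial>PiM I (\<lambda>_. lborel))"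
  using assms
proof (induction I arbitrary: g)
  case empty
  have "(\<lambda>i\<in>{}. e i + c i * a i) = (\<lambda>_. undefined)" for a :: "'i \<Rightarrow> real" by (simp add: restrict_def)
  then show ?case by (simp add: PiM_empty nn_integral_count_space_finite)
next
  case (insert i I)
  note [measurable] = insert.prems(1)
  have ci: "c i \<noteq> 0" using insert.prems by simp
  define h where "h x = (\<integral>\<^sup>+y. g (x(i := e i + c i * y)) \<partial>lborel)" for x
  have upd [measurable]: "(\<lambda>(x, y). x(i := e i + c i * y)) \<in> measurable (PiM I (\<lambda>_. lborel) \<Otimes>\<^sub>M borel) (PiM (insert i I) (\<lambda>_. lborel))"
    by (simp add: case_prod_unfold) measurable
  have h [measurable]: "h \<in> borel_measurable (PiM I (\<lambda>_. lborel))"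
  proof -
    have "(\<lambda>(x, y). g (x(i := e i + c i * y))) \<in> borel_measurable (PiM I (\<lambda>_. lborel) \<Otimes>\<^sub>M lborel)"
      using measurable_compose[OF upd insert.prems(1)] by (simp add: case_prod_unfold cong: measurable_cong_sets)
    then show ?thesis unfolding h_def by measurable
  qed
  have "(\<integral>\<^sup>+a. g a \<partial>PiM (insert i I) (\<lambda>_. lborel)) = (\<integral>\<^sup>+x. \<integral>\<^sup>+y. g (x(i := y)) \<partial>lborel \<partial>PiM I (\<lambda>_. lborel))"
    using insert by (intro lborel_prod.product_nn_integral_insert) auto
  also have "\<dots> = (\<integral>\<^sup>+x. ennreal \<bar>c i\<bar> * h x \<partial>PiM I (\<lambda>_. lborel))"
    unfolding h_def using ci insert.hyps
    by (intro nn_integral_cong nn_integral_real_affine) (auto intro!: measurable_compose[OF _ insert.prems(1)] measurable_fun_upd simp: space_PiM)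
  also have "\<dots> = ennreal \<bar>c i\<bar> * (\<integral>\<^sup>+x. h x \<partial>PiM I (\<lambda>_. lborel))"
    by (rule nn_integral_cmult) measurable
  also have "(\<integral>\<^sup>+x. h x \<partial>PiM I (\<lambda>_. lborel)) =
      ennreal (\<Prod>i\<in>I. \<bar>c i\<bar>) * (\<integral>\<^sup>+a. h (\<lambda>i\<in>I. e i + c i * a i) \<partial>PiM I (\<lambda>_. lborel))"
    using insert.prems(2) by (intro insert.IH h) auto
  also have "(\<integral>\<^sup>+a. h (\<lambda>i\<in>I. e i + c i * a i) \<partial>PiM I (\<lambda>_. lborel))
     = (\<integral>\<^sup>+x. \<integral>\<^sup>+y. g (\<lambda>j\<in>insert i I. e j + c j * (x(i := y)) j) \<partial>lborel \<partial>PiM I (\<lambda>_. lborel))"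
    unfolding h_def using insert.hyps
    by (intro nn_integral_cong arg_cong[where f = g]) (auto simp: fun_eq_iff)
  also have "\<dots> = (\<integral>\<^sup>+a. g (\<lambda>j\<in>insert i I. e j + c j * a j) \<partial>PiM (insert i I) (\<lambda>_. lborel))"
    using insert.hyps
    by (intro lborel_prod.product_nn_integral_insert[symmetric])
       (auto intro!: measurable_compose[OF measurable_PiM_coordwise[where g = "\<lambda>j t. e j + c j * t"] insert.prems(1)])
  finally have "(\<integral>\<^sup>+a. g a \<partial>PiM (insert i I) (\<lambda>_. lborel)) = ennreal \<bar>c i\<bar> * (ennreal (\<Prod>i\<in>I. \<bar>c i\<bar>) *
      (\<integral>\<^sup>+a. g (\<lambda>j\<in>insert i I. e j + c j * a j) \<partial>PiM (insert i I) (\<lambda>_. lborel)))" .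
  moreover have "ennreal (\<Prod>i\<in>insert i I. \<bar>c i\<bar>) = ennreal \<bar>c i\<bar> * ennreal (\<Prod>i\<in>I. \<bar>c i\<bar>)"
    using insert.hyps by (simp add: ennreal_mult prod_nonneg)
  ultimately show ?case by (simp only: mult.assoc)
qed

section \<open>Cubes tiled by unit cells around lattice points\<close>

definition icube :: "'i set \<Rightarrow> real \<Rightarrow> ('i \<Rightarrow> real) set" where
  "icube I r = PiE I (\<lambda>_. {-r..r})"

lemma icube_sets [measurable]: "finite I \<Longrightarrow> icube I r \<in> sets (PiM I (\<lambda>_. lborel))"
  unfolding icube_def by (intro sets_PiM_I_finite) auto

lemma lattice_interval: "{- int (Suc q)..int (Suc q)} = insert (- int (Suc q)) (insert (int (Suc q)) {- int q..int q})"
  by auto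

text \<open>The unit intervals centred at the integers from -q to q tile an interval of half-length
  q + 1/2; this is where the 1/2 in the later volume term comes from.\<close>

lemma nn_integral_interval_split:
  fixes g :: "real \<Rightarrow> ennreal"
  assumes [measurable]: "g \<in> borel_measurable borel"
  shows "(\<integral>\<^sup>+y. g y * indicator {-(real q + 1/2)..real q + 1/2} y \<partial>lborel) =
    (\<Sum>s\<in>{-int q..int q}. \<integral>\<^sup>+y. g (real_of_int s + y) * indicator {-(1/2)..1/2} y \<partial>lborel)"
proof -
  have shift: "(\<integral>\<^sup>+y. g (real_of_int s + y) * indicator {-(1/2)..1/2} y \<partial>lborel)
      = (\<integral>\<^sup>+y. g y * indicator {s - 1/2..s + 1/2} y \<partial>lborel)" for s
    by (subst nn_integral_real_affine[where c = 1 and t = "real_of_int s"])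
       (auto intro!: nn_integral_cong simp: indicator_def)
  show ?thesis unfolding shift
  proof (induction q)
    case (Suc q)
    let ?A = "{-(real q + 1/2)..real q + 1/2}"
    let ?B = "{real_of_int (int (Suc q)) - 1/2..real_of_int (int (Suc q)) + 1/2}"
    let ?C = "{real_of_int (- int (Suc q)) - 1/2..real_of_int (- int (Suc q)) + 1/2}"
    \<comment> \<open>Neighbouring cells share an endpoint, so the identity of indicators fails at
      two points and is used almost everywhere.\<close>
    have ind: "(indicator {-(real (Suc q) + 1/2)..real (Suc q) + 1/2} y :: ennreal)
        = indicator ?A y + (indicator ?B y + indicator ?C y)"
      if "y \<notin> {real q + 1/2, - (real q + 1/2)}" for y
      using that by (cases "y \<in> ?A"; cases "y \<in> ?B"; cases "y \<in> ?C") (simp_all add: indicator_def, linarith+)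
    have "AE y in lborel. y \<notin> {real q + 1/2, - (real q + 1/2)}"
      by (rule AE_not_in) (rule finite_imp_null_set_lborel, simp)
    then have "AE y in lborel. g y * indicator {-(real (Suc q) + 1/2)..real (Suc q) + 1/2} y
      = g y * indicator ?A y + (g y * indicator ?B y + g y * indicator ?C y)"
    proof (rule AE_mp, intro AE_I2 impI)
      fix y assume "y \<notin> {real q + 1/2, - (real q + 1/2)}"
      from ind[OF this] show "g y * indicator {-(real (Suc q) + 1/2)..real (Suc q) + 1/2} y
        = g y * indicator ?A y + (g y * indicator ?B y + g y * indicator ?C y)"
        by (simp only: distrib_left)
    qed
    then have "(\<integral>\<^sup>+y. g y * indicator {-(real (Suc q) + 1/2)..real (Suc q) + 1/2} y \<partial>lborel)
      = (\<integral>\<^sup>+y. g y * indicator ?A y + (g y * indicator ?B y + g y * indicator ?C y) \<partial>lborel)"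
      by (rule nn_integral_cong_AE)
    also have "\<dots> = (\<integral>\<^sup>+y. g y * indicator {-(real q + 1/2)..real q + 1/2} y \<partial>lborel) +
          ((\<integral>\<^sup>+y. g y * indicator {real_of_int (int (Suc q)) - 1/2..real_of_int (int (Suc q)) + 1/2} y \<partial>lborel)
          + (\<integral>\<^sup>+y. g y * indicator {real_of_int (- int (Suc q)) - 1/2..real_of_int (- int (Suc q)) + 1/2} y \<partial>lborel))"
      by (simp add: nn_integral_add)
    finally show ?case unfolding Suc.IH lattice_interval by (simp add: add_ac)
  qed simp
qed

definition lattice_pts :: "nat \<Rightarrow> real set" where
  "lattice_pts q = real_of_int ` {-int q..int q}"

lemma lattice_pts: "finite (lattice_pts q)" "card (lattice_pts q) = 2 * q + 1" "lattice_pts q \<subseteq> \<int>"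
  by (auto simp: lattice_pts_def card_image inj_on_def)

lemma sum_lattice_pts: "(\<Sum>s\<in>lattice_pts q. h s) = (\<Sum>s\<in>{-int q..int q}. h (real_of_int s))"
  unfolding lattice_pts_def by (subst sum.reindex) (auto simp: inj_on_def)

lemma indicator_icube_insert:
  assumes "x \<in> space (PiM I (\<lambda>_. lborel))" "i \<notin> I"
  shows "indicator (icube (insert i I) r) (x(i := y)) = (indicator (icube I r) x * indicator {-r..r} y :: ennreal)"
proof -
  have "x(i := y) \<in> icube (insert i I) r \<longleftrightarrow> x \<in> icube I r \<and> y \<in> {-r..r}"
    using assms unfolding icube_def by (auto simp: PiE_iff space_PiM extensional_def split: if_splits)
  then show ?thesis by (simp add: indicator_def)
qed

lemma nn_integral_icube_split:
  fixes f :: "('i \<Rightarrow> real) \<Rightarrow> ennreal"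
  assumes "finite I" "f \<in> borel_measurable (PiM I (\<lambda>_. lborel))"
  shows "(\<integral>\<^sup>+a. f a * indicator (icube I (real q + 1/2)) a \<partial>PiM I (\<lambda>_. lborel)) =
    (\<Sum>z\<in>grid I (\<lambda>_. lattice_pts q) (\<lambda>_. 0). \<integral>\<^sup>+a. f (\<lambda>i\<in>I. z i + a i) * indicator (icube I (1/2)) a \<partial>PiM I (\<lambda>_. lborel))"
  using assms
proof (induction I arbitrary: f)
  case empty
  show ?case by (simp add: PiM_empty nn_integral_count_space_finite icube_def restrict_def)
next
  case (insert i I)
  note [measurable] = insert.prems(1)
  let ?M = "\<lambda>_. lborel :: real measure"
  have [measurable]: "finite I" "i \<notin> I" using insert by auto
  define r where "r = real q + 1/2"
  have fi: "finite (insert i I)" using insert by simp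
  note [measurable] = icube_sets[OF insert.hyps(1)] icube_sets[OF fi]
  define h where "h s x = (\<integral>\<^sup>+y. f (x(i := real_of_int s + y)) * indicator {-(1/2)..1/2} y \<partial>lborel)" for s :: int and x
  have upd [measurable]: "(\<lambda>(x, y). x(i := real_of_int s + y)) \<in> measurable (PiM I ?M \<Otimes>\<^sub>M borel) (PiM (insert i I) ?M)" for s
    by (simp add: case_prod_unfold) measurable
  have h [measurable]: "h s \<in> borel_measurable (PiM I ?M)" for s
  proof -
    have "(\<lambda>(x, y). f (x(i := real_of_int s + y))) \<in> borel_measurable (PiM I ?M \<Otimes>\<^sub>M lborel)"
      using measurable_compose[OF upd insert.prems(1)] by (simp add: case_prod_unfold cong: measurable_cong_sets)
    then show ?thesis unfolding h_def by measurable
  qed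
  have sl: "(\<lambda>y. f (x(i := y))) \<in> borel_measurable borel" if "x \<in> space (PiM I ?M)" for x
    using insert.hyps that
    by (auto intro!: measurable_compose[OF _ insert.prems(1)] measurable_fun_upd simp: space_PiM)
  have "(\<integral>\<^sup>+a. f a * indicator (icube (insert i I) r) a \<partial>PiM (insert i I) ?M)
     = (\<integral>\<^sup>+x. \<integral>\<^sup>+y. f (x(i := y)) * indicator (icube (insert i I) r) (x(i := y)) \<partial>lborel \<partial>PiM I ?M)"
    using insert.hyps by (intro lborel_prod.product_nn_integral_insert) measurable
  also have "\<dots> = (\<integral>\<^sup>+x. (\<Sum>s\<in>{-int q..int q}. h s x * indicator (icube I r) x) \<partial>PiM I ?M)"
  proof (rule nn_integral_cong)
    fix x assume x: "x \<in> space (PiM I ?M)"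
    have "(\<integral>\<^sup>+y. f (x(i := y)) * indicator (icube (insert i I) r) (x(i := y)) \<partial>lborel)
       = (\<integral>\<^sup>+y. indicator (icube I r) x * (f (x(i := y)) * indicator {-r..r} y) \<partial>lborel)"
      using indicator_icube_insert[OF x insert.hyps(2)] by (intro nn_integral_cong) (simp add: mult_ac)
    also have "\<dots> = indicator (icube I r) x * (\<integral>\<^sup>+y. f (x(i := y)) * indicator {-r..r} y \<partial>lborel)"
      by (rule nn_integral_cmult) (simp add: borel_measurable_times_ennreal[OF sl[OF x]])
    also have "(\<integral>\<^sup>+y. f (x(i := y)) * indicator {-r..r} y \<partial>lborel) = (\<Sum>s\<in>{-int q..int q}. h s x)"
      unfolding r_def h_def by (rule nn_integral_interval_split[OF sl[OF x]])
    finally show "(\<integral>\<^sup>+y. f (x(i := y)) * indicator (icube (insert i I) r) (x(i := y)) \<partial>lborel)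
       = (\<Sum>s\<in>{-int q..int q}. h s x * indicator (icube I r) x)"
      unfolding sum_distrib_right[symmetric] by (simp only: mult.commute)
  qed
  also have "\<dots> = (\<Sum>s\<in>{-int q..int q}. \<integral>\<^sup>+x. h s x * indicator (icube I r) x \<partial>PiM I ?M)"
    by (intro nn_integral_sum) measurable
  also have "\<dots> = (\<Sum>s\<in>{-int q..int q}. \<Sum>z\<in>grid I (\<lambda>_. lattice_pts q) (\<lambda>_. 0).
      \<integral>\<^sup>+x. h s (\<lambda>j\<in>I. z j + x j) * indicator (icube I (1/2)) x \<partial>PiM I ?M)"
    unfolding r_def by (intro sum.cong refl insert.IH h)
  also have "\<dots> = (\<Sum>s\<in>{-int q..int q}. \<Sum>z\<in>grid I (\<lambda>_. lattice_pts q) (\<lambda>_. 0).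
      \<integral>\<^sup>+a. f (\<lambda>j\<in>insert i I. (z(i := real_of_int s)) j + a j) * indicator (icube (insert i I) (1/2)) a \<partial>PiM (insert i I) ?M)"
  proof (intro sum.cong refl)
    fix s z
    have m: "(\<lambda>a. f (\<lambda>j\<in>insert i I. (z(i := real_of_int s)) j + a j)) \<in> borel_measurable (PiM (insert i I) ?M)"
      by (rule measurable_compose[OF measurable_PiM_coordwise[where g = "\<lambda>j t. (z(i := real_of_int s)) j + t"] insert.prems(1)]) simp
    have "(\<integral>\<^sup>+a. f (\<lambda>j\<in>insert i I. (z(i := real_of_int s)) j + a j) * indicator (icube (insert i I) (1/2)) a \<partial>PiM (insert i I) ?M)
      = (\<integral>\<^sup>+x. \<integral>\<^sup>+y. f (\<lambda>j\<in>insert i I. (z(i := real_of_int s)) j + (x(i := y)) j) * indicator (icube (insert i I) (1/2)) (x(i := y)) \<partial>lborel \<partial>PiM I ?M)"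
      using insert.hyps m by (intro lborel_prod.product_nn_integral_insert) measurable
    also have "\<dots> = (\<integral>\<^sup>+x. h s (\<lambda>j\<in>I. z j + x j) * indicator (icube I (1/2)) x \<partial>PiM I ?M)"
    proof (rule nn_integral_cong)
      fix x assume x: "x \<in> space (PiM I ?M)"
      have eq: "(\<lambda>j\<in>insert i I. (z(i := real_of_int s)) j + (x(i := y)) j) = (\<lambda>j\<in>I. z j + x j)(i := real_of_int s + y)" for y
        using insert.hyps by (auto simp: fun_eq_iff)
      have sp: "(\<lambda>j\<in>I. z j + x j) \<in> space (PiM I ?M)" by (simp add: space_PiM)
      have sl': "(\<lambda>y. f ((\<lambda>j\<in>I. z j + x j)(i := real_of_int s + y))) \<in> borel_measurable borel"
        by (rule measurable_compose[OF _ sl[OF sp]]) measurable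
      have "(\<integral>\<^sup>+y. f (\<lambda>j\<in>insert i I. (z(i := real_of_int s)) j + (x(i := y)) j) * indicator (icube (insert i I) (1/2)) (x(i := y)) \<partial>lborel)
        = (\<integral>\<^sup>+y. (f ((\<lambda>j\<in>I. z j + x j)(i := real_of_int s + y)) * indicator {-(1/2)..1/2} y) * indicator (icube I (1/2)) x \<partial>lborel)"
        unfolding eq using indicator_icube_insert[OF x insert.hyps(2)] by (intro nn_integral_cong) (simp add: mult_ac)
      also have "\<dots> = h s (\<lambda>j\<in>I. z j + x j) * indicator (icube I (1/2)) x"
        unfolding h_def using sl' by (intro nn_integral_multc) measurable
      finally show "(\<integral>\<^sup>+y. f (\<lambda>j\<in>insert i I. (z(i := real_of_int s)) j + (x(i := y)) j) * indicator (icube (insert i I) (1/2)) (x(i := y)) \<partial>lborel)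
        = h s (\<lambda>j\<in>I. z j + x j) * indicator (icube I (1/2)) x" .
    qed
    finally show "(\<integral>\<^sup>+x. h s (\<lambda>j\<in>I. z j + x j) * indicator (icube I (1/2)) x \<partial>PiM I ?M) =
      (\<integral>\<^sup>+a. f (\<lambda>j\<in>insert i I. (z(i := real_of_int s)) j + a j) * indicator (icube (insert i I) (1/2)) a \<partial>PiM (insert i I) ?M)" ..
  qed
  also have "\<dots> = (\<Sum>z\<in>grid (insert i I) (\<lambda>_. lattice_pts q) (\<lambda>_. 0).
      \<integral>\<^sup>+a. f (\<lambda>j\<in>insert i I. z j + a j) * indicator (icube (insert i I) (1/2)) a \<partial>PiM (insert i I) ?M)"
  proof -
    define G where "G z = (\<integral>\<^sup>+a. f (\<lambda>j\<in>insert i I. z j + a j) * indicator (icube (insert i I) (1/2)) a \<partial>PiM (insert i I) ?M)" for z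
    have "(\<Sum>s\<in>{-int q..int q}. \<Sum>z\<in>grid I (\<lambda>_. lattice_pts q) (\<lambda>_. 0). G (z(i := real_of_int s))) =
      (\<Sum>z\<in>grid I (\<lambda>_. lattice_pts q) (\<lambda>_. 0). \<Sum>s\<in>lattice_pts q. G (z(i := s)))"
      unfolding sum_lattice_pts by (rule sum.swap)
    also have "\<dots> = (\<Sum>z\<in>grid (insert i I) (\<lambda>_. lattice_pts q) (\<lambda>_. 0). G z)"
      using insert.hyps by (intro sum_grid_lines[symmetric] lattice_pts) auto
    finally show ?thesis by (simp only: G_def)
  qed
  finally show ?case by (simp only: r_def)
qed

lemma emeasure_icube:
  assumes "finite I" "r \<ge> 0"
  shows "(\<integral>\<^sup>+a. indicator (icube I r) a \<partial>PiM I (\<lambda>_. lborel)) = ennreal ((2 * r) ^ card I)"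
proof -
  have "emeasure (PiM I (\<lambda>_. lborel)) (icube I r) = (\<Prod>i\<in>I. emeasure lborel {-r..r})"
    unfolding icube_def using assms by (intro lborel_prod.emeasure_PiM) auto
  also have "\<dots> = ennreal ((2 * r) ^ card I)" using assms by (simp add: ennreal_power)
  finally show ?thesis using assms by simp
qed

text \<open>Mediates between points of the product space, which are \<open>undefined\<close> outside
  \<open>I\<close>, and grid points, which are 0 there.\<close>

definition zero_ext :: "'i set \<Rightarrow> ('i \<Rightarrow> real) \<Rightarrow> 'i \<Rightarrow> real" where
  "zero_ext I a = (\<lambda>i. if i \<in> I then a i else 0)"

context wall_function
begin

text \<open>By the tiling, the integral over the cube of half-side q + 1/2 is the mean, over shifts
  in the cube of half-side 1/2, of the shifted lattice sums, and each of these is within the error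
  of \<open>shift_bound\<close> of the unshifted sum. Homogeneity of \<open>f\<close> reduces the
  large cube to the unit cube and produces the power of q + 1/2.\<close>

lemma lattice_sum_approx:
  assumes meas: "(\<lambda>a. ennreal (f (zero_ext I a))) \<in> borel_measurable (PiM I (\<lambda>_. lborel))"
    and hom: "\<And>a c. c > 0 \<Longrightarrow> f (\<lambda>i. c * a i) = f a"
  shows "\<bar>sum f (grid I (\<lambda>_. lattice_pts q) (\<lambda>_. 0)) -
      (real q + 1/2) ^ card I * enn2real (\<integral>\<^sup>+a. ennreal (f (zero_ext I a)) * indicator (icube I 1) a \<partial>PiM I (\<lambda>_. lborel))\<bar>
    \<le> card I * (K * card L * D * card I * real (2 * q + 1) ^ (card I - 1))"
    (is "\<bar>?S - _ * enn2real ?V\<bar> \<le> ?E")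
proof -
  let ?M = "\<lambda>_. lborel :: real measure"
  note [measurable] = meas icube_sets[OF finI]
  have K: "0 \<le> K" by (rule order_trans[OF f0 fK])
  define r where "r = real q + 1/2"
  have r: "r > 0" by (simp add: r_def)
  define W where "W = (\<integral>\<^sup>+a. ennreal (f (zero_ext I a)) * indicator (icube I r) a \<partial>PiM I ?M)"
  have "W = ennreal (\<Prod>i\<in>I. \<bar>r\<bar>) * (\<integral>\<^sup>+a. ennreal (f (zero_ext I (\<lambda>i\<in>I. 0 + r * a i))) * indicator (icube I r) (\<lambda>i\<in>I. 0 + r * a i) \<partial>PiM I ?M)"
    unfolding W_def using r by (intro nn_integral_PiM_affine finI) measurable
  also have "(\<integral>\<^sup>+a. ennreal (f (zero_ext I (\<lambda>i\<in>I. 0 + r * a i))) * indicator (icube I r) (\<lambda>i\<in>I. 0 + r * a i) \<partial>PiM I ?M) = ?V"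
  proof (rule nn_integral_cong)
    fix a assume a: "a \<in> space (PiM I ?M)"
    have "zero_ext I (\<lambda>i\<in>I. 0 + r * a i) = (\<lambda>i. r * zero_ext I a i)" by (auto simp: zero_ext_def fun_eq_iff)
    moreover have "(\<lambda>i\<in>I. 0 + r * a i) \<in> icube I r \<longleftrightarrow> a \<in> icube I 1"
    proof -
      have "(- r \<le> r * x \<and> r * x \<le> r) = (- 1 \<le> x \<and> x \<le> 1)" for x
        using r mult_le_cancel_left_pos[of r "-1" x] mult_le_cancel_left_pos[of r x 1] by simp
      then show ?thesis using a by (auto simp: icube_def PiE_iff space_PiM)
    qed
    ultimately show "ennreal (f (zero_ext I (\<lambda>i\<in>I. 0 + r * a i))) * indicator (icube I r) (\<lambda>i\<in>I. 0 + r * a i)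
       = ennreal (f (zero_ext I a)) * indicator (icube I 1) a"
      using hom[OF r] by (simp add: indicator_def)
  qed
  finally have WV: "W = ennreal (r ^ card I) * ?V" using r by simp
  have "W = (\<Sum>z\<in>grid I (\<lambda>_. lattice_pts q) (\<lambda>_. 0). \<integral>\<^sup>+a. ennreal (f (zero_ext I (\<lambda>i\<in>I. z i + a i))) * indicator (icube I (1/2)) a \<partial>PiM I ?M)"
    unfolding W_def r_def by (rule nn_integral_icube_split[OF finI meas])
  also have "\<dots> = (\<integral>\<^sup>+a. (\<Sum>z\<in>grid I (\<lambda>_. lattice_pts q) (\<lambda>_. 0). ennreal (f (zero_ext I (\<lambda>i\<in>I. z i + a i))) * indicator (icube I (1/2)) a) \<partial>PiM I ?M)"
  proof (rule nn_integral_sum[symmetric])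
    fix z
    have "(\<lambda>a. ennreal (f (zero_ext I (\<lambda>i\<in>I. z i + a i)))) \<in> borel_measurable (PiM I ?M)"
      by (rule measurable_compose[OF measurable_PiM_coordwise[where g = "\<lambda>i t. z i + t"] meas]) simp
    then show "(\<lambda>a. ennreal (f (zero_ext I (\<lambda>i\<in>I. z i + a i))) * indicator (icube I (1/2)) a) \<in> borel_measurable (PiM I ?M)"
      by measurable
  qed
  also have "\<dots> = (\<integral>\<^sup>+a. ennreal (sum f (grid I (\<lambda>i. (\<lambda>s. s + a i) ` lattice_pts q) (\<lambda>_. 0))) * indicator (icube I (1/2)) a \<partial>PiM I ?M)"
  proof (rule nn_integral_cong)
    fix a
    have img: "grid I (\<lambda>i. (\<lambda>s. s + a i) ` lattice_pts q) (\<lambda>_. 0) = (\<lambda>z. zero_ext I (\<lambda>i\<in>I. z i + a i)) ` grid I (\<lambda>_. lattice_pts q) (\<lambda>_. 0)"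
    proof (intro equalityI subsetI)
      fix b assume b: "b \<in> grid I (\<lambda>i. (\<lambda>s. s + a i) ` lattice_pts q) (\<lambda>_. 0)"
      define z where "z i = (if i \<in> I then b i - a i else 0)" for i
      have "z \<in> grid I (\<lambda>_. lattice_pts q) (\<lambda>_. 0)" "b = zero_ext I (\<lambda>i\<in>I. z i + a i)"
        using b by (auto simp: grid_def z_def zero_ext_def fun_eq_iff)
      then show "b \<in> (\<lambda>z. zero_ext I (\<lambda>i\<in>I. z i + a i)) ` grid I (\<lambda>_. lattice_pts q) (\<lambda>_. 0)" by blast
    qed (auto simp: grid_def zero_ext_def)
    have inj: "inj_on (\<lambda>z. zero_ext I (\<lambda>i\<in>I. z i + a i)) (grid I (\<lambda>_. lattice_pts q) (\<lambda>_. 0))"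
    proof (rule inj_onI, rule ext)
      fix z w i assume zw: "z \<in> grid I (\<lambda>_. lattice_pts q) (\<lambda>_. 0)" "w \<in> grid I (\<lambda>_. lattice_pts q) (\<lambda>_. 0)"
        "zero_ext I (\<lambda>i\<in>I. z i + a i) = zero_ext I (\<lambda>i\<in>I. w i + a i)"
      show "z i = w i"
        using zw(1,2) fun_cong[OF zw(3), of i] unfolding grid_def zero_ext_def by (cases "i \<in> I") auto
    qed
    have "sum f (grid I (\<lambda>i. (\<lambda>s. s + a i) ` lattice_pts q) (\<lambda>_. 0)) = (\<Sum>z\<in>grid I (\<lambda>_. lattice_pts q) (\<lambda>_. 0). f (zero_ext I (\<lambda>i\<in>I. z i + a i)))"
      unfolding img using sum.reindex[OF inj] by (simp add: comp_def)
    then show "(\<Sum>z\<in>grid I (\<lambda>_. lattice_pts q) (\<lambda>_. 0). ennreal (f (zero_ext I (\<lambda>i\<in>I. z i + a i))) * indicator (icube I (1/2)) a)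
      = ennreal (sum f (grid I (\<lambda>i. (\<lambda>s. s + a i) ` lattice_pts q) (\<lambda>_. 0))) * indicator (icube I (1/2)) a"
      using f0 by (simp add: sum_ennreal flip: sum_distrib_right)
  qed
  finally have W: "W = \<dots>" .
  have close: "\<bar>?S - sum f (grid I (\<lambda>i. (\<lambda>s. s + a i) ` lattice_pts q) (\<lambda>_. 0))\<bar> \<le> ?E"
    if "a \<in> icube I (1/2)" for a
  proof -
    have "\<bar>a i\<bar> \<le> 1/2" if "i \<in> I" for i
      using \<open>a \<in> _\<close> that by (auto simp: icube_def PiE_iff abs_le_iff)
    from shift_bound[of a "lattice_pts q", OF this] lattice_pts[of q] show ?thesis by simp
  qed
  \<comment> \<open>The cube of shifts has volume 1, so integrating a constant over it returns the
    constant.\<close>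
  have one: "(\<integral>\<^sup>+a. indicator (icube I (1/2)) a \<partial>PiM I ?M) = 1"
    using emeasure_icube[OF finI, of "1/2"] by simp
  have S0: "?S \<ge> 0" by (intro sum_nonneg f0)
  have E0: "?E \<ge> 0" using K by simp
  have "W \<le> (\<integral>\<^sup>+a. ennreal (?S + ?E) * indicator (icube I (1/2)) a \<partial>PiM I ?M)"
    unfolding W
  proof (rule nn_integral_mono)
    fix a
    show "ennreal (sum f (grid I (\<lambda>i. (\<lambda>s. s + a i) ` lattice_pts q) (\<lambda>_. 0))) * indicator (icube I (1/2)) a
       \<le> ennreal (?S + ?E) * indicator (icube I (1/2)) a"
      using close[of a] by (auto simp: indicator_def intro!: ennreal_leI)
  qed
  also have "\<dots> = ennreal (?S + ?E)" by (subst nn_integral_cmult) (simp_all add: one del: nn_integral_indicator)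
  finally have up: "W \<le> ennreal (?S + ?E)" .
  have "ennreal (?S - ?E) = (\<integral>\<^sup>+a. ennreal (?S - ?E) * indicator (icube I (1/2)) a \<partial>PiM I ?M)"
    by (subst nn_integral_cmult) (simp_all add: one del: nn_integral_indicator)
  also have "\<dots> \<le> W"
    unfolding W
  proof (rule nn_integral_mono)
    fix a
    show "ennreal (?S - ?E) * indicator (icube I (1/2)) a \<le>
      ennreal (sum f (grid I (\<lambda>i. (\<lambda>s. s + a i) ` lattice_pts q) (\<lambda>_. 0))) * indicator (icube I (1/2)) a"
      using close[of a] by (auto simp: indicator_def intro!: ennreal_leI)
  qed
  finally have lo: "ennreal (?S - ?E) \<le> W" .
  have fin: "W < \<top>" using up ennreal_less_top le_less_trans by blast
  have "enn2real W = r ^ card I * enn2real ?V" using r by (simp add: WV enn2real_mult)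
  moreover have "enn2real W \<le> ?S + ?E" using up S0 E0 by (intro enn2real_leI) auto
  moreover have "?S - ?E \<le> enn2real W"
    using lo fin by (metis enn2real_nonneg ennreal_enn2real ennreal_le_iff)
  ultimately show ?thesis by (simp add: r_def abs_le_iff)
qed

end

subsection \<open>Real zeros as a measurable kernel\<close>

definition peval :: "nat \<Rightarrow> (nat \<Rightarrow> real) \<Rightarrow> real \<Rightarrow> real" where
  "peval N a x = (\<Sum>i<N. a i * x ^ i)"

definition vpoly :: "nat \<Rightarrow> (nat \<Rightarrow> real) \<Rightarrow> real poly" where
  "vpoly N a = (\<Sum>i<N. monom (a i) i)"

definition zeros :: "nat \<Rightarrow> (nat \<Rightarrow> real) \<Rightarrow> real set" where
  "zeros N a = {x. peval N a x = 0}"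

lemma peval_vpoly: "peval N a x = poly (vpoly N a) x"
  by (simp add: peval_def vpoly_def poly_sum poly_monom)

lemma coeff_vpoly: "coeff (vpoly N a) i = (if i < N then a i else 0)"
  by (simp add: vpoly_def coeff_sum sum.delta)

lemma peval_cong: "(\<And>i. i < N \<Longrightarrow> a i = b i) \<Longrightarrow> peval N a x = peval N b x"
  by (simp add: peval_def)

lemma vpoly_eq_0_iff: "vpoly N a = 0 \<longleftrightarrow> (\<forall>i<N. a i = 0)"
  by (auto simp: poly_eq_iff coeff_vpoly)

lemma degree_vpoly: "degree (vpoly N a) \<le> N - 1"
  by (rule degree_le) (auto simp: coeff_vpoly)

lemma finite_zeros_iff: "finite (zeros N a) \<longleftrightarrow> (\<exists>i<N. a i \<noteq> 0)"
proof
  assume "finite (zeros N a)"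
  show "\<exists>i<N. a i \<noteq> 0"
  proof (rule ccontr)
    assume "\<not> ?thesis"
    then have "zeros N a = UNIV" by (simp add: zeros_def peval_def)
    with \<open>finite (zeros N a)\<close> show False by (simp add: infinite_UNIV_char_0)
  qed
next
  assume "\<exists>i<N. a i \<noteq> 0"
  then have "vpoly N a \<noteq> 0" by (simp add: vpoly_eq_0_iff)
  then show "finite (zeros N a)" by (simp add: zeros_def peval_vpoly poly_roots_finite)
qed

lemma card_zeros: "finite (zeros N a) \<Longrightarrow> card (zeros N a) < N"
proof -
  assume "finite (zeros N a)"
  then obtain i where i: "i < N" "a i \<noteq> 0" by (auto simp: finite_zeros_iff)
  then have "vpoly N a \<noteq> 0" by (auto simp: vpoly_eq_0_iff)
  then have "card (zeros N a) \<le> N - 1"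
    unfolding zeros_def peval_vpoly by (rule card_roots_le) (rule degree_vpoly)
  with i show ?thesis by linarith
qed

lemma continuous_on_peval: "continuous_on UNIV (\<lambda>p. peval N (fst p) (snd p))"
  unfolding peval_def
  by (intro continuous_intros continuous_on_compose2[OF continuous_on_product_coordinates]) auto

text \<open>Tube lemma: nonvanishing on a compact set survives small changes of the coefficients. It
  yields both the measurability of zero sets and their stability along curves.\<close>

lemma open_nonroots: "compact A \<Longrightarrow> open {a. \<forall>x\<in>A. peval N a x \<noteq> 0}"
proof (subst open_subopen, safe)
  fix a assume A: "compact A" and a: "\<forall>x\<in>A. peval N a x \<noteq> 0"
  have "open ((\<lambda>p. peval N (fst p) (snd p)) -` (- {0}))"
    by (rule open_vimage[OF open_Compl[OF closed_singleton] continuous_on_peval])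
  then obtain X where "a \<in> X" "open X" "X \<times> A \<subseteq> (\<lambda>p. peval N (fst p) (snd p)) -` (- {0})"
  proof -
    have "{a} \<times> A \<subseteq> (\<lambda>p. peval N (fst p) (snd p)) -` (- {0})" using a by auto
    from Elementary_Topology.tube_lemma[OF A \<open>open _\<close> this] that show thesis by blast
  qed
  then show "\<exists>T. open T \<and> a \<in> T \<and> T \<subseteq> {a. \<forall>x\<in>A. peval N a x \<noteq> 0}"
    by (intro exI[of _ X]) auto
qed

lemma measurable_zero_ext: "zero_ext I \<in> measurable (PiM I (\<lambda>_. borel)) (borel :: (nat \<Rightarrow> real) measure)"
proof -
  have "zero_ext I \<in> measurable (PiM I (\<lambda>_. borel)) (PiM UNIV (\<lambda>_. borel :: real measure))"
  proof (rule measurable_PiM_single')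
    fix i
    show "(\<lambda>a. zero_ext I a i) \<in> borel_measurable (PiM I (\<lambda>_. borel))"
    proof (cases "i \<in> I")
      case True
      then show ?thesis using measurable_component_singleton[of i I "\<lambda>_. borel :: real measure"] by (simp add: zero_ext_def)
    qed (simp add: zero_ext_def)
  qed simp
  then show ?thesis by (simp add: sets_PiM_equal_borel cong: measurable_cong_sets)
qed

lemma measurable_hits_Icc:
  "Measurable.pred (PiM {..<N} (\<lambda>_. borel)) (\<lambda>a. zeros N a \<inter> {v..w} \<noteq> {})"
proof -
  have "Measurable.pred (borel :: (nat \<Rightarrow> real) measure) (\<lambda>a. \<forall>x\<in>{v..w}. peval N a x \<noteq> 0)"
    using open_nonroots[OF compact_Icc, of v w N] by (intro pred_def[THEN iffD2]) (simp add: borel_open)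
  from measurable_compose[OF measurable_zero_ext[of "{..<N}"] this]
  have [measurable]: "Measurable.pred (PiM {..<N} (\<lambda>_. borel)) (\<lambda>a. \<forall>x\<in>{v..w}. peval N (zero_ext {..<N} a) x \<noteq> 0)" .
  have "peval N (zero_ext {..<N} a) x = peval N a x" for a x
    by (rule peval_cong) (simp add: zero_ext_def)
  then have eq: "(\<lambda>a. zeros N a \<inter> {v..w} \<noteq> {}) = (\<lambda>a. \<not> (\<forall>x\<in>{v..w}. peval N (zero_ext {..<N} a) x \<noteq> 0))"
    by (auto simp: zeros_def fun_eq_iff)
  show ?thesis unfolding eq by measurable
qed

lemma measurable_hits_Ioc:
  "Measurable.pred (PiM {..<N} (\<lambda>_. borel)) (\<lambda>a. zeros N a \<inter> {v<..w} \<noteq> {})"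
proof -
  note [measurable] = measurable_hits_Icc
  have "{v<..w} = (\<Union>l::nat. {v + 1 / Suc l..w})"
  proof (intro equalityI subsetI)
    fix x assume x: "x \<in> {v<..w}"
    then obtain l where "inverse (real (Suc l)) < x - v" using reals_Archimedean[of "x - v"] by auto
    then show "x \<in> (\<Union>l::nat. {v + 1 / Suc l..w})" using x by (auto simp: inverse_eq_divide intro!: exI[of _ l])
  qed (auto simp: less_le_trans[of _ "_ + _"] intro: less_le_trans[rotated])
  then have eq: "(\<lambda>a. zeros N a \<inter> {v<..w} \<noteq> {}) = (\<lambda>a. \<exists>l::nat. zeros N a \<inter> {v + 1 / Suc l..w} \<noteq> {})"
    by (simp only: fun_eq_iff) blast
  show ?thesis unfolding eq by measurable
qed

lemma eventually_inj_ceiling: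
  assumes "finite (R :: real set)"
  shows "eventually (\<lambda>m::nat. inj_on (\<lambda>x. \<lceil>x * m\<rceil>) R) sequentially"
proof -
  have "eventually (\<lambda>m::nat. x \<noteq> y \<longrightarrow> \<lceil>x * m\<rceil> \<noteq> \<lceil>y * m\<rceil>) sequentially" for x y :: real
  proof (cases "x = y")
    case False
    obtain m0 :: nat where m0: "1 / \<bar>x - y\<bar> < m0" using reals_Archimedean2 by blast
    have "\<lceil>x * m\<rceil> \<noteq> \<lceil>y * m\<rceil>" if "m0 \<le> m" for m :: nat
    proof
      assume eq: "\<lceil>x * m\<rceil> = \<lceil>y * m\<rceil>"
      have "1 < \<bar>x - y\<bar> * m0" using m0 False by (simp add: field_simps)
      also have "\<dots> \<le> \<bar>x - y\<bar> * m" using that by (intro mult_left_mono) auto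
      also have "\<dots> = \<bar>x * m - y * m\<bar>" by (simp add: abs_mult flip: left_diff_distrib)
      also have "\<dots> < 1" using eq by linarith
      finally show False .
    qed
    then show ?thesis by (auto simp: eventually_sequentially)
  qed simp
  then have "eventually (\<lambda>m::nat. \<forall>x\<in>R. \<forall>y\<in>R. x \<noteq> y \<longrightarrow> \<lceil>x * m\<rceil> \<noteq> \<lceil>y * m\<rceil>) sequentially"
    using assms by (intro eventually_ball_finite ballI)
  then show ?thesis by (rule eventually_mono) (auto simp: inj_on_def)
qed

text \<open>The number of zeros is the limit of the number of cells of width 1/(m + 1) that contain
  a zero: the two agree as soon as the cells separate the finitely many zeros. Whether a cell is hit
  is measurable.\<close>

lemma measurable_card_zeros_Ioc:
  "(\<lambda>a. if finite (zeros N a) then real (card (zeros N a \<inter> {v<..w})) else 0) \<in> borel_measurable (PiM {..<N} (\<lambda>_. borel))"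
proof -
  note [measurable] = measurable_hits_Ioc
  \<comment> \<open>\<open>max\<close> and \<open>min\<close> clip the outermost cells to the
    interval from \<open>v\<close> to \<open>w\<close>.\<close>
  define cnt where "cnt m a = (\<Sum>i\<in>{\<lceil>v * real (Suc m)\<rceil>..\<lceil>w * real (Suc m)\<rceil>}.
    if zeros N a \<inter> {max v ((real_of_int i - 1) / real (Suc m))<..min w (real_of_int i / real (Suc m))} \<noteq> {} then 1 else 0 :: real)" for m a
  have fin: "Measurable.pred (PiM {..<N} (\<lambda>_. borel)) (\<lambda>a. finite (zeros N a))"
    unfolding finite_zeros_iff by measurable
  have [measurable]: "(\<lambda>a. if finite (zeros N a) then cnt m a else 0) \<in> borel_measurable (PiM {..<N} (\<lambda>_. borel))" for m
    unfolding cnt_def using fin by measurable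
  show ?thesis
  proof (rule borel_measurable_LIMSEQ_real)
    fix a
    show "(\<lambda>m. if finite (zeros N a) then cnt m a else 0) \<longlonglongrightarrow> (if finite (zeros N a) then real (card (zeros N a \<inter> {v<..w})) else 0)"
    proof (cases "finite (zeros N a)")
      case True
      define R where "R = zeros N a \<inter> {v<..w}"
      have "finite R" using True by (simp add: R_def)
      then have "eventually (\<lambda>m. inj_on (\<lambda>x. \<lceil>x * real (Suc m)\<rceil>) R) sequentially"
        using eventually_inj_ceiling[of R] by (simp add: eventually_sequentially_Suc[of "\<lambda>m. inj_on (\<lambda>x. \<lceil>x * real m\<rceil>) R"] del: of_nat_Suc)
      then have "eventually (\<lambda>m. cnt m a = real (card R)) sequentially"
      proof (rule eventually_mono)
        fix m assume inj: "inj_on (\<lambda>x. \<lceil>x * real (Suc m)\<rceil>) R"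
        define idx where "idx x = \<lceil>x * real (Suc m)\<rceil>" for x
        have cell: "zeros N a \<inter> {max v ((real_of_int i - 1) / real (Suc m))<..min w (real_of_int i / real (Suc m))}
          = {x \<in> R. idx x = i}" for i
        proof -
          have "idx x = i \<longleftrightarrow> (real_of_int i - 1) / real (Suc m) < x \<and> x \<le> real_of_int i / real (Suc m)" for x
            unfolding idx_def ceiling_eq_iff by (simp add: pos_divide_less_eq pos_le_divide_eq)
          then have idx: "{x \<in> R. idx x = i} = {x \<in> R. (real_of_int i - 1) / real (Suc m) < x \<and> x \<le> real_of_int i / real (Suc m)}"
            by simp
          show ?thesis unfolding idx unfolding R_def by auto
        qed
        have "cnt m a = (\<Sum>i\<in>{\<lceil>v * real (Suc m)\<rceil>..\<lceil>w * real (Suc m)\<rceil>}. if i \<in> idx ` R then 1 else 0)"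
          unfolding cnt_def cell by (intro sum.cong refl if_cong) auto
        also have "\<dots> = real (card ({\<lceil>v * real (Suc m)\<rceil>..\<lceil>w * real (Suc m)\<rceil>} \<inter> idx ` R))"
          by (simp add: sum.inter_restrict[symmetric])
        also have "{\<lceil>v * real (Suc m)\<rceil>..\<lceil>w * real (Suc m)\<rceil>} \<inter> idx ` R = idx ` R"
        proof -
          have "idx x \<in> {\<lceil>v * real (Suc m)\<rceil>..\<lceil>w * real (Suc m)\<rceil>}" if "x \<in> R" for x
            unfolding idx_def atLeastAtMost_iff using that
            by (intro conjI ceiling_mono mult_right_mono) (auto simp: R_def)
          then show ?thesis by blast
        qed
        also have "card (idx ` R) = card R" unfolding idx_def by (rule card_image[OF inj])
        finally show "cnt m a = real (card R)" .
      qed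
      then show ?thesis using True by (simp add: tendsto_eventually R_def)
    qed simp
  qed measurable
qed

text \<open>The factor \<open>1 / N\<close> makes the kernel a subprobability, so that the measurability theory of
  \<open>subprob_algebra\<close> applies.\<close>

definition zero_kernel :: "nat \<Rightarrow> (nat \<Rightarrow> real) \<Rightarrow> real measure" where
  "zero_kernel N a = scale_measure (inverse (of_nat N)) (distr (count_space (if finite (zeros N a) then zeros N a else {})) borel (\<lambda>x. x))"

lemma zero_kernel_sets [simp]: "sets (zero_kernel N a) = sets borel" "space (zero_kernel N a) = UNIV"
  by (simp_all add: zero_kernel_def space_scale_measure)

text \<open>For an infinite zero set both sides are 0: the kernel is then the zero measure, and
  \<open>sum\<close> over an infinite set is 0.\<close>

lemma nn_integral_zero_kernel:
  assumes "f \<in> borel_measurable borel"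
  shows "(\<integral>\<^sup>+x. f x \<partial>zero_kernel N a) = inverse (of_nat N) * (\<Sum>x\<in>zeros N a. f x)"
  using assms unfolding zero_kernel_def
  by (subst nn_integral_scale_measure) (auto simp: nn_integral_distr nn_integral_count_space_finite)

lemma emeasure_zero_kernel:
  assumes "A \<in> sets borel"
  shows "emeasure (zero_kernel N a) A = inverse (of_nat N) * ennreal (if finite (zeros N a) then real (card (zeros N a \<inter> A)) else 0)"
proof -
  have "emeasure (zero_kernel N a) A = (\<integral>\<^sup>+x. indicator A x \<partial>zero_kernel N a)" using assms by simp
  also have "\<dots> = inverse (of_nat N) * (\<Sum>x\<in>zeros N a. indicator A x)"
    using assms by (intro nn_integral_zero_kernel) auto
  also have "(\<Sum>x\<in>zeros N a. indicator A x :: ennreal) = ennreal (if finite (zeros N a) then real (card (zeros N a \<inter> A)) else 0)"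
    by (auto simp: indicator_def sum.If_cases ennreal_of_nat_eq_real_of_nat Int_def)
  finally show ?thesis .
qed

lemma inverse_mult_le_one:
  assumes "c < N"
  shows "inverse (of_nat N) * ennreal (real c) \<le> 1"
proof -
  have "inverse (of_nat N) * ennreal (real c) = ennreal (real c / real N)"
    using assms by (simp add: divide_ennreal ennreal_of_nat_eq_real_of_nat flip: divide_ennreal_def) (metis divide_ennreal divide_ennreal_def mult.commute of_nat_0_le_iff of_nat_0_less_iff gr_zeroI not_less_zero)
  also have "\<dots> \<le> 1" using assms by (simp add: ennreal_le_1)
  finally show ?thesis .
qed

lemma measurable_zero_kernel: "zero_kernel N \<in> measurable (PiM {..<N} (\<lambda>_. borel)) (subprob_algebra borel)"
proof (rule measurable_subprob_algebra_generated[where \<Omega> = UNIV and G = "range (\<lambda>(u, v). {u<..v :: real})"])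
  show "sets borel = sigma_sets UNIV (range (\<lambda>(u, v). {u<..v :: real}))"
    by (subst borel_sigma_sets_Ioc) simp
  show "Int_stable (range (\<lambda>(u, v). {u<..v :: real}))"
  proof (rule Int_stableI, clarify)
    fix a b c d :: real
    have "{a<..b} \<inter> {c<..d} = {max a c<..min b d}" by auto
    then show "{a<..b} \<inter> {c<..d} \<in> range (\<lambda>(u, v). {u<..v})" by auto
  qed
  show "subprob_space (zero_kernel N a)" for a
  proof (rule subprob_spaceI)
    show "space (zero_kernel N a) \<noteq> {}" by simp
    show "emeasure (zero_kernel N a) (space (zero_kernel N a)) \<le> 1"
      using card_zeros[of N a] inverse_mult_le_one by (simp add: emeasure_zero_kernel)
  qed
  show "(\<lambda>a. emeasure (zero_kernel N a) A) \<in> borel_measurable (PiM {..<N} (\<lambda>_. borel))"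
    if "A \<in> range (\<lambda>(u, v). {u<..v :: real})" for A
  proof -
    obtain u v where A: "A = {u<..v}" using \<open>A \<in> _\<close> by auto
    note [measurable] = measurable_card_zeros_Ioc
    show ?thesis unfolding A by (subst emeasure_zero_kernel) measurable
  qed
  show "(\<lambda>a. emeasure (zero_kernel N a) UNIV) \<in> borel_measurable (PiM {..<N} (\<lambda>_. borel))"
  proof -
    note [measurable] = measurable_card_zeros_Ioc
    \<comment> \<open>The whole line is no half-open interval; its mass is the limit along an
      exhausting sequence of such intervals.\<close>
    have "emeasure (zero_kernel N a) UNIV = (SUP i::nat. emeasure (zero_kernel N a) {- real i<..real i})" for a
    proof -
      have "x \<in> (\<Union>i::nat. {- real i<..real i})" for x :: real
      proof -
        obtain i :: nat where "\<bar>x\<bar> < i" using reals_Archimedean2 by blast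
        then have "x \<in> {- real i<..real i}" by (simp add: abs_less_iff)
        then show ?thesis by blast
      qed
      then have "(\<Union>i::nat. {- real i<..real i}) = UNIV" by blast
      moreover have "(SUP i::nat. emeasure (zero_kernel N a) {- real i<..real i}) = emeasure (zero_kernel N a) (\<Union>i::nat. {- real i<..real i})"
        by (rule SUP_emeasure_incseq) (auto simp: incseq_def)
      ultimately show ?thesis by simp
    qed
    then show ?thesis by (simp add: emeasure_zero_kernel)
  qed
qed auto

text \<open>The purpose of the kernel: a sum over the roots of a varying polynomial becomes an
  integral against a measurable kernel, so no measurable enumeration of the roots is
  required.\<close>

lemma measurable_sum_zeros:
  fixes G :: "'z \<Rightarrow> real \<Rightarrow> ennreal"
  assumes A: "A \<in> measurable M (PiM {..<N} (\<lambda>_. borel))"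
    and G: "(\<lambda>(z, x). G z x) \<in> borel_measurable (M \<Otimes>\<^sub>M borel)"
  shows "(\<lambda>z. \<Sum>x\<in>zeros N (A z). G z x) \<in> borel_measurable M"
proof (cases "N = 0")
  case True
  then show ?thesis by (simp add: zeros_def peval_def infinite_UNIV_char_0)
next
  case False
  have [measurable]: "(\<lambda>z. \<integral>\<^sup>+x. G z x \<partial>zero_kernel N (A z)) \<in> borel_measurable M"
    using G measurable_compose[OF A measurable_zero_kernel] by (rule nn_integral_measurable_subprob_algebra2)
  have "(\<Sum>x\<in>zeros N (A z). G z x) = of_nat N * (\<integral>\<^sup>+x. G z x \<partial>zero_kernel N (A z))" if "z \<in> space M" for z
  proof -
    have "G z \<in> borel_measurable borel" using measurable_compose[OF measurable_Pair1'[OF that] G] by simp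
    then show ?thesis using False
      by (simp add: nn_integral_zero_kernel mult.assoc[symmetric] ennreal_of_nat_eq_real_of_nat ennreal_inverse_mult ennreal_mult_divide_eq flip: divide_ennreal_def)
  qed
  then show ?thesis by (subst measurable_cong) auto
qed

subsection \<open>The area formula for zeros\<close>

lemma borel_measurable_poly [measurable]: "poly (p :: real poly) \<in> borel_measurable borel"
  by (intro borel_measurable_continuous_onI continuous_intros)

lemma zeros_update_0:
  assumes "N > 0"
  shows "zeros N (a(0 := - y)) = {x. (\<Sum>i\<in>{1..<N}. a i * x ^ i) = y}"
proof -
  have "peval N (a(0 := - y)) x = - y + (\<Sum>i\<in>{1..<N}. a i * x ^ i)" for x
  proof -
    have "{..<N} = insert 0 {1..<N}" using assms by auto
    then have "peval N (a(0 := - y)) x = - y + (\<Sum>i\<in>{1..<N}. (a(0 := - y)) i * x ^ i)"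
      unfolding peval_def by simp
    also have "(\<Sum>i\<in>{1..<N}. (a(0 := - y)) i * x ^ i) = (\<Sum>i\<in>{1..<N}. a i * x ^ i)"
      by (rule sum.cong) auto
    finally show ?thesis .
  qed
  then show ?thesis by (auto simp: zeros_def)
qed

lemma emeasure_lborel_affine_Ioc:
  fixes s c d :: real
  assumes "s = 1 \<or> s = -1" "c \<le> d"
  shows "emeasure lborel {y. c < s * y \<and> s * y \<le> d} = ennreal (d - c)"
proof (cases "s = 1")
  case True
  then have "{y. c < s * y \<and> s * y \<le> d} = {c<..d}" by auto
  then show ?thesis using assms by simp
next
  case False
  then have "{y. c < s * y \<and> s * y \<le> d} = {-d..<-c}" using assms by auto
  then show ?thesis using assms by simp
qed

text \<open>The area formula on the line: both sides are measures of the set \<open>S\<close> when \<open>G\<close> is the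
  indicator of \<open>S\<close>, and they agree on half-open intervals without interior critical points.\<close>

lemma nn_integral_sum_zeros_line:
  fixes q :: "real poly" and G :: "real \<Rightarrow> ennreal"
  assumes N: "N > 0" and q: "\<And>x. poly q x = (\<Sum>i\<in>{1..<N}. a i * x ^ i)"
    and a: "a \<in> space (PiM {1..<N} (\<lambda>_. borel))"
    and G: "G \<in> borel_measurable borel"
  shows "(\<integral>\<^sup>+y. (\<Sum>x\<in>zeros N (a(0 := y)). G x) \<partial>lborel) = (\<integral>\<^sup>+x. \<bar>poly (pderiv q) x\<bar> * G x \<partial>lborel)"
proof (cases "pderiv q = 0")
  \<comment> \<open>A constant \<open>q\<close> has empty level sets except for one, which is the
    whole line and contributes 0 by the convention on infinite sums.\<close>
  case True
  then obtain c where c: "q = [:c:]" using pderiv_iszero by blast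
  have "(\<Sum>x\<in>zeros N (a(0 := y)). G x) = 0" for y
  proof -
    have "zeros N (a(0 := y)) = {x. poly q x = - y}"
      using zeros_update_0[OF N, of a "- y"] q by simp
    then have "zeros N (a(0 := y)) = (if c = - y then UNIV else {})" using c by auto
    then show ?thesis by (simp add: infinite_UNIV_char_0)
  qed
  then show ?thesis using True by simp
next
  case False
  define Z where "Z y = zeros N (a(0 := y))" for y
  have Z: "Z y = {x. poly q x = - y}" for y
    using zeros_update_0[OF N, of a "- y"] q by (simp add: Z_def)
  have finZ: "finite (Z y)" for y
  proof -
    have "q + [:y:] \<noteq> 0"
    proof
      assume "q + [:y:] = 0"
      then have "pderiv (q + [:y:]) = 0" by simp
      then show False using False by (simp add: pderiv_add pderiv_pCons)
    qed
    then have "finite {x. poly (q + [:y:]) x = 0}" by (rule poly_roots_finite)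
    moreover have "{x. poly (q + [:y:]) x = 0} = Z y" unfolding Z by (simp add: eq_neg_iff_add_eq_0)
    ultimately show ?thesis by simp
  qed
  have "(\<lambda>y. a(0 := y)) \<in> measurable borel (PiM (insert 0 {1..<N}) (\<lambda>_. borel))"
    using a by (intro measurable_fun_upd[where J = "{1..<N}"]) auto
  moreover have "insert 0 {1..<N} = {..<N}" using N by auto
  ultimately have "(\<lambda>y. a(0 := y)) \<in> measurable borel (PiM {..<N} (\<lambda>_. borel))" by simp
  from measurable_compose[OF this measurable_zero_kernel]
  have K: "(\<lambda>y. zero_kernel N (a(0 := y))) \<in> measurable lborel (subprob_algebra borel)" by simp
  \<comment> \<open>Up to the factor 1/N, \<open>\<mu>\<close> measures a set by the number of
    preimages integrated over all levels, and \<open>\<nu>\<close> has density |q'|; equality of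
    these measures is the formula.\<close>
  define \<mu> where "\<mu> = lborel \<bind> (\<lambda>y. zero_kernel N (a(0 := y)))"
  define w where "w x = inverse (of_nat N) * ennreal \<bar>poly (pderiv q) x\<bar>" for x
  define \<nu> where "\<nu> = density lborel w"
  have [measurable]: "w \<in> borel_measurable borel" unfolding w_def by measurable
  have sets\<mu> [simp]: "sets \<mu> = sets borel"
    unfolding \<mu>_def using sets_kernel[OF K] by (intro sets_bind) auto
  have sets\<nu> [simp]: "sets \<nu> = sets borel" by (simp add: \<nu>_def)
  have \<mu>: "emeasure \<mu> A = inverse (of_nat N) * (\<integral>\<^sup>+y. of_nat (card (Z y \<inter> A)) \<partial>lborel)" if A: "A \<in> sets borel" for A
  proof -
    have "emeasure \<mu> A = (\<integral>\<^sup>+y. emeasure (zero_kernel N (a(0 := y))) A \<partial>lborel)"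
      unfolding \<mu>_def using A by (intro emeasure_bind[OF _ K]) auto
    also have "\<dots> = (\<integral>\<^sup>+y. inverse (of_nat N) * of_nat (card (Z y \<inter> A)) \<partial>lborel)"
      using finZ by (intro nn_integral_cong) (simp add: emeasure_zero_kernel[OF A] Z_def ennreal_of_nat_eq_real_of_nat)
    also have "\<dots> = inverse (of_nat N) * (\<integral>\<^sup>+y. of_nat (card (Z y \<inter> A)) \<partial>lborel)"
    proof (rule nn_integral_cmult)
      have "(\<lambda>y. \<Sum>x\<in>zeros N (a(0 := y)). indicator A x :: ennreal) \<in> borel_measurable borel"
      proof (rule measurable_sum_zeros)
        note [measurable] = A
        show "(\<lambda>(y, x). indicator A x :: ennreal) \<in> borel_measurable (borel \<Otimes>\<^sub>M borel)" by measurable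
      qed fact
      also have "(\<lambda>y. \<Sum>x\<in>zeros N (a(0 := y)). indicator A x :: ennreal) = (\<lambda>y. of_nat (card (Z y \<inter> A)))"
        using finZ by (auto simp: Z_def indicator_def sum.If_cases Int_def)
      finally show "(\<lambda>y. of_nat (card (Z y \<inter> A)) :: ennreal) \<in> borel_measurable lborel" by simp
    qed
    finally show ?thesis .
  qed
  define C where "C = {x. poly (pderiv q) x = 0}"
  have C: "finite C" unfolding C_def using False by (rule poly_roots_finite)
  have Ioc: "emeasure \<mu> {u<..v} = emeasure \<nu> {u<..v}" if "u \<le> v" for u v
    using that
  \<comment> \<open>Split at an interior critical point until none is left; then \<open>q\<close> is
    strictly monotone on the interval and both measures equal |q v - q u| / N.\<close>
  proof (induction "card (C \<inter> {u<..<v})" arbitrary: u v rule: less_induct)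
    case less
    show ?case
    proof (cases "C \<inter> {u<..<v} = {}")
      case False
      then obtain c where c: "c \<in> C" "u < c" "c < v" by auto
      have "C \<inter> {u<..<c} \<subset> C \<inter> {u<..<v}" "C \<inter> {c<..<v} \<subset> C \<inter> {u<..<v}" using c by auto
      then have "emeasure \<mu> {u<..c} = emeasure \<nu> {u<..c}" "emeasure \<mu> {c<..v} = emeasure \<nu> {c<..v}"
        using c C by (auto intro!: less.hyps psubset_card_mono)
      moreover have "{u<..v} = {u<..c} \<union> {c<..v}" "{u<..c} \<inter> {c<..v} = {}" using c by auto
      ultimately show ?thesis by (simp flip: plus_emeasure)
    next
      case True
      show ?thesis
      proof (cases "u = v")
        case False
        then have uv: "u < v" using less.prems by simp
        have nz: "poly (pderiv q) x \<noteq> 0" if "x \<in> {u<..<v}" for x using True that by (auto simp: C_def)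
        define m where "m = (u + v) / 2"
        have m: "m \<in> {u<..<v}" using uv by (simp add: m_def field_simps)
        \<comment> \<open>The sign for which \<open>s * q\<close> is increasing; the intermediate
          value theorem shows that the derivative keeps this sign inside the interval.\<close>
        define s :: real where "s = (if poly (pderiv q) m > 0 then 1 else -1)"
        have s: "s = 1 \<or> s = -1" "s * s = 1" by (auto simp: s_def)
        have pos: "s * poly (pderiv q) x > 0" if x: "x \<in> {u<..<v}" for x
        proof (rule ccontr)
          assume neg: "\<not> ?thesis"
          define p where "p = smult s (pderiv q)"
          have pm: "poly p m > 0" using nz[OF m] by (auto simp: s_def p_def)
          have px: "poly p x < 0" using neg nz[OF x] s by (auto simp: p_def)
          have "x \<noteq> m" using pm px by auto
          then consider "x < m" | "m < x" by linarith
          then show False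
          proof cases
            case 1
            obtain z where "z > x" "z < m" "poly p z = 0" using poly_IVT_pos[OF 1 px pm] by blast
            then show False using nz[of z] x m s by (auto simp: p_def)
          next
            case 2
            obtain z where "z > m" "z < x" "poly p z = 0" using poly_IVT_neg[OF 2 pm px] by blast
            then show False using nz[of z] x m s by (auto simp: p_def)
          qed
        qed
        have mono: "s * poly q x < s * poly q y" if "u \<le> x" "x < y" "y \<le> v" for x y
        proof -
          have "\<exists>z. x < z \<and> z < y \<and> poly (smult s q) y - poly (smult s q) x = (y - x) * poly (pderiv (smult s q)) z"
            by (rule poly_MVT[OF that(2)])
          then obtain z where z: "x < z" "z < y" "poly (smult s q) y - poly (smult s q) x = (y - x) * poly (pderiv (smult s q)) z"
            by blast
          have "s * poly (pderiv q) z > 0" using z that by (intro pos) auto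
          then have "(y - x) * poly (pderiv (smult s q)) z > 0" using that by (simp add: pderiv_smult)
          then show ?thesis using z(3) by simp
        qed
        have img: "(\<exists>x\<in>{u<..v}. poly q x = - y) \<longleftrightarrow> s * poly q u < - s * y \<and> - s * y \<le> s * poly q v" for y
        proof
          assume "\<exists>x\<in>{u<..v}. poly q x = - y"
          then obtain x where x: "u < x" "x \<le> v" "poly q x = - y" by auto
          have "s * poly q u < s * poly q x" using x by (intro mono) auto
          moreover have "s * poly q x \<le> s * poly q v" using mono[of x v] x by (cases "x = v") auto
          ultimately show "s * poly q u < - s * y \<and> - s * y \<le> s * poly q v" using x by simp
        next
          assume y: "s * poly q u < - s * y \<and> - s * y \<le> s * poly q v"
          have "\<exists>x\<ge>u. x \<le> v \<and> poly (smult s q) x = - s * y"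
            using y uv by (intro IVT') (auto intro!: continuous_intros)
          then obtain x where x: "u \<le> x" "x \<le> v" "s * poly q x = - s * y" by auto
          have "x \<noteq> u" using x y by auto
          moreover have "poly q x = - y" using x(3) s(1) by auto
          ultimately show "\<exists>x\<in>{u<..v}. poly q x = - y" using x by (intro bexI[of _ x]) auto
        qed
        have cardZ: "card (Z y \<inter> {u<..v}) = (if s * poly q u < - s * y \<and> - s * y \<le> s * poly q v then 1 else 0)" for y
        proof (cases "\<exists>x\<in>{u<..v}. poly q x = - y")
          case T: True
          then obtain x where x: "x \<in> {u<..v}" "poly q x = - y" by blast
          have "x' = x" if "x' \<in> {u<..v}" "poly q x' = - y" for x'
            using mono[of x x'] mono[of x' x] that x by (cases x x' rule: linorder_cases) auto
          then have "Z y \<inter> {u<..v} = {x}" using x unfolding Z by blast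
          then show ?thesis using T img[of y] by simp
        next
          case F: False
          then have "Z y \<inter> {u<..v} = {}" unfolding Z by blast
          then show ?thesis using F img[of y] by simp
        qed
        have le: "s * poly q u \<le> s * poly q v" using mono[of u v] uv by simp
        have "(\<integral>\<^sup>+y. of_nat (card (Z y \<inter> {u<..v})) \<partial>lborel)
            = (\<integral>\<^sup>+y. indicator {y. s * poly q u < - s * y \<and> - s * y \<le> s * poly q v} y \<partial>lborel)"
          by (intro nn_integral_cong) (simp add: cardZ indicator_def)
        also have "\<dots> = emeasure lborel {y. s * poly q u < - s * y \<and> - s * y \<le> s * poly q v}"
          by (rule nn_integral_indicator) simp
        also have "\<dots> = ennreal (s * poly q v - s * poly q u)"
          using s(1) le by (intro emeasure_lborel_affine_Ioc) auto
        finally have 1: "emeasure \<mu> {u<..v} = inverse (of_nat N) * ennreal (s * poly q v - s * poly q u)"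
          by (subst \<mu>) auto
        have "emeasure \<nu> {u<..v} = (\<integral>\<^sup>+x. w x * indicator {u<..v} x \<partial>lborel)"
          unfolding \<nu>_def by (rule emeasure_density) auto
        also have "\<dots> = (\<integral>\<^sup>+x. inverse (of_nat N) * (ennreal (poly (pderiv (smult s q)) x) * indicator {u..v} x) \<partial>lborel)"
        proof (rule nn_integral_cong_AE)
          have "AE x in lborel. x \<notin> {u, v}" by (rule AE_not_in) (rule finite_imp_null_set_lborel, simp)
          then show "AE x in lborel. w x * indicator {u<..v} x = inverse (of_nat N) * (ennreal (poly (pderiv (smult s q)) x) * indicator {u..v} x)"
          proof (rule AE_mp, intro AE_I2 impI)
            fix x assume x: "x \<notin> {u, v}"
            show "w x * indicator {u<..v} x = inverse (of_nat N) * (ennreal (poly (pderiv (smult s q)) x) * indicator {u..v} x)"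
            proof (cases "x \<in> {u<..<v}")
              case True
              have "\<bar>poly (pderiv q) x\<bar> = s * poly (pderiv q) x" using pos[OF True] s(1) by (auto simp: abs_if)
              then show ?thesis using True by (simp add: w_def pderiv_smult)
            next
              case False
              then show ?thesis using x by (auto simp: indicator_def)
            qed
          qed
        qed
        also have "\<dots> = inverse (of_nat N) * (\<integral>\<^sup>+x. ennreal (poly (pderiv (smult s q)) x) * indicator {u..v} x \<partial>lborel)"
          by (rule nn_integral_cmult) measurable
        also have "(\<integral>\<^sup>+x. ennreal (poly (pderiv (smult s q)) x) * indicator {u..v} x \<partial>lborel) = ennreal (poly (smult s q) v - poly (smult s q) u)"
        proof (rule nn_integral_FTC_Icc)
          \<comment> \<open>The endpoints may themselves be critical; there the sign follows from
            the interior by continuity.\<close>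
          show "0 \<le> poly (pderiv (smult s q)) x" if x: "x \<in> {u..v}" for x
          proof (rule ccontr)
            assume neg: "\<not> ?thesis"
            have "\<forall>\<^sub>F z in at x. poly (pderiv (smult s q)) z < 0"
              using neg by (intro order_tendstoD(2)[OF poly_isCont[unfolded isCont_def]]) auto
            then obtain e where e: "e > 0" "\<And>z. z \<noteq> x \<Longrightarrow> dist z x < e \<Longrightarrow> poly (pderiv (smult s q)) z < 0"
              unfolding eventually_at by auto
            define d where "d = min (e / 2) ((v - u) / 2)"
            define z where "z = (if x = u then u + d else v - d)"
            have d: "d > 0" "d < e" "d \<le> (v - u) / 2" using e uv by (auto simp: d_def min_def)
            have "x = u \<or> x = v" using pos[of x] neg x by (cases "x \<in> {u<..<v}") (auto simp: pderiv_smult)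
            then have "z \<noteq> x" "dist z x < e" using d uv by (auto simp: z_def dist_real_def)
            moreover have "z \<in> {u<..<v}" using d uv by (auto simp: z_def field_simps)
            ultimately show False using e(2)[of z] pos[of z] by (auto simp: pderiv_smult)
          qed
          show "(poly (smult s q) has_real_derivative poly (pderiv (smult s q)) x) (at x)" for x
            by (rule poly_DERIV)
          show "u \<le> v" using uv by simp
        qed measurable
        finally have 2: "emeasure \<nu> {u<..v} = inverse (of_nat N) * ennreal (s * poly q v - s * poly q u)" by simp
        show ?thesis unfolding 1 2 ..
      qed simp
    qed
  qed
  have eq: "\<mu> = \<nu>"
  proof (rule measure_eqI_generator_eq[where E = "range (\<lambda>(u, v). {u<..v :: real})" and \<Omega> = UNIV and A = "\<lambda>i::nat. {- real i<..real i}"])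
    show "Int_stable (range (\<lambda>(u, v). {u<..v :: real}))"
    proof (rule Int_stableI, clarify)
      fix a b c d :: real
      have "{a<..b} \<inter> {c<..d} = {max a c<..min b d}" by auto
      then show "{a<..b} \<inter> {c<..d} \<in> range (\<lambda>(u, v). {u<..v})" by auto
    qed
    show "emeasure \<mu> X = emeasure \<nu> X" if "X \<in> range (\<lambda>(u, v). {u<..v :: real})" for X
    proof -
      obtain u v where X: "X = {u<..v}" using \<open>X \<in> _\<close> by auto
      show ?thesis unfolding X using Ioc[of u v] by (cases "u \<le> v") auto
    qed
    show "sets \<mu> = sigma_sets UNIV (range (\<lambda>(u, v). {u<..v :: real}))"
         "sets \<nu> = sigma_sets UNIV (range (\<lambda>(u, v). {u<..v :: real}))"
      unfolding sets\<mu> sets\<nu> by (subst borel_sigma_sets_Ioc, simp)+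
    show "(\<Union>i::nat. {- real i<..real i}) = UNIV" by (rule UN_Ioc_eq_UNIV)
    \<comment> \<open>Finiteness, required for uniqueness of measures, is read off from
      \<open>\<nu>\<close>, whose density is bounded on bounded intervals.\<close>
    show "emeasure \<mu> {- real i<..real i} \<noteq> \<infinity>" for i
    proof -
      have "bounded (w' ` {- real i..real i})" if "w' = (\<lambda>x. \<bar>poly (pderiv q) x\<bar>)" for w'
        unfolding that by (intro compact_imp_bounded compact_continuous_image continuous_intros) auto
      then obtain b where b: "\<And>x. x \<in> {- real i..real i} \<Longrightarrow> \<bar>poly (pderiv q) x\<bar> \<le> b"
        unfolding bounded_iff by fastforce
      have "emeasure \<nu> {- real i<..real i} = (\<integral>\<^sup>+x. w x * indicator {- real i<..real i} x \<partial>lborel)"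
        unfolding \<nu>_def by (rule emeasure_density) auto
      also have "\<dots> \<le> (\<integral>\<^sup>+x. (inverse (of_nat N) * ennreal b) * indicator {- real i<..real i} x \<partial>lborel)"
        using b by (intro nn_integral_mono) (auto simp: w_def indicator_def intro!: mult_left_mono ennreal_leI)
      also have "\<dots> = (inverse (of_nat N) * ennreal b) * ennreal (2 * real i)"
        by (subst nn_integral_cmult_indicator) auto
      also have "\<dots> < \<top>" using N by (simp add: ennreal_mult_less_top ennreal_of_nat_eq_real_of_nat inverse_ennreal)
      finally show ?thesis using Ioc[of "- real i" "real i"] by simp
    qed
  qed auto
  have "(\<integral>\<^sup>+x. G x \<partial>\<mu>) = (\<integral>\<^sup>+y. \<integral>\<^sup>+x. G x \<partial>zero_kernel N (a(0 := y)) \<partial>lborel)"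
    unfolding \<mu>_def by (rule nn_integral_bind[OF G K])
  also have "\<dots> = (\<integral>\<^sup>+y. inverse (of_nat N) * (\<Sum>x\<in>zeros N (a(0 := y)). G x) \<partial>lborel)"
    by (simp add: nn_integral_zero_kernel[OF G])
  also have "\<dots> = inverse (of_nat N) * (\<integral>\<^sup>+y. (\<Sum>x\<in>zeros N (a(0 := y)). G x) \<partial>lborel)"
  proof (rule nn_integral_cmult)
    have "(\<lambda>y. \<Sum>x\<in>zeros N (a(0 := y)). G x) \<in> borel_measurable borel"
    proof (rule measurable_sum_zeros)
      note [measurable] = G
      show "(\<lambda>(y, x). G x) \<in> borel_measurable (borel \<Otimes>\<^sub>M borel)" by measurable
    qed fact
    then show "(\<lambda>y. \<Sum>x\<in>zeros N (a(0 := y)). G x) \<in> borel_measurable lborel" by simp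
  qed
  finally have L: "(\<integral>\<^sup>+x. G x \<partial>\<mu>) = inverse (of_nat N) * (\<integral>\<^sup>+y. (\<Sum>x\<in>zeros N (a(0 := y)). G x) \<partial>lborel)" .
  have "(\<integral>\<^sup>+x. G x \<partial>\<nu>) = (\<integral>\<^sup>+x. w x * G x \<partial>lborel)"
    unfolding \<nu>_def using G by (intro nn_integral_density) auto
  also have "\<dots> = (\<integral>\<^sup>+x. inverse (of_nat N) * (\<bar>poly (pderiv q) x\<bar> * G x) \<partial>lborel)"
    by (simp add: w_def mult.assoc)
  also have "\<dots> = inverse (of_nat N) * (\<integral>\<^sup>+x. \<bar>poly (pderiv q) x\<bar> * G x \<partial>lborel)"
    by (rule nn_integral_cmult) (use G in measurable)
  finally have R: "(\<integral>\<^sup>+x. G x \<partial>\<nu>) = inverse (of_nat N) * (\<integral>\<^sup>+x. \<bar>poly (pderiv q) x\<bar> * G x \<partial>lborel)" .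
  have "of_nat N * inverse (of_nat N) = (1 :: ennreal)"
    using N by (simp add: ennreal_of_nat_eq_real_of_nat inverse_ennreal flip: ennreal_mult')
  moreover have "of_nat N * (inverse (of_nat N) * (\<integral>\<^sup>+y. (\<Sum>x\<in>zeros N (a(0 := y)). G x) \<partial>lborel)) =
     of_nat N * (inverse (of_nat N) * (\<integral>\<^sup>+x. \<bar>poly (pderiv q) x\<bar> * G x \<partial>lborel))"
    using L R eq by simp
  ultimately show ?thesis by (simp add: mult.assoc[symmetric])
qed

lemma pderiv_sum_finite: "finite A \<Longrightarrow> pderiv (\<Sum>x\<in>A. f x) = (\<Sum>x\<in>A. pderiv (f x))"
  by (induction A rule: finite_induct) (simp_all add: pderiv_add)

section \<open>Multiplication and division by a linear factor\<close>

definition cf :: "nat \<Rightarrow> real poly \<Rightarrow> nat \<Rightarrow> real" where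
  "cf N p = (\<lambda>i\<in>{..<N}. coeff p i)"

lemma vpoly_cf: "(\<And>i. N \<le> i \<Longrightarrow> coeff p i = 0) \<Longrightarrow> vpoly N (cf N p) = p"
  by (rule poly_eqI) (simp add: coeff_vpoly cf_def)

lemma cf_vpoly: "a \<in> extensional {..<N} \<Longrightarrow> cf N (vpoly N a) = a"
  by (auto simp: cf_def coeff_vpoly fun_eq_iff extensional_def)

lemma coeff_linear_mult: "coeff ([:- s, 1:] * p) i = (if i = 0 then 0 else coeff p (i - 1)) - s * coeff p i"
  for s :: "'a::comm_ring_1"
  by (cases i) (simp_all add: mult_pCons_left)

definition mul_lin :: "nat \<Rightarrow> real \<Rightarrow> (nat \<Rightarrow> real) \<Rightarrow> nat \<Rightarrow> real" where
  "mul_lin m s b = cf (Suc m) ([:- s, 1:] * vpoly m b)"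

lemma vpoly_mul_lin: "vpoly (Suc m) (mul_lin m s b) = [:- s, 1:] * vpoly m b"
  unfolding mul_lin_def
  by (rule vpoly_cf) (auto simp: coeff_linear_mult coeff_vpoly simp del: mult_pCons_left)

lemma mul_lin_apply:
  "i < Suc m \<Longrightarrow> mul_lin m s b i = (if i = 0 then 0 else b (i - 1)) - s * (if i < m then b i else 0)"
  by (auto simp: mul_lin_def cf_def coeff_linear_mult coeff_vpoly simp del: mult_pCons_left)

text \<open>The quotient of synthetic division by X - s. The formula makes sense for every
  \<open>s\<close>, which keeps it jointly measurable; it is the exact quotient when
  \<open>s\<close> is a root.\<close>

definition div_lin :: "nat \<Rightarrow> real \<Rightarrow> (nat \<Rightarrow> real) \<Rightarrow> nat \<Rightarrow> real" where
  "div_lin m s a = (\<lambda>i\<in>{..<m}. \<Sum>j\<in>{Suc i..m}. a j * s ^ (j - Suc i))"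

lemma vpoly_div_lin:
  assumes "s \<in> zeros (Suc m) a"
  shows "[:- s, 1:] * vpoly m (div_lin m s a) = vpoly (Suc m) a"
proof (rule poly_eqI)
  fix i
  define B where "B i = (\<Sum>j\<in>{Suc i..m}. a j * s ^ (j - Suc i))" for i
  have B: "coeff (vpoly m (div_lin m s a)) i = B i" for i
    by (auto simp: coeff_vpoly div_lin_def B_def)
  have rec: "B (i - 1) = a i + s * B i" if "i \<le> m" "0 < i" for i
  proof -
    have "{Suc (i - 1)..m} = insert i {Suc i..m}" using that by auto
    then have "B (i - 1) = a i + (\<Sum>j\<in>{Suc i..m}. a j * s ^ (j - i))" using that by (simp add: B_def)
    also have "(\<Sum>j\<in>{Suc i..m}. a j * s ^ (j - i)) = s * B i"
      unfolding B_def sum_distrib_left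
    proof (rule sum.cong)
      fix j assume "j \<in> {Suc i..m}"
      then have "j - i = Suc (j - Suc i)" by auto
      then show "a j * s ^ (j - i) = s * (a j * s ^ (j - Suc i))" by simp
    qed simp
    finally show ?thesis .
  qed
  \<comment> \<open>The root condition enters at the constant coefficient; all other coefficients
    obey the Horner recurrence \<open>rec\<close>.\<close>
  have zero: "a 0 = - s * B 0"
  proof -
    have "{..<Suc m} = insert 0 {Suc 0..m}" by auto
    then have "0 = a 0 + (\<Sum>j\<in>{Suc 0..m}. a j * s ^ j)"
      using assms by (simp add: zeros_def peval_def)
    also have "(\<Sum>j\<in>{Suc 0..m}. a j * s ^ j) = s * B 0"
      unfolding B_def sum_distrib_left
    proof (rule sum.cong)
      fix j assume "j \<in> {Suc 0..m}"
      then have "j = Suc (j - Suc 0)" by auto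
      then have "s ^ j = s * s ^ (j - Suc 0)" by (metis power_Suc)
      then show "a j * s ^ j = s * (a j * s ^ (j - Suc 0))" by simp
    qed simp
    finally show ?thesis by simp
  qed
  show "coeff ([:- s, 1:] * vpoly m (div_lin m s a)) i = coeff (vpoly (Suc m) a) i"
    unfolding coeff_linear_mult B using zero rec[of i]
    by (auto simp: coeff_vpoly B_def not_less_eq)
qed

lemma div_mul_lin:
  assumes "b \<in> extensional {..<m}"
  shows "div_lin m s (mul_lin m s b) = b"
proof -
  have "s \<in> zeros (Suc m) (mul_lin m s b)" by (simp add: zeros_def peval_vpoly vpoly_mul_lin)
  from vpoly_div_lin[OF this] have "vpoly m (div_lin m s (mul_lin m s b)) = vpoly m b"
    unfolding vpoly_mul_lin by (simp del: mult_pCons_left)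
  then have "cf m (vpoly m (div_lin m s (mul_lin m s b))) = cf m (vpoly m b)" by simp
  then show ?thesis using assms by (simp add: cf_vpoly div_lin_def)
qed

lemma measurable_cf:
  assumes "\<And>i. i < N \<Longrightarrow> (\<lambda>z. coeff (p z) i) \<in> borel_measurable M"
  shows "(\<lambda>z. cf N (p z)) \<in> measurable M (PiM {..<N} (\<lambda>_. borel))"
  unfolding cf_def using assms by (intro measurable_restrict) auto

lemma measurable_coeff_vpoly:
  assumes "A \<in> measurable M (PiM {..<N} (\<lambda>_. borel))"
  shows "(\<lambda>z. coeff (vpoly N (A z)) i) \<in> borel_measurable M"
proof (cases "i < N")
  case True
  have "(\<lambda>z. A z i) \<in> borel_measurable M"
    using measurable_compose[OF assms measurable_component_singleton[of i "{..<N}"]] True by simp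
  then show ?thesis using True by (simp add: coeff_vpoly)
qed (simp add: coeff_vpoly)

lemma measurable_mul_lin:
  assumes "S \<in> borel_measurable M" "A \<in> measurable M (PiM {..<m} (\<lambda>_. borel))"
  shows "(\<lambda>z. mul_lin m (S z) (A z)) \<in> measurable M (PiM {..<Suc m} (\<lambda>_. borel))"
  unfolding mul_lin_def
proof (rule measurable_cf)
  fix i
  note [measurable] = assms(1) measurable_coeff_vpoly[OF assms(2)]
  show "(\<lambda>z. coeff ([:- S z, 1:] * vpoly m (A z)) i) \<in> borel_measurable M"
    unfolding coeff_linear_mult by measurable
qed

lemma measurable_div_lin:
  assumes "S \<in> borel_measurable M" "A \<in> measurable M (PiM {..<Suc m} (\<lambda>_. borel))"
  shows "(\<lambda>z. div_lin m (S z) (A z)) \<in> measurable M (PiM {..<m} (\<lambda>_. borel))"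
  unfolding div_lin_def
proof (rule measurable_restrict)
  fix i
  note [measurable] = assms(1)
  have "(\<lambda>z. A z j) \<in> borel_measurable M" if "j \<in> {Suc i..m}" for j
    using measurable_compose[OF assms(2) measurable_component_singleton[of j "{..<Suc m}"]] that by simp
  then show "(\<lambda>z. \<Sum>j\<in>{Suc i..m}. A z j * S z ^ (j - Suc i)) \<in> borel_measurable M"
    by (intro borel_measurable_sum borel_measurable_times) auto
qed

lemma measurable_peval:
  assumes "S \<in> borel_measurable M" "A \<in> measurable M (PiM {..<m} (\<lambda>_. borel))"
  shows "(\<lambda>z. peval m (A z) (S z)) \<in> borel_measurable M"
proof -
  note [measurable] = assms(1)
  have "(\<lambda>z. A z j) \<in> borel_measurable M" if "j < m" for j
    using measurable_compose[OF assms(2) measurable_component_singleton[of j "{..<m}"]] that by simp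
  then show ?thesis unfolding peval_def by (intro borel_measurable_sum borel_measurable_times) auto
qed

lemma sets_PiM_lborel: "sets (PiM I (\<lambda>_. lborel :: real measure)) = sets (PiM I (\<lambda>_. borel))"
  by (intro sets_PiM_cong) auto

lemma measurable_PiM_lborel:
  "measurable M (PiM I (\<lambda>_. lborel :: real measure)) = measurable M (PiM I (\<lambda>_. borel))"
  "measurable (PiM I (\<lambda>_. lborel :: real measure)) M' = measurable (PiM I (\<lambda>_. borel)) M'"
  by (intro measurable_cong_sets sets_PiM_lborel refl)+

lemma measurable_pair_PiM_lborel:
  "measurable (M1 \<Otimes>\<^sub>M PiM I (\<lambda>_. lborel :: real measure)) M' = measurable (M1 \<Otimes>\<^sub>M PiM I (\<lambda>_. borel)) M'"
  "measurable (PiM I (\<lambda>_. lborel :: real measure) \<Otimes>\<^sub>M M1) M' = measurable (PiM I (\<lambda>_. borel) \<Otimes>\<^sub>M M1) M'"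
  by (intro measurable_cong_sets sets_pair_measure_cong sets_PiM_lborel refl)+

lemma measurable_fun_upd_last:
  assumes "f \<in> measurable M (PiM I (\<lambda>_. borel :: real measure))" "g \<in> borel_measurable M" "i \<notin> I"
  shows "(\<lambda>z. (f z)(i := g z)) \<in> measurable M (PiM (insert i I) (\<lambda>_. borel))"
  using assms by (intro measurable_fun_upd[where J = I]) auto

text \<open>The map on the right is multiplication by \<open>X - s\<close> on coefficient vectors without the
  constant term; it is unipotent, hence volume preserving.\<close>

lemma nn_integral_shear:
  fixes g :: "(nat \<Rightarrow> real) \<Rightarrow> ennreal" and s c :: real
  assumes "g \<in> borel_measurable (PiM {1..<Suc m} (\<lambda>_. borel))"
  shows "(\<integral>\<^sup>+a. g a \<partial>PiM {1..<Suc m} (\<lambda>_. lborel)) =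
    (\<integral>\<^sup>+b. g (\<lambda>i\<in>{1..<Suc m}. b (i - 1) - s * (if i < m then b i else c)) \<partial>PiM {..<m} (\<lambda>_. lborel))"
  using assms
\<comment> \<open>The parameter \<open>c\<close> stands for a coefficient above the top one. Peeling
  off the top coordinate translates it by \<open>s * c\<close>, and its value \<open>y\<close> plays
  the role of \<open>c\<close> for the shorter vector.\<close>
proof (induction m arbitrary: g c)
  case 0
  have "{1..<Suc 0} = {}" by auto
  then show ?case by (simp add: PiM_empty nn_integral_count_space_finite restrict_def)
next
  case (Suc m)
  have I: "{1..<Suc (Suc m)} = insert (Suc m) {1..<Suc m}" "{..<Suc m} = insert m {..<m}" by auto
  note gm = Suc.prems[unfolded I]
  have "(\<integral>\<^sup>+a. g a \<partial>PiM {1..<Suc (Suc m)} (\<lambda>_. lborel))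
      = (\<integral>\<^sup>+y. \<integral>\<^sup>+a. g (a(Suc m := y)) \<partial>PiM {1..<Suc m} (\<lambda>_. lborel) \<partial>lborel)"
    unfolding I by (rule lborel_prod.product_nn_integral_insert_rev) (use gm in \<open>auto simp: measurable_PiM_lborel\<close>)
  also have "\<dots> = ennreal \<bar>1\<bar> * (\<integral>\<^sup>+y. \<integral>\<^sup>+a. g (a(Suc m := - (s * c) + 1 * y)) \<partial>PiM {1..<Suc m} (\<lambda>_. lborel) \<partial>lborel)"
  proof (rule nn_integral_real_affine)
    interpret sigma_finite_measure "PiM {1..<Suc m} (\<lambda>_. lborel :: real measure)"
      by (rule lborel_prod.sigma_finite) simp
    have "(\<lambda>(y, a). g (a(Suc m := y))) \<in> borel_measurable (borel \<Otimes>\<^sub>M PiM {1..<Suc m} (\<lambda>_. lborel))"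
      unfolding measurable_pair_PiM_lborel case_prod_unfold
      by (rule measurable_compose[OF measurable_fun_upd_last gm]) auto
    then show "(\<lambda>y. \<integral>\<^sup>+a. g (a(Suc m := y)) \<partial>PiM {1..<Suc m} (\<lambda>_. lborel)) \<in> borel_measurable borel"
      by (rule borel_measurable_nn_integral)
  qed simp
  also have "\<dots> = (\<integral>\<^sup>+y. \<integral>\<^sup>+a. g (a(Suc m := y - s * c)) \<partial>PiM {1..<Suc m} (\<lambda>_. lborel) \<partial>lborel)"
    by simp
  also have "\<dots> = (\<integral>\<^sup>+y. \<integral>\<^sup>+b. g ((\<lambda>i\<in>{1..<Suc m}. b (i - 1) - s * (if i < m then b i else y))(Suc m := y - s * c)) \<partial>PiM {..<m} (\<lambda>_. lborel) \<partial>lborel)"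
    by (intro nn_integral_cong Suc.IH measurable_compose[OF measurable_fun_upd_last gm]) auto
  also have "\<dots> = (\<integral>\<^sup>+y. \<integral>\<^sup>+b. g (\<lambda>i\<in>{1..<Suc (Suc m)}. (b(m := y)) (i - 1) - s * (if i < Suc m then (b(m := y)) i else c)) \<partial>PiM {..<m} (\<lambda>_. lborel) \<partial>lborel)"
    by (intro nn_integral_cong arg_cong[where f = g]) (auto simp: fun_eq_iff less_Suc_eq)
  also have "\<dots> = (\<integral>\<^sup>+b. g (\<lambda>i\<in>{1..<Suc (Suc m)}. b (i - 1) - s * (if i < Suc m then b i else c)) \<partial>PiM (insert m {..<m}) (\<lambda>_. lborel))"
  proof (rule lborel_prod.product_nn_integral_insert_rev[symmetric])
    show "(\<lambda>b. g (\<lambda>i\<in>{1..<Suc (Suc m)}. b (i - 1) - s * (if i < Suc m then b i else c))) \<in> borel_measurable (PiM (insert m {..<m}) (\<lambda>_. lborel))"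
      unfolding measurable_PiM_lborel
    proof (rule measurable_compose[OF measurable_restrict Suc.prems])
      fix i assume i: "i \<in> {1..<Suc (Suc m)}"
      have c: "(\<lambda>b. b j) \<in> borel_measurable (PiM (insert m {..<m}) (\<lambda>_. borel :: real measure))" if "j < Suc m" for j
        using that measurable_component_singleton[of j "insert m {..<m}" "\<lambda>_. borel :: real measure"] by (auto simp: less_Suc_eq)
      show "(\<lambda>b. b (i - 1) - s * (if i < Suc m then b i else c)) \<in> borel_measurable (PiM (insert m {..<m}) (\<lambda>_. borel))"
        using c[of "i - 1"] c[of i] i by (cases "i < Suc m") auto
    qed
  qed auto
  finally show ?case by (simp only: I(2))
qed

lemma poly_pderiv_linear_mult: "poly (pderiv ([:- s, 1:] * p)) s = poly p s" for s :: real
  by (simp add: pderiv_mult pderiv_pCons del: mult_pCons_left)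

text \<open>Freeze the nonconstant coefficients and integrate over the constant term: this is the
  formula on the line, with weight |q'(x)|. After exchanging the integrals, the shear rewrites the
  coefficients as those of (X - x) times \<open>b\<close>, and the derivative of this product at x
  is b(x), which explains the weight.\<close>

lemma nn_integral_sum_zeros:
  fixes G :: "real \<Rightarrow> (nat \<Rightarrow> real) \<Rightarrow> ennreal"
  assumes G: "(\<lambda>(x, a). G x a) \<in> borel_measurable (borel \<Otimes>\<^sub>M PiM {..<Suc m} (\<lambda>_. borel))"
  shows "(\<integral>\<^sup>+a. (\<Sum>x\<in>zeros (Suc m) a. G x a) \<partial>PiM {..<Suc m} (\<lambda>_. lborel)) =
    (\<integral>\<^sup>+x. \<integral>\<^sup>+b. \<bar>peval m b x\<bar> * G x (mul_lin m x b) \<partial>PiM {..<m} (\<lambda>_. lborel) \<partial>lborel)"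
proof -
  define I where "I = {1..<Suc m}"
  have I: "{..<Suc m} = insert 0 I" "finite I" "0 \<notin> I" by (auto simp: I_def)
  define q where "q a = (\<Sum>i\<in>I. monom (a i) i)" for a :: "nat \<Rightarrow> real"
  have q: "poly (q a) x = (\<Sum>i\<in>{1..<Suc m}. a i * x ^ i)" for a x
    by (simp add: q_def I_def poly_sum poly_monom)
  have [measurable]: "(\<lambda>p. poly (q (fst p)) (snd p)) \<in> borel_measurable (PiM I (\<lambda>_. borel) \<Otimes>\<^sub>M borel)"
    unfolding q I_def[symmetric] by measurable
  have pdq: "poly (pderiv (q a)) x = (\<Sum>i\<in>I. a i * (real i * x ^ (i - 1)))" for a x
    using I(2) by (simp add: q_def pderiv_sum_finite pderiv_monom poly_sum poly_monom mult_ac)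
  have [measurable]: "(\<lambda>p. poly (pderiv (q (fst p))) (snd p)) \<in> borel_measurable (PiM I (\<lambda>_. borel) \<Otimes>\<^sub>M borel)"
    unfolding pdq by measurable
  have upd [measurable]: "(\<lambda>p. (fst p)(0 := - poly (q (fst p)) (snd p))) \<in> measurable (PiM I (\<lambda>_. borel) \<Otimes>\<^sub>M borel) (PiM {..<Suc m} (\<lambda>_. borel))"
    unfolding I(1) using I(3) by (intro measurable_fun_upd_last) measurable
  define H where "H a x = ennreal \<bar>poly (pderiv (q a)) x\<bar> * G x (a(0 := - poly (q a) x))" for a x
  have GH: "(\<lambda>p. G (snd p) ((fst p)(0 := - poly (q (fst p)) (snd p)))) \<in> borel_measurable (PiM I (\<lambda>_. borel) \<Otimes>\<^sub>M borel)"
  proof -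
    have "(\<lambda>p. (snd p, (fst p)(0 := - poly (q (fst p)) (snd p)))) \<in> measurable (PiM I (\<lambda>_. borel) \<Otimes>\<^sub>M borel) (borel \<Otimes>\<^sub>M PiM {..<Suc m} (\<lambda>_. borel))"
      by (intro measurable_Pair upd) measurable
    from measurable_compose[OF this G] show ?thesis by simp
  qed
  have H: "(\<lambda>(a, x). H a x) \<in> borel_measurable (PiM I (\<lambda>_. borel) \<Otimes>\<^sub>M borel)"
    unfolding H_def case_prod_unfold using GH by measurable
  have "(\<integral>\<^sup>+a. (\<Sum>x\<in>zeros (Suc m) a. G x a) \<partial>PiM {..<Suc m} (\<lambda>_. lborel))
     = (\<integral>\<^sup>+a. \<integral>\<^sup>+y. (\<Sum>x\<in>zeros (Suc m) (a(0 := y)). G x (a(0 := y))) \<partial>lborel \<partial>PiM I (\<lambda>_. lborel))"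
    unfolding I(1)
  proof (rule lborel_prod.product_nn_integral_insert[OF I(2,3)])
    show "(\<lambda>a. \<Sum>x\<in>zeros (Suc m) a. G x a) \<in> borel_measurable (PiM (insert 0 I) (\<lambda>_. lborel))"
      unfolding measurable_PiM_lborel I(1)[symmetric]
    proof (rule measurable_sum_zeros)
      show "(\<lambda>(a, x). G x a) \<in> borel_measurable (PiM {..<Suc m} (\<lambda>_. borel) \<Otimes>\<^sub>M borel)"
        using measurable_compose[OF measurable_pair_swap' G] by (simp add: case_prod_unfold)
    qed simp
  qed
  also have "\<dots> = (\<integral>\<^sup>+a. \<integral>\<^sup>+x. H a x \<partial>lborel \<partial>PiM I (\<lambda>_. lborel))"
  proof (rule nn_integral_cong)
    fix a assume "a \<in> space (PiM I (\<lambda>_. lborel :: real measure))"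
    then have a: "a \<in> space (PiM I (\<lambda>_. borel :: real measure))" by (simp add: space_PiM)
    \<comment> \<open>At a zero the constant term is determined by x, so the summand becomes a
      function of x alone, as the formula on the line demands.\<close>
    have z: "x \<in> zeros (Suc m) (a(0 := y)) \<Longrightarrow> y = - poly (q a) x" for x y
      using zeros_update_0[of "Suc m" a "- y"] unfolding q by auto
    have "(\<integral>\<^sup>+y. (\<Sum>x\<in>zeros (Suc m) (a(0 := y)). G x (a(0 := y))) \<partial>lborel)
      = (\<integral>\<^sup>+y. (\<Sum>x\<in>zeros (Suc m) (a(0 := y)). G x (a(0 := - poly (q a) x))) \<partial>lborel)"
      by (intro nn_integral_cong sum.cong refl) (auto dest!: z)
    also have "\<dots> = (\<integral>\<^sup>+x. \<bar>poly (pderiv (q a)) x\<bar> * G x (a(0 := - poly (q a) x)) \<partial>lborel)"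
    proof (rule nn_integral_sum_zeros_line)
      show "poly (q a) x = (\<Sum>i\<in>{1..<Suc m}. a i * x ^ i)" for x by (rule q)
      show "a \<in> space (PiM {1..<Suc m} (\<lambda>_. borel))" using a by (simp add: I_def)
      show "(\<lambda>x. G x (a(0 := - poly (q a) x))) \<in> borel_measurable borel"
        using measurable_compose[OF measurable_Pair1'[OF a] GH] by simp
    qed simp
    finally show "(\<integral>\<^sup>+y. (\<Sum>x\<in>zeros (Suc m) (a(0 := y)). G x (a(0 := y))) \<partial>lborel) = (\<integral>\<^sup>+x. H a x \<partial>lborel)"
      by (simp only: H_def)
  qed
  also have "\<dots> = (\<integral>\<^sup>+x. \<integral>\<^sup>+a. H a x \<partial>PiM I (\<lambda>_. lborel) \<partial>lborel)"
  proof (rule pair_sigma_finite.Fubini'[symmetric])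
    show "pair_sigma_finite (PiM I (\<lambda>_. lborel :: real measure)) (lborel :: real measure)"
      using lborel_prod.sigma_finite[OF I(2)] by (intro pair_sigma_finite.intro) (auto intro: lborel.sigma_finite_measure_axioms)
    have "sets (PiM I (\<lambda>_. lborel :: real measure) \<Otimes>\<^sub>M (lborel :: real measure))
        = sets (PiM I (\<lambda>_. borel :: real measure) \<Otimes>\<^sub>M (borel :: real measure))"
      by (rule sets_pair_measure_cong[OF sets_PiM_lborel sets_lborel])
    then show "(\<lambda>(a, x). H a x) \<in> borel_measurable (PiM I (\<lambda>_. lborel) \<Otimes>\<^sub>M lborel)"
      using H measurable_cong_sets by blast
  qed
  also have "\<dots> = (\<integral>\<^sup>+x. \<integral>\<^sup>+b. H (\<lambda>i\<in>I. b (i - 1) - x * (if i < m then b i else 0)) x \<partial>PiM {..<m} (\<lambda>_. lborel) \<partial>lborel)"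
  proof (rule nn_integral_cong)
    fix x :: real
    have "(\<lambda>a. H a x) \<in> borel_measurable (PiM {1..<Suc m} (\<lambda>_. borel))"
      using measurable_compose[OF measurable_Pair2'[of x borel] H] by (simp add: I_def)
    then show "(\<integral>\<^sup>+a. H a x \<partial>PiM I (\<lambda>_. lborel)) = (\<integral>\<^sup>+b. H (\<lambda>i\<in>I. b (i - 1) - x * (if i < m then b i else 0)) x \<partial>PiM {..<m} (\<lambda>_. lborel))"
      unfolding I_def by (rule nn_integral_shear)
  qed
  also have "\<dots> = (\<integral>\<^sup>+x. \<integral>\<^sup>+b. \<bar>peval m b x\<bar> * G x (mul_lin m x b) \<partial>PiM {..<m} (\<lambda>_. lborel) \<partial>lborel)"
  proof (intro nn_integral_cong)
    fix x :: real and b :: "nat \<Rightarrow> real"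
    define a where "a = (\<lambda>i\<in>I. b (i - 1) - x * (if i < m then b i else 0))"
    have ml: "mul_lin m x b i = a i" if "i \<in> I" for i
      using that by (auto simp: a_def I_def mul_lin_apply)
    have split: "vpoly (Suc m) (mul_lin m x b) = q a + [:mul_lin m x b 0:]"
    proof -
      have "vpoly (Suc m) (mul_lin m x b) = monom (mul_lin m x b 0) 0 + (\<Sum>i\<in>I. monom (mul_lin m x b i) i)"
        unfolding vpoly_def I(1) using I(2,3) by simp
      also have "(\<Sum>i\<in>I. monom (mul_lin m x b i) i) = q a" unfolding q_def by (rule sum.cong) (simp_all add: ml)
      finally show ?thesis by (simp add: monom_0)
    qed
    \<comment> \<open>The polynomials differ by a constant, which the derivative ignores.\<close>
    have "pderiv (q a) = pderiv ([:- x, 1:] * vpoly m b)"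
      using arg_cong[OF split, of pderiv] by (simp add: vpoly_mul_lin pderiv_add pderiv_pCons del: mult_pCons_left)
    then have 1: "poly (pderiv (q a)) x = peval m b x"
      by (simp only: poly_pderiv_linear_mult peval_vpoly)
    have "poly (q a) x + mul_lin m x b 0 = poly ([:- x, 1:] * vpoly m b) x"
      using arg_cong[OF split, of "\<lambda>p. poly p x"] by (simp add: vpoly_mul_lin)
    then have "- poly (q a) x = mul_lin m x b 0" by simp
    then have "a(0 := - poly (q a) x) = mul_lin m x b"
      using ml I(1) by (auto simp: fun_eq_iff a_def mul_lin_def cf_def restrict_def I_def)
    with 1 show "H (\<lambda>i\<in>I. b (i - 1) - x * (if i < m then b i else 0)) x = \<bar>peval m b x\<bar> * G x (mul_lin m x b)"
      unfolding a_def[symmetric] H_def by simp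
  qed
  finally show ?thesis .
qed

subsection \<open>The area formula for root tuples\<close>

definition root_tuples :: "'v set \<Rightarrow> nat \<Rightarrow> (nat \<Rightarrow> real) \<Rightarrow> ('v \<Rightarrow> real) set" where
  "root_tuples V M a = {x \<in> PiE V (\<lambda>_. zeros M a). inj_on x V}"

text \<open>An infinite zero set contributes 0, except when \<open>V\<close> is empty: the single
  empty tuple is counted for every polynomial and gives the recursion a uniform start.\<close>

definition tuple_sum :: "'v set \<Rightarrow> nat \<Rightarrow> (nat \<Rightarrow> real) \<Rightarrow> (('v \<Rightarrow> real) \<Rightarrow> ennreal) \<Rightarrow> ennreal" where
  "tuple_sum V M a H = (if V = {} \<or> finite (zeros M a) then \<Sum>x\<in>root_tuples V M a. H x else 0)"

lemma tuple_sum_empty [simp]: "tuple_sum {} M a H = H (\<lambda>_. undefined)"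
  by (simp add: tuple_sum_def root_tuples_def)

lemma finite_root_tuples: "finite V \<Longrightarrow> finite (zeros M a) \<Longrightarrow> finite (root_tuples V M a)"
  unfolding root_tuples_def by (rule finite_subset[of _ "PiE V (\<lambda>_. zeros M a)"]) (auto intro: finite_PiE)

lemma tuple_sum_cmult: "tuple_sum V M a (\<lambda>x. c * H x) = c * tuple_sum V M a H"
  by (simp add: tuple_sum_def sum_distrib_left)

lemma zeros_div_lin:
  assumes "s \<in> zeros (Suc M) a"
  shows "zeros (Suc M) a = insert s (zeros M (div_lin M s a))"
proof -
  have "peval (Suc M) a x = (x - s) * peval M (div_lin M s a) x" for x
    unfolding peval_vpoly vpoly_div_lin[OF assms, symmetric] by (simp add: algebra_simps)
  then show ?thesis by (auto simp: zeros_def)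
qed

text \<open>Choose the root for \<open>v\<close> first; the others are roots of the quotient by X -
  s. If s is a multiple root it is still a root of the quotient, so tuples that repeat it are set to
  0.\<close>

lemma tuple_sum_insert:
  assumes V: "finite V" "v \<notin> V"
  shows "tuple_sum (insert v V) (Suc M) a H =
    (\<Sum>s\<in>zeros (Suc M) a. tuple_sum V M (div_lin M s a) (\<lambda>y. if s \<in> y ` V then 0 else H (y(v := s))))"
proof (cases "finite (zeros (Suc M) a)")
  case True
  let ?Z = "zeros (Suc M) a"
  let ?T = "\<lambda>s. {y \<in> root_tuples V M (div_lin M s a). s \<notin> y ` V}"
  have fin: "finite (zeros M (div_lin M s a))" if "s \<in> ?Z" for s
    using True zeros_div_lin[OF that] by simp
  have "tuple_sum (insert v V) (Suc M) a H = (\<Sum>x\<in>root_tuples (insert v V) (Suc M) a. H x)"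
    using True by (simp add: tuple_sum_def)
  also have "\<dots> = (\<Sum>(s, y)\<in>Sigma ?Z ?T. H (y(v := s)))"
  proof (rule sum.reindex_bij_witness[where i = "\<lambda>(s, y). y(v := s)" and j = "\<lambda>x. (x v, restrict x V)"])
    fix x assume x: "x \<in> root_tuples (insert v V) (Suc M) a"
    then have xe: "x \<in> extensional (insert v V)" and xz: "\<And>i. i \<in> insert v V \<Longrightarrow> x i \<in> ?Z" and inj: "inj_on x (insert v V)"
      by (auto simp: root_tuples_def PiE_iff)
    show eq: "(case (x v, restrict x V) of (s, y) \<Rightarrow> y(v := s)) = x"
      using xe V by (auto simp: fun_eq_iff extensional_def)
    have ne: "x i \<noteq> x v" if "i \<in> V" for i using inj_onD[OF inj, of i v] that V by auto
    then have nv: "x v \<notin> restrict x V ` V" by force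
    have "x i \<in> zeros M (div_lin M (x v) a)" if "i \<in> V" for i
      using xz[of i] that ne[OF that] zeros_div_lin[OF xz[of v]] by auto
    moreover have "inj_on (restrict x V) V" using inj by (auto simp: inj_on_def)
    ultimately show "(x v, restrict x V) \<in> Sigma ?Z ?T"
      using xz[of v] nv by (auto simp: root_tuples_def)
    show "(case (x v, restrict x V) of (s, y) \<Rightarrow> H (y(v := s))) = H x"
      using eq by simp
  next
    fix p assume "p \<in> Sigma ?Z ?T"
    then obtain s y where p: "p = (s, y)" "s \<in> ?Z" "y \<in> root_tuples V M (div_lin M s a)" "s \<notin> y ` V" by auto
    then have y: "y \<in> extensional V" "\<And>i. i \<in> V \<Longrightarrow> y i \<in> zeros M (div_lin M s a)" "inj_on y V"
      by (auto simp: root_tuples_def PiE_iff)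
    show "((case p of (s, y) \<Rightarrow> y(v := s)) v, restrict (case p of (s, y) \<Rightarrow> y(v := s)) V) = p"
      using p y V by (auto simp: fun_eq_iff extensional_def)
    have "inj_on (y(v := s)) (insert v V)" using y(3) p(4) V by (auto simp: inj_on_def)
    moreover have "(y(v := s)) i \<in> ?Z" if "i \<in> insert v V" for i
      using that y(2)[of i] p(2) zeros_div_lin[OF p(2)] by auto
    ultimately show "(case p of (s, y) \<Rightarrow> y(v := s)) \<in> root_tuples (insert v V) (Suc M) a"
      using y(1) p(1,2) unfolding root_tuples_def PiE_iff extensional_def by simp
  qed
  also have "\<dots> = (\<Sum>s\<in>?Z. \<Sum>y\<in>?T s. H (y(v := s)))"
    using True V fin by (intro sum.Sigma[symmetric] ballI) (auto intro: finite_subset[OF _ finite_root_tuples])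
  also have "\<dots> = (\<Sum>s\<in>?Z. tuple_sum V M (div_lin M s a) (\<lambda>y. if s \<in> y ` V then 0 else H (y(v := s))))"
  proof (rule sum.cong[OF refl])
    fix s assume s: "s \<in> ?Z"
    have "(\<Sum>y\<in>?T s. H (y(v := s))) = (\<Sum>y\<in>root_tuples V M (div_lin M s a). if s \<in> y ` V then 0 else H (y(v := s)))"
      using finite_root_tuples[OF V(1) fin[OF s]] by (intro sum.mono_neutral_cong_left) auto
    then show "(\<Sum>y\<in>?T s. H (y(v := s))) = tuple_sum V M (div_lin M s a) (\<lambda>y. if s \<in> y ` V then 0 else H (y(v := s)))"
      using fin[OF s] by (simp add: tuple_sum_def)
  qed
  finally show ?thesis .
qed (simp add: tuple_sum_def)

lemma measurable_restrict_coords: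
  "U \<subseteq> W \<Longrightarrow> (\<lambda>x. restrict x U) \<in> measurable (PiM W (\<lambda>_. borel :: real measure)) (PiM U (\<lambda>_. borel))"
  by (rule measurable_restrict_subset)

text \<open>In the recursion the roots already chosen turn into parameters. The type of the
  parameter space cannot grow along the induction, so they are stored as the coordinates
  \<open>U\<close>, of the same index type as \<open>V\<close>.\<close>

lemma measurable_tuple_sum_aux:
  fixes A :: "('v \<Rightarrow> real) \<times> 'z \<Rightarrow> nat \<Rightarrow> real" and H :: "('v \<Rightarrow> real) \<times> 'z \<Rightarrow> ('v \<Rightarrow> real) \<Rightarrow> ennreal"
  assumes "finite V" "U \<inter> V = {}" "A \<in> measurable (PiM U (\<lambda>_. borel) \<Otimes>\<^sub>M M) (PiM {..<N} (\<lambda>_. borel))"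
    and "(\<lambda>(p, y). H p y) \<in> borel_measurable ((PiM U (\<lambda>_. borel) \<Otimes>\<^sub>M M) \<Otimes>\<^sub>M PiM V (\<lambda>_. borel))"
  shows "(\<lambda>p. tuple_sum V N (A p) (H p)) \<in> borel_measurable (PiM U (\<lambda>_. borel) \<Otimes>\<^sub>M M)"
  using assms
proof (induction V arbitrary: U A H N)
  case empty
  have "(\<lambda>p. (p, \<lambda>_. undefined)) \<in> measurable (PiM U (\<lambda>_. borel) \<Otimes>\<^sub>M M) ((PiM U (\<lambda>_. borel) \<Otimes>\<^sub>M M) \<Otimes>\<^sub>M PiM {} (\<lambda>_. borel :: real measure))"
    by (intro measurable_Pair) (auto simp: space_PiM)
  from measurable_compose[OF this empty(3)] show ?case by simp
next
  case (insert v V)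
  show ?case
  proof (cases N)
    case 0
    then have "infinite (zeros N a)" for a by (simp add: finite_zeros_iff)
    then show ?thesis by (simp add: tuple_sum_def)
  next
    case (Suc M')
    let ?P = "PiM U (\<lambda>_. borel :: real measure) \<Otimes>\<^sub>M M"
    let ?P' = "PiM (insert v U) (\<lambda>_. borel :: real measure) \<Otimes>\<^sub>M M"
    have vU: "v \<notin> U" using insert.prems(1) by auto
    have pr: "(\<lambda>(x, z). (restrict x U, z)) \<in> measurable ?P' ?P"
      unfolding case_prod_unfold
      by (intro measurable_Pair measurable_compose[OF measurable_fst measurable_restrict_coords] measurable_snd) auto
    have cv: "(\<lambda>p. fst p v) \<in> borel_measurable ?P'"
      by (rule measurable_compose[OF measurable_fst measurable_component_singleton]) simp
    define A' where "A' p = div_lin M' (fst p v) (A (restrict (fst p) U, snd p))" for p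
    define H' where "H' p y = (if fst p v \<in> y ` V then 0 else H (restrict (fst p) U, snd p) (y(v := fst p v)))" for p y
    have A': "A' \<in> measurable ?P' (PiM {..<M'} (\<lambda>_. borel))"
      unfolding A'_def
      by (intro measurable_div_lin cv) (use measurable_compose[OF pr insert.prems(2)] Suc in \<open>simp add: case_prod_unfold\<close>)
    have H': "(\<lambda>(p, y). H' p y) \<in> borel_measurable (?P' \<Otimes>\<^sub>M PiM V (\<lambda>_. borel))"
    proof -
      let ?P2 = "?P' \<Otimes>\<^sub>M PiM V (\<lambda>_. borel :: real measure)"
      have cv2: "(\<lambda>q. fst (fst q) v) \<in> borel_measurable ?P2" by (rule measurable_compose[OF measurable_fst cv])
      have "(\<lambda>q. ((restrict (fst (fst q)) U, snd (fst q)), (snd q)(v := fst (fst q) v))) \<in>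
          measurable ?P2 (?P \<Otimes>\<^sub>M PiM (insert v V) (\<lambda>_. borel))"
        using measurable_compose[OF measurable_fst pr] cv2 insert.hyps
        by (intro measurable_Pair measurable_fun_upd_last) (auto simp: case_prod_unfold)
      from measurable_compose[OF this insert.prems(3)]
      have m1: "(\<lambda>q. H (restrict (fst (fst q)) U, snd (fst q)) ((snd q)(v := fst (fst q) v))) \<in> borel_measurable ?P2" by simp
      have "Measurable.pred ?P2 (\<lambda>q. \<exists>w\<in>V. fst (fst q) v = snd q w)"
      proof (rule pred_intros_finite(4)[OF insert.hyps(1)])
        fix w assume w: "w \<in> V"
        have "(\<lambda>q. snd q w) \<in> borel_measurable ?P2"
          by (rule measurable_compose[OF measurable_snd measurable_component_singleton[OF w]])
        then show "Measurable.pred ?P2 (\<lambda>q. fst (fst q) v = snd q w)" using cv2 by measurable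
      qed
      moreover have "(fst (fst q) v \<in> snd q ` V) = (\<exists>w\<in>V. fst (fst q) v = snd q w)" for q :: "(('v \<Rightarrow> real) \<times> 'z) \<times> ('v \<Rightarrow> real)" by auto
      ultimately have m2: "Measurable.pred ?P2 (\<lambda>q. fst (fst q) v \<in> snd q ` V)" by simp
      show ?thesis unfolding H'_def case_prod_unfold using m1 m2 by (intro measurable_If_set[unfolded] measurable_If) auto
    qed
    have IH: "(\<lambda>p. tuple_sum V M' (A' p) (H' p)) \<in> borel_measurable ?P'"
      using insert.prems(1) insert.hyps(2) by (intro insert.IH A' H') auto
    have "(\<lambda>p. \<Sum>s\<in>zeros (Suc M') (A p). tuple_sum V M' (A' ((fst p)(v := s), snd p)) (H' ((fst p)(v := s), snd p))) \<in> borel_measurable ?P"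
    proof (rule measurable_sum_zeros)
      show "A \<in> measurable ?P (PiM {..<Suc M'} (\<lambda>_. borel))" using insert.prems(2) Suc by simp
      have "(\<lambda>q. ((fst (fst q))(v := snd q), snd (fst q))) \<in> measurable (?P \<Otimes>\<^sub>M borel) ?P'"
        using vU by (intro measurable_Pair measurable_fun_upd_last) measurable
      from measurable_compose[OF this IH]
      show "(\<lambda>(p, s). tuple_sum V M' (A' ((fst p)(v := s), snd p)) (H' ((fst p)(v := s), snd p))) \<in> borel_measurable (?P \<Otimes>\<^sub>M borel)"
        by (simp add: case_prod_unfold)
    qed
    also have "(\<lambda>p. \<Sum>s\<in>zeros (Suc M') (A p). tuple_sum V M' (A' ((fst p)(v := s), snd p)) (H' ((fst p)(v := s), snd p))) \<in> borel_measurable ?P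
      \<longleftrightarrow> (\<lambda>p. tuple_sum (insert v V) N (A p) (H p)) \<in> borel_measurable ?P"
    proof (rule measurable_cong)
      fix p assume "p \<in> space ?P"
      then have r: "restrict ((fst p)(v := s)) U = fst p" for s
        using vU by (auto simp: space_pair_measure space_PiM PiE_iff fun_eq_iff extensional_def)
      then show "(\<Sum>s\<in>zeros (Suc M') (A p). tuple_sum V M' (A' ((fst p)(v := s), snd p)) (H' ((fst p)(v := s), snd p))) = tuple_sum (insert v V) N (A p) (H p)"
        unfolding Suc tuple_sum_insert[OF insert.hyps] A'_def H'_def
        by (simp only: fst_conv snd_conv r fun_upd_same prod.collapse)
    qed
    finally show ?thesis .
  qed
qed

lemma measurable_tuple_sum:
  fixes H :: "'z \<Rightarrow> ('v \<Rightarrow> real) \<Rightarrow> ennreal"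
  assumes "finite V" "A \<in> measurable M (PiM {..<N} (\<lambda>_. borel))"
    and "(\<lambda>(z, y). H z y) \<in> borel_measurable (M \<Otimes>\<^sub>M PiM V (\<lambda>_. borel))"
  shows "(\<lambda>z. tuple_sum V N (A z) (H z)) \<in> borel_measurable M"
proof -
  let ?P = "PiM ({} :: 'v set) (\<lambda>_. borel :: real measure) \<Otimes>\<^sub>M M"
  have 1: "(\<lambda>p. tuple_sum V N (A (snd p)) (H (snd p))) \<in> borel_measurable ?P"
  proof (rule measurable_tuple_sum_aux[OF assms(1)])
    show "(\<lambda>p. A (snd p)) \<in> measurable ?P (PiM {..<N} (\<lambda>_. borel))"
      by (rule measurable_compose[OF measurable_snd assms(2)])
    have "(\<lambda>q. (snd (fst q), snd q)) \<in> measurable (?P \<Otimes>\<^sub>M PiM V (\<lambda>_. borel :: real measure)) (M \<Otimes>\<^sub>M PiM V (\<lambda>_. borel))"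
      by measurable
    from measurable_compose[OF this assms(3)]
    show "(\<lambda>(p, y). H (snd p) y) \<in> borel_measurable (?P \<Otimes>\<^sub>M PiM V (\<lambda>_. borel))" by (simp add: case_prod_unfold)
  qed simp
  have 2: "(\<lambda>z. (\<lambda>_. undefined, z)) \<in> measurable M ?P"
    by (intro measurable_Pair) (auto simp: space_PiM)
  show ?thesis using measurable_compose[OF 2 1] by simp
qed

section \<open>Polynomials with prescribed roots and the Jacobian of their coefficients\<close>

definition lin_prod :: "'v set \<Rightarrow> ('v \<Rightarrow> real) \<Rightarrow> real poly" where
  "lin_prod V x = (\<Prod>i\<in>V. [:- x i, 1:])"

definition tuple_poly :: "'v set \<Rightarrow> nat \<Rightarrow> ('v \<Rightarrow> real) \<Rightarrow> (nat \<Rightarrow> real) \<Rightarrow> real poly" where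
  "tuple_poly V N x t = lin_prod V x * vpoly N t"

definition tuple_coeffs :: "'v set \<Rightarrow> nat \<Rightarrow> ('v \<Rightarrow> real) \<Rightarrow> (nat \<Rightarrow> real) \<Rightarrow> nat \<Rightarrow> real" where
  "tuple_coeffs V N x t = cf (N + card V) (tuple_poly V N x t)"

lemma tuple_poly_insert:
  assumes "finite V" "v \<notin> V"
  shows "tuple_poly (insert v V) N x t = [:- x v, 1:] * tuple_poly V N x t"
  using assms by (simp add: tuple_poly_def lin_prod_def mult.assoc del: mult_pCons_left)

lemma tuple_poly_cong: "(\<And>i. i \<in> V \<Longrightarrow> x i = y i) \<Longrightarrow> tuple_poly V N x t = tuple_poly V N y t"
  by (simp add: tuple_poly_def lin_prod_def cong: prod.cong)

lemma coeff_tuple_poly_0: "finite V \<Longrightarrow> N + card V \<le> i \<Longrightarrow> coeff (tuple_poly V N x t) i = 0"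
proof (induction V arbitrary: i rule: finite_induct)
  case empty
  then show ?case by (simp add: tuple_poly_def lin_prod_def coeff_vpoly)
next
  case (insert v V)
  have "coeff (tuple_poly V N x t) (i - 1) = 0" "coeff (tuple_poly V N x t) i = 0"
    using insert.prems insert.hyps by (auto intro!: insert.IH)
  then show ?case
    unfolding tuple_poly_insert[OF insert.hyps] coeff_linear_mult by simp
qed

lemma vpoly_tuple_coeffs: "finite V \<Longrightarrow> vpoly (N + card V) (tuple_coeffs V N x t) = tuple_poly V N x t"
  unfolding tuple_coeffs_def by (rule vpoly_cf) (rule coeff_tuple_poly_0)

lemma mul_lin_tuple_coeffs:
  assumes "finite V" "v \<notin> V"
  shows "mul_lin (N + card V) s (tuple_coeffs V N y t) = tuple_coeffs (insert v V) N (y(v := s)) t"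
proof -
  have "tuple_poly V N (y(v := s)) t = tuple_poly V N y t" using assms(2) by (intro tuple_poly_cong) auto
  then show ?thesis
    unfolding mul_lin_def vpoly_tuple_coeffs[OF assms(1)] unfolding tuple_coeffs_def tuple_poly_insert[OF assms]
    using assms by (simp del: mult_pCons_left)
qed

lemma peval_tuple_coeffs:
  assumes "finite V"
  shows "peval (N + card V) (tuple_coeffs V N y t) s = (\<Prod>i\<in>V. s - y i) * peval N t s"
  unfolding peval_vpoly vpoly_tuple_coeffs[OF assms] tuple_poly_def lin_prod_def by (simp add: poly_prod)

lemma measurable_coeff_tuple_poly:
  assumes "finite V" "\<And>i. i \<in> V \<Longrightarrow> (\<lambda>z. X z i) \<in> borel_measurable M" "T \<in> measurable M (PiM {..<N} (\<lambda>_. borel))"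
  shows "(\<lambda>z. coeff (tuple_poly V N (X z) (T z)) j) \<in> borel_measurable M"
  using assms(1,2)
proof (induction V arbitrary: j rule: finite_induct)
  case empty
  then show ?case using measurable_coeff_vpoly[OF assms(3)] by (simp add: tuple_poly_def lin_prod_def)
next
  case (insert v V)
  have [measurable]: "(\<lambda>z. X z v) \<in> borel_measurable M" "\<And>j. (\<lambda>z. coeff (tuple_poly V N (X z) (T z)) j) \<in> borel_measurable M"
    using insert by auto
  show ?case unfolding tuple_poly_insert[OF insert.hyps] coeff_linear_mult by measurable
qed

lemma measurable_tuple_coeffs:
  assumes "finite V" "X \<in> measurable M (PiM V (\<lambda>_. borel))" "T \<in> measurable M (PiM {..<N} (\<lambda>_. borel))"
  shows "(\<lambda>z. tuple_coeffs V N (X z) (T z)) \<in> measurable M (PiM {..<N + card V} (\<lambda>_. borel))"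
  unfolding tuple_coeffs_def
proof (rule measurable_cf, rule measurable_coeff_tuple_poly[OF assms(1) _ assms(3)])
  show "(\<lambda>z. X z i) \<in> borel_measurable M" if "i \<in> V" for i
    by (rule measurable_compose[OF assms(2) measurable_component_singleton[OF that]])
qed

text \<open>The absolute value of the Vandermonde determinant; the order on indices lists each pair
  once.\<close>

definition vdm :: "'v::linorder set \<Rightarrow> ('v \<Rightarrow> real) \<Rightarrow> real" where
  "vdm V x = (\<Prod>i\<in>V. \<Prod>j\<in>{j \<in> V. i < j}. \<bar>x i - x j\<bar>)"

lemma vdm_insert_min:
  assumes "finite V" "\<forall>w\<in>V. v < w"
  shows "vdm (insert v V) (y(v := s)) = (\<Prod>w\<in>V. \<bar>s - y w\<bar>) * vdm V y"
proof -
  have v: "v \<notin> V" using assms by auto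
  have 1: "{j \<in> insert v V. v < j} = V" using assms by auto
  have 2: "{j \<in> insert v V. i < j} = {j \<in> V. i < j}" if "i \<in> V" for i using assms that by auto
  have "vdm (insert v V) (y(v := s)) = (\<Prod>w\<in>V. \<bar>s - (y(v := s)) w\<bar>) * (\<Prod>i\<in>V. \<Prod>j\<in>{j \<in> V. i < j}. \<bar>(y(v := s)) i - (y(v := s)) j\<bar>)"
    unfolding vdm_def using assms(1) v 1 2 by simp
  also have "(\<Prod>w\<in>V. \<bar>s - (y(v := s)) w\<bar>) = (\<Prod>w\<in>V. \<bar>s - y w\<bar>)" using v by (intro prod.cong) auto
  also have "(\<Prod>i\<in>V. \<Prod>j\<in>{j \<in> V. i < j}. \<bar>(y(v := s)) i - (y(v := s)) j\<bar>) = vdm V y"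
    unfolding vdm_def using v by (intro prod.cong) auto
  finally show ?thesis .
qed

lemma vdm_nonneg: "0 \<le> vdm V x"
  unfolding vdm_def by (intro prod_nonneg) auto

lemma measurable_vdm:
  assumes "finite V" "\<And>i. i \<in> V \<Longrightarrow> (\<lambda>z. X z i) \<in> borel_measurable M"
  shows "(\<lambda>z. vdm V (X z)) \<in> borel_measurable M"
  unfolding vdm_def using assms(2) by (intro borel_measurable_prod borel_measurable_abs borel_measurable_diff) auto

text \<open>The absolute Jacobian determinant of \<open>tuple_coeffs\<close>, as
  \<open>nn_integral_tuple_sum\<close> bears out: the Vandermonde factor times the absolute
  resultant of \<open>lin_prod V x\<close> and the cofactor.\<close>

definition jacobian :: "'v::linorder set \<Rightarrow> nat \<Rightarrow> ('v \<Rightarrow> real) \<Rightarrow> (nat \<Rightarrow> real) \<Rightarrow> real" where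
  "jacobian V N x t = vdm V x * (\<Prod>i\<in>V. \<bar>peval N t (x i)\<bar>)"

lemma jacobian_nonneg: "0 \<le> jacobian V N x t"
  unfolding jacobian_def by (intro mult_nonneg_nonneg vdm_nonneg prod_nonneg) auto

lemma measurable_jacobian:
  assumes "finite V" "X \<in> measurable M (PiM V (\<lambda>_. borel))" "T \<in> measurable M (PiM {..<N} (\<lambda>_. borel))"
  shows "(\<lambda>z. jacobian V N (X z) (T z)) \<in> borel_measurable M"
proof -
  have "(\<lambda>z. X z i) \<in> borel_measurable M" if "i \<in> V" for i
    by (rule measurable_compose[OF assms(2) measurable_component_singleton[OF that]])
  then show ?thesis unfolding jacobian_def
    by (intro borel_measurable_times borel_measurable_prod borel_measurable_abs measurable_vdm measurable_peval assms)
qed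

lemma jacobian_insert_min:
  assumes "finite V" "\<forall>w\<in>V. v < w"
  shows "jacobian (insert v V) N (y(v := s)) t = \<bar>peval (N + card V) (tuple_coeffs V N y t) s\<bar> * jacobian V N y t"
proof -
  have v: "v \<notin> V" using assms by auto
  have "(\<Prod>i\<in>V. \<bar>peval N t ((y(v := s)) i)\<bar>) = (\<Prod>i\<in>V. \<bar>peval N t (y i)\<bar>)" using v by (intro prod.cong) auto
  then show ?thesis
    using assms v by (simp add: jacobian_def vdm_insert_min peval_tuple_coeffs abs_mult prod.insert flip: abs_prod)
qed

text \<open>Induction adds a new least index \<open>v\<close> with root s. The one-root formula
  contributes |b(s)|, where b is the remaining polynomial; since b is itself the product of the X -
  y_i with the cofactor t, this is the product of the |s - y_i| times |t(s)|, exactly what the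
  Jacobian gains when \<open>v\<close> is inserted.\<close>

theorem nn_integral_tuple_sum:
  fixes V :: "'v::linorder set" and H :: "('v \<Rightarrow> real) \<Rightarrow> (nat \<Rightarrow> real) \<Rightarrow> ennreal"
  assumes "finite V"
    and "(\<lambda>(x, a). H x a) \<in> borel_measurable (PiM V (\<lambda>_. borel) \<Otimes>\<^sub>M PiM {..<N + card V} (\<lambda>_. borel))"
  shows "(\<integral>\<^sup>+a. tuple_sum V (N + card V) a (\<lambda>x. H x a) \<partial>PiM {..<N + card V} (\<lambda>_. lborel)) =
    (\<integral>\<^sup>+x. \<integral>\<^sup>+t. H x (tuple_coeffs V N x t) * ennreal (jacobian V N x t) \<partial>PiM {..<N} (\<lambda>_. lborel) \<partial>PiM V (\<lambda>_. lborel))"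
  using assms
proof (induction V arbitrary: H rule: finite_linorder_min_induct)
  case empty
  have "(\<integral>\<^sup>+t. H (\<lambda>_. undefined) t \<partial>PiM {..<N} (\<lambda>_. lborel))
     = (\<integral>\<^sup>+t. H (\<lambda>_. undefined) (cf N (vpoly N t)) \<partial>PiM {..<N} (\<lambda>_. lborel))"
    by (intro nn_integral_cong arg_cong2[where f = H] refl cf_vpoly[symmetric]) (auto simp: space_PiM PiE_iff)
  then show ?case
    by (simp add: PiM_empty nn_integral_count_space_finite tuple_coeffs_def tuple_poly_def lin_prod_def jacobian_def vdm_def)
next
  case (insert v V)
  have v: "v \<notin> V" using insert.hyps by auto
  define M where "M = N + card V"
  have M: "N + card (insert v V) = Suc M" using insert.hyps v by (simp add: M_def)
  note Hm = insert.prems[unfolded M]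
  define G where "G s a = tuple_sum V M (div_lin M s a) (\<lambda>y. if s \<in> y ` V then 0 else H (y(v := s)) a)" for s a
  have ind: "Measurable.pred (Q \<Otimes>\<^sub>M PiM V (\<lambda>_. borel)) (\<lambda>q. S (fst q) \<in> snd q ` V)" if S: "S \<in> borel_measurable Q" for S :: "'q \<Rightarrow> real" and Q
  proof -
    have "Measurable.pred (Q \<Otimes>\<^sub>M PiM V (\<lambda>_. borel :: real measure)) (\<lambda>q. \<exists>w\<in>V. S (fst q) = snd q w)"
    proof (rule pred_intros_finite(4)[OF insert.hyps(1)])
      fix w assume w: "w \<in> V"
      have "(\<lambda>q. snd q w) \<in> borel_measurable (Q \<Otimes>\<^sub>M PiM V (\<lambda>_. borel :: real measure))"
        by (rule measurable_compose[OF measurable_snd measurable_component_singleton[OF w]])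
      then show "Measurable.pred (Q \<Otimes>\<^sub>M PiM V (\<lambda>_. borel :: real measure)) (\<lambda>q. S (fst q) = snd q w)"
        using measurable_compose[OF measurable_fst S] by measurable
    qed
    moreover have "(S (fst q) \<in> snd q ` V) = (\<exists>w\<in>V. S (fst q) = snd q w)" for q :: "'q \<times> ('v \<Rightarrow> real)" by auto
    ultimately show ?thesis by simp
  qed
  have G: "(\<lambda>(s, a). G s a) \<in> borel_measurable (borel \<Otimes>\<^sub>M PiM {..<Suc M} (\<lambda>_. borel))"
  proof -
    let ?Q = "borel \<Otimes>\<^sub>M PiM {..<Suc M} (\<lambda>_. borel :: real measure)"
    have "(\<lambda>p. tuple_sum V M (div_lin M (fst p) (snd p)) (\<lambda>y. if fst p \<in> y ` V then 0 else H (y(v := fst p)) (snd p))) \<in> borel_measurable ?Q"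
    proof (rule measurable_tuple_sum[OF insert.hyps(1)])
      show "(\<lambda>p. div_lin M (fst p) (snd p)) \<in> measurable ?Q (PiM {..<M} (\<lambda>_. borel))"
        by (intro measurable_div_lin) measurable
      have "(\<lambda>q. ((snd q)(v := fst (fst q)), snd (fst q))) \<in> measurable (?Q \<Otimes>\<^sub>M PiM V (\<lambda>_. borel :: real measure)) (PiM (insert v V) (\<lambda>_. borel) \<Otimes>\<^sub>M PiM {..<Suc M} (\<lambda>_. borel))"
        using v by (intro measurable_Pair measurable_fun_upd_last) measurable
      from measurable_compose[OF this Hm] ind[of "fst" ?Q]
      show "(\<lambda>(p, y). if fst p \<in> y ` V then 0 else H (y(v := fst p)) (snd p)) \<in> borel_measurable (?Q \<Otimes>\<^sub>M PiM V (\<lambda>_. borel))"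
        unfolding case_prod_unfold by (intro measurable_If) auto
    qed
    then show ?thesis by (simp add: G_def case_prod_unfold)
  qed
  define J where "J s y t = \<bar>peval M (tuple_coeffs V N y t) s\<bar>" for s y t
  define F where "F x t = H x (tuple_coeffs (insert v V) N x t) * ennreal (jacobian (insert v V) N x t)" for x t
  have F: "(\<lambda>(x, t). F x t) \<in> borel_measurable (PiM (insert v V) (\<lambda>_. borel) \<Otimes>\<^sub>M PiM {..<N} (\<lambda>_. borel))"
  proof -
    let ?Q = "PiM (insert v V) (\<lambda>_. borel :: real measure) \<Otimes>\<^sub>M PiM {..<N} (\<lambda>_. borel :: real measure)"
    have fin: "finite (insert v V)" using insert.hyps by simp
    have "(\<lambda>p. (fst p, tuple_coeffs (insert v V) N (fst p) (snd p))) \<in> measurable ?Q (PiM (insert v V) (\<lambda>_. borel) \<Otimes>\<^sub>M PiM {..<Suc M} (\<lambda>_. borel))"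
      using measurable_tuple_coeffs[OF fin measurable_fst measurable_snd, of N] unfolding M
      by (intro measurable_Pair measurable_fst) simp
    from measurable_compose[OF this Hm]
    have "(\<lambda>p. H (fst p) (tuple_coeffs (insert v V) N (fst p) (snd p))) \<in> borel_measurable ?Q" by simp
    moreover have "(\<lambda>p. ennreal (jacobian (insert v V) N (fst p) (snd p))) \<in> borel_measurable ?Q"
      by (intro measurable_compose[OF _ measurable_ennreal] measurable_jacobian fin) auto
    ultimately show ?thesis unfolding F_def case_prod_unfold by (rule borel_measurable_times_ennreal)
  qed
  have "(\<integral>\<^sup>+a. tuple_sum (insert v V) (Suc M) a (\<lambda>x. H x a) \<partial>PiM {..<Suc M} (\<lambda>_. lborel))
     = (\<integral>\<^sup>+a. (\<Sum>s\<in>zeros (Suc M) a. G s a) \<partial>PiM {..<Suc M} (\<lambda>_. lborel))"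
    unfolding tuple_sum_insert[OF insert.hyps(1) v] G_def ..
  also have "\<dots> = (\<integral>\<^sup>+s. \<integral>\<^sup>+b. \<bar>peval M b s\<bar> * G s (mul_lin M s b) \<partial>PiM {..<M} (\<lambda>_. lborel) \<partial>lborel)"
    by (rule nn_integral_sum_zeros[OF G])
  also have "\<dots> = (\<integral>\<^sup>+s. \<integral>\<^sup>+y. \<integral>\<^sup>+t. F (y(v := s)) t \<partial>PiM {..<N} (\<lambda>_. lborel) \<partial>PiM V (\<lambda>_. lborel) \<partial>lborel)"
  proof (rule nn_integral_cong)
    fix s :: real
    define H' where "H' y b = ennreal \<bar>peval M b s\<bar> * (if s \<in> y ` V then 0 else H (y(v := s)) (mul_lin M s b))" for y :: "'v \<Rightarrow> real" and b
    have H': "(\<lambda>(y, b). H' y b) \<in> borel_measurable (PiM V (\<lambda>_. borel) \<Otimes>\<^sub>M PiM {..<M} (\<lambda>_. borel))"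
    proof -
      let ?Q = "PiM V (\<lambda>_. borel :: real measure) \<Otimes>\<^sub>M PiM {..<M} (\<lambda>_. borel :: real measure)"
      have "(\<lambda>q. ((fst q)(v := s), mul_lin M s (snd q))) \<in> measurable ?Q (PiM (insert v V) (\<lambda>_. borel) \<Otimes>\<^sub>M PiM {..<Suc M} (\<lambda>_. borel))"
        using v by (intro measurable_Pair measurable_fun_upd_last measurable_mul_lin) auto
      from measurable_compose[OF this Hm] have 1: "(\<lambda>q. H ((fst q)(v := s)) (mul_lin M s (snd q))) \<in> borel_measurable ?Q" by simp
      have 2: "Measurable.pred ?Q (\<lambda>q. s \<in> fst q ` V)"
        using measurable_compose[OF measurable_pair_swap' ind[of "\<lambda>_. s" "PiM {..<M} (\<lambda>_. borel)"]] by (simp add: case_prod_unfold)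
      have 3: "(\<lambda>q. ennreal \<bar>peval M (snd q) s\<bar>) \<in> borel_measurable ?Q"
        by (intro measurable_compose[OF _ measurable_ennreal] borel_measurable_abs measurable_peval) auto
      show ?thesis unfolding H'_def case_prod_unfold using 1 2 3 by (intro borel_measurable_times_ennreal measurable_If) auto
    qed
    have "(\<integral>\<^sup>+b. \<bar>peval M b s\<bar> * G s (mul_lin M s b) \<partial>PiM {..<M} (\<lambda>_. lborel))
       = (\<integral>\<^sup>+b. tuple_sum V M b (\<lambda>y. H' y b) \<partial>PiM {..<M} (\<lambda>_. lborel))"
      unfolding G_def H'_def tuple_sum_cmult
      by (intro nn_integral_cong) (simp add: div_mul_lin space_PiM PiE_iff)
    also have "\<dots> = (\<integral>\<^sup>+y. \<integral>\<^sup>+t. H' y (tuple_coeffs V N y t) * ennreal (jacobian V N y t) \<partial>PiM {..<N} (\<lambda>_. lborel) \<partial>PiM V (\<lambda>_. lborel))"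
      unfolding M_def by (rule insert.IH) (use H' in \<open>simp add: M_def\<close>)
    also have "\<dots> = (\<integral>\<^sup>+y. \<integral>\<^sup>+t. F (y(v := s)) t \<partial>PiM {..<N} (\<lambda>_. lborel) \<partial>PiM V (\<lambda>_. lborel))"
    proof (intro nn_integral_cong)
      fix y t
      have jac: "jacobian (insert v V) N (y(v := s)) t = \<bar>peval M (tuple_coeffs V N y t) s\<bar> * jacobian V N y t"
        unfolding M_def using insert.hyps by (rule jacobian_insert_min)
      show "H' y (tuple_coeffs V N y t) * ennreal (jacobian V N y t) = F (y(v := s)) t"
      proof (cases "s \<in> y ` V")
        \<comment> \<open>Tuples with a repeated root are excluded on the left; on the right the
          Jacobian vanishes there.\<close>
        case True
        then have "peval M (tuple_coeffs V N y t) s = 0"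
          unfolding M_def peval_tuple_coeffs[OF insert.hyps(1)] using insert.hyps(1) by (auto intro!: prod_zero)
        then show ?thesis using jac by (simp add: H'_def F_def)
      next
        case False
        then show ?thesis
          using mul_lin_tuple_coeffs[OF insert.hyps(1) v, of N s y t]
          by (simp add: H'_def F_def jac ennreal_mult jacobian_nonneg M_def mult_ac)
      qed
    qed
    finally show "(\<integral>\<^sup>+b. \<bar>peval M b s\<bar> * G s (mul_lin M s b) \<partial>PiM {..<M} (\<lambda>_. lborel)) = \<dots>" .
  qed
  also have "\<dots> = (\<integral>\<^sup>+x. \<integral>\<^sup>+t. F x t \<partial>PiM {..<N} (\<lambda>_. lborel) \<partial>PiM (insert v V) (\<lambda>_. lborel))"
  proof (rule lborel_prod.product_nn_integral_insert_rev[OF insert.hyps(1) v, symmetric])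
    interpret sigma_finite_measure "PiM {..<N} (\<lambda>_. lborel :: real measure)"
      by (rule lborel_prod.sigma_finite) simp
    have "(\<lambda>(x, t). F x t) \<in> borel_measurable (PiM (insert v V) (\<lambda>_. borel) \<Otimes>\<^sub>M PiM {..<N} (\<lambda>_. lborel))"
      using F by (simp only: measurable_pair_PiM_lborel)
    from borel_measurable_nn_integral[OF this]
    show "(\<lambda>x. \<integral>\<^sup>+t. F x t \<partial>PiM {..<N} (\<lambda>_. lborel)) \<in> borel_measurable (PiM (insert v V) (\<lambda>_. lborel))"
      by (simp only: measurable_PiM_lborel)
  qed
  finally show ?case unfolding M F_def .
qed

subsection \<open>Walls in coefficient space\<close>

lemma lin_prod_dvd:
  assumes "finite V" "\<And>i. i \<in> V \<Longrightarrow> poly p (x i) = 0" "inj_on x V"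
  shows "\<exists>q. p = lin_prod V x * q"
  using assms
proof (induction V rule: finite_induct)
  case empty
  then show ?case by (simp add: lin_prod_def)
next
  case (insert v V)
  then obtain q where q: "p = lin_prod V x * q" by auto
  have "x v \<noteq> x i" if "i \<in> V" for i using inj_onD[OF insert.prems(2), of v i] insert.hyps that by auto
  then have "poly (lin_prod V x) (x v) \<noteq> 0" using insert.hyps by (auto simp: lin_prod_def poly_prod)
  moreover have "poly p (x v) = 0" using insert.prems by simp
  ultimately have "poly q (x v) = 0" using q by simp
  then obtain r where "q = [:- x v, 1:] * r" unfolding poly_eq_0_iff_dvd by (elim dvdE)
  then have "p = lin_prod (insert v V) x * r"
    using q insert.hyps by (simp add: lin_prod_def mult_ac del: mult_pCons_left mult_pCons_right)
  then show ?case by blast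
qed

lemma degree_lin_prod: "finite V \<Longrightarrow> degree (lin_prod V x) = card V"
  unfolding lin_prod_def by (subst degree_prod_eq_sum_degree) auto

lemma lin_prod_nonzero: "lin_prod V x \<noteq> 0"
  unfolding lin_prod_def by (cases "finite V") auto

lemma vpoly_poly_coeff: "degree q < N \<Longrightarrow> vpoly N (coeff q) = q"
  by (rule poly_eqI) (auto simp: coeff_vpoly coeff_eq_0)

lemma multiple_eq_tuple_poly:
  assumes "finite V" "vpoly (N + card V) a = lin_prod V x * q" "vpoly (N + card V) a \<noteq> 0"
  shows "vpoly (N + card V) a = tuple_poly V N x (coeff q)"
proof -
  have "q \<noteq> 0" using assms(2,3) by auto
  then have "degree (vpoly (N + card V) a) = card V + degree q"
    unfolding assms(2) using degree_lin_prod[OF assms(1)] lin_prod_nonzero by (subst degree_mult_eq) auto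
  moreover have "0 < N + card V" using assms(3) by (cases "N + card V = 0") (auto simp: vpoly_def)
  ultimately have "degree q < N" using degree_vpoly[of "N + card V" a] by linarith
  then show ?thesis unfolding tuple_poly_def assms(2) by (simp add: vpoly_poly_coeff)
qed

text \<open>Each root occurs in a single linear factor and \<open>t\<close> enters linearly, hence
  degree 1 in each variable.\<close>

lemma sepoly_coeff_tuple_poly:
  assumes "finite V"
  shows "sepoly (V <+> {..<N}) 1 (\<lambda>y. coeff (tuple_poly V N (\<lambda>i. y (Inl i)) (\<lambda>i. y (Inr i))) j)"
proof (rule sepolyI, goal_cases)
  case (1 w y)
  then consider (l) i where "w = Inl i" "i \<in> V" | (r) i where "w = Inr i" "i < N" by auto
  then show ?case
  proof cases
    case l
    define W where "W = V - {i}"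
    have W: "finite W" "i \<notin> W" "V = insert i W" using assms l by (auto simp: W_def)
    define p where "p = tuple_poly W N (\<lambda>i. y (Inl i)) (\<lambda>i. y (Inr i))"
    have "tuple_poly W N (\<lambda>i. (y(w := s)) (Inl i)) (\<lambda>i. (y(w := s)) (Inr i)) = p" for s
      unfolding p_def l(1) using W(2) by (auto simp: tuple_poly_def lin_prod_def intro!: prod.cong)
    then have "coeff (tuple_poly V N (\<lambda>i. (y(w := s)) (Inl i)) (\<lambda>i. (y(w := s)) (Inr i))) j
      = poly [:(if j = 0 then 0 else coeff p (j - 1)), - coeff p j:] s" for s
      unfolding W(3) tuple_poly_insert[OF W(1,2)] coeff_linear_mult using l(1) by simp
    then show ?thesis by (intro exI[of _ "[:(if j = 0 then 0 else coeff p (j - 1)), - coeff p j:]"]) simp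
  next
    case r
    let ?L = "lin_prod V (\<lambda>i. y (Inl i))"
    have e: "vpoly N (\<lambda>i. (y(w := s)) (Inr i)) = vpoly N (\<lambda>i. (y(w := 0)) (Inr i)) + smult s (monom 1 i)" for s
    proof (rule poly_eqI)
      fix j
      show "coeff (vpoly N (\<lambda>i. (y(w := s)) (Inr i))) j = coeff (vpoly N (\<lambda>i. (y(w := 0)) (Inr i)) + smult s (monom 1 i)) j"
        using r by (cases "j = i") (simp_all add: coeff_vpoly)
    qed
    have "coeff (tuple_poly V N (\<lambda>i. (y(w := s)) (Inl i)) (\<lambda>i. (y(w := s)) (Inr i))) j
      = poly [:coeff (?L * vpoly N (\<lambda>i. (y(w := 0)) (Inr i))) j, coeff (?L * monom 1 i) j:] s" for s
      unfolding tuple_poly_def e[of s] using r(1) by (simp add: distrib_left)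
    then show ?thesis
      by (intro exI[of _ "[:coeff (?L * vpoly N (\<lambda>i. (y(w := 0)) (Inr i))) j, coeff (?L * monom 1 i) j:]"]) simp
  qed
qed

text \<open>\<open>(x, t) \<mapsto> tuple_coeffs V N x t\<close> has as many parameters as coefficients, and \<open>P x = 0\<close> removes one
  degree of freedom, so the image satisfies a nontrivial polynomial equation.\<close>

lemma root_tuple_wall:
  fixes V :: "'v set" and P :: "('v \<Rightarrow> real) \<Rightarrow> real"
  assumes V: "finite V" "N > 0" and P: "sepoly V d P" "P x0 \<noteq> 0"
    and Pdep: "\<And>x y. (\<And>i. i \<in> V \<Longrightarrow> x i = y i) \<Longrightarrow> P x = P y"
  defines "M \<equiv> N + card V"
  shows "\<exists>F. sepoly {..<M} (M ^ M * d) F \<and> (\<exists>a. (\<forall>j. j \<notin> {..<M} \<longrightarrow> a j = 0) \<and> F a \<noteq> 0) \<and>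
    (\<forall>a x q. vpoly M a \<noteq> 0 \<longrightarrow> vpoly M a = lin_prod V x * q \<longrightarrow> P x = 0 \<longrightarrow> F a = 0)"
proof -
  define I where "I = V <+> {..<N}"
  define \<phi> where "\<phi> y j = coeff (tuple_poly V N (\<lambda>i. y (Inl i)) (\<lambda>i. y (Inr i))) j" for y :: "'v + nat \<Rightarrow> real" and j
  have I: "finite I" "card I = M" using V by (simp_all add: I_def M_def card_Plus)
  have M: "M > 0" using V by (simp add: M_def)
  have ex: "\<exists>F. sepoly {..<M} (M ^ M * d) F \<and> (\<exists>a. (\<forall>j. j \<notin> {..<M} \<longrightarrow> a j = 0) \<and> F a \<noteq> 0) \<and>
    (\<forall>y. (\<forall>i. i \<notin> I \<longrightarrow> y i = 0) \<longrightarrow> P (\<lambda>i. y (Inl i)) = 0 \<longrightarrow> F (\<phi> y) = 0) \<and>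
    (\<forall>a b. (\<forall>j\<in>{..<M}. a j = b j) \<longrightarrow> F a = F b)"
  proof (rule elimination[OF I _ _ M])
    show "sepoly I 1 (\<lambda>y. \<phi> y j)" for j
      unfolding I_def \<phi>_def by (rule sepoly_coeff_tuple_poly[OF V(1)])
    show "sepoly I d (\<lambda>y. P (\<lambda>i. y (Inl i)))"
    proof (rule sepolyI, goal_cases)
      case (1 w y)
      then consider (l) i where "w = Inl i" "i \<in> V" | (r) i where "w = Inr i" by (auto simp: I_def)
      then show ?case
      proof cases
        case l
        have "(\<lambda>j. (y(w := s)) (Inl j)) = (\<lambda>j. y (Inl j))(i := s)" for s using l by (auto simp: fun_eq_iff)
        then show ?thesis using sepolyE[OF P(1) l(2), of "\<lambda>j. y (Inl j)"] by metis
      next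
        case r
        then show ?thesis by (intro exI[of _ "[:P (\<lambda>i. y (Inl i)):]"]) simp
      qed
    qed
    show "P (\<lambda>i. (case Inl i of Inl i \<Rightarrow> if i \<in> V then x0 i else 0 | Inr _ \<Rightarrow> 0)) \<noteq> 0"
      using P(2) Pdep[of "\<lambda>i. if i \<in> V then x0 i else 0" x0] by simp
    show "(case i of Inl i \<Rightarrow> if i \<in> V then x0 i else 0 | Inr _ \<Rightarrow> 0) = 0" if "i \<notin> I" for i
      using that by (auto simp: I_def split: sum.splits)
  qed simp_all
  obtain F where F1: "sepoly {..<M} (M ^ M * d) F" and F2: "\<exists>a. (\<forall>j. j \<notin> {..<M} \<longrightarrow> a j = 0) \<and> F a \<noteq> 0"
    and F3: "\<forall>y. (\<forall>i. i \<notin> I \<longrightarrow> y i = 0) \<longrightarrow> P (\<lambda>i. y (Inl i)) = 0 \<longrightarrow> F (\<phi> y) = 0"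
    and F4: "\<forall>a b. (\<forall>j\<in>{..<M}. a j = b j) \<longrightarrow> F a = F b"
    using ex by blast
  have "F a = 0" if a: "vpoly M a \<noteq> 0" "vpoly M a = lin_prod V x * q" "P x = 0" for a x q
  proof -
    \<comment> \<open>\<open>F3\<close> speaks of parameter vectors that are 0 outside
      \<open>I\<close>, so the roots and the coefficients of the cofactor are extended by 0.\<close>
    define y where "y w = (case w of Inl i \<Rightarrow> if i \<in> V then x i else 0 | Inr i \<Rightarrow> if i < N then coeff q i else 0)" for w
    have "tuple_poly V N x (coeff q) = tuple_poly V N (\<lambda>i. y (Inl i)) (\<lambda>i. y (Inr i))"
      by (auto simp: tuple_poly_def lin_prod_def vpoly_def y_def intro!: arg_cong2[where f = "(*)"] prod.cong sum.cong)
    then have "vpoly M a = tuple_poly V N (\<lambda>i. y (Inl i)) (\<lambda>i. y (Inr i))"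
      using multiple_eq_tuple_poly[OF V(1)] a(1,2) unfolding M_def by metis
    then have "a j = \<phi> y j" if "j < M" for j
      using that by (metis \<phi>_def coeff_vpoly)
    then have "F a = F (\<phi> y)" using F4 by simp
    also have "\<dots> = 0"
    proof (rule F3[rule_format])
      show "y i = 0" if "i \<notin> I" for i using that by (auto simp: I_def y_def split: sum.splits)
      show "P (\<lambda>i. y (Inl i)) = 0" using a(3) Pdep[of "\<lambda>i. y (Inl i)" x] by (simp add: y_def)
    qed
    finally show ?thesis .
  qed
  with F1 F2 show ?thesis by blast
qed

text \<open>View the sum as a polynomial in the variable \<open>w\<close>. Its coefficient at the
  exponent \<open>\<alpha>0 w\<close> is again such a sum in fewer variables, nonzero at some
  \<open>x\<close> by induction; then a value of \<open>w\<close> that is not a root completes the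
  point.\<close>

lemma monomials_independent:
  fixes c :: "('v \<Rightarrow> nat) \<Rightarrow> real"
  assumes "finite W" "finite A" "\<And>\<alpha> i. \<alpha> \<in> A \<Longrightarrow> i \<notin> W \<Longrightarrow> \<alpha> i = 0" "\<alpha>0 \<in> A" "c \<alpha>0 \<noteq> 0"
  shows "\<exists>x. (\<Sum>\<alpha>\<in>A. c \<alpha> * (\<Prod>i\<in>W. x i ^ \<alpha> i)) \<noteq> 0"
  using assms
proof (induction W arbitrary: A c \<alpha>0 rule: finite_induct)
  case empty
  then have "\<alpha> = (\<lambda>_. 0)" if "\<alpha> \<in> A" for \<alpha> using that by auto
  then have "A = {\<alpha>0}" using empty.prems(3) by blast
  then show ?case using empty by simp
next
  case (insert w W)
  define E where "E = {\<alpha> \<in> A. \<alpha> w = \<alpha>0 w}"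
  let ?z = "\<lambda>\<alpha>. \<alpha>(w := 0)"
  have inj: "inj_on ?z E"
  proof (rule inj_onI)
    fix \<alpha> \<beta> assume "\<alpha> \<in> E" "\<beta> \<in> E" "?z \<alpha> = ?z \<beta>"
    then show "\<alpha> = \<beta>" unfolding E_def by (metis (mono_tags, lifting) fun_upd_triv fun_upd_upd mem_Collect_eq)
  qed
  have "\<exists>x. (\<Sum>\<beta>\<in>?z ` E. c (\<beta>(w := \<alpha>0 w)) * (\<Prod>i\<in>W. x i ^ \<beta> i)) \<noteq> 0"
  proof (rule insert.IH)
    show "finite (?z ` E)" using insert.prems(1) by (simp add: E_def)
    show "?z \<alpha>0 \<in> ?z ` E" "c ((?z \<alpha>0)(w := \<alpha>0 w)) \<noteq> 0" using insert.prems by (auto simp: E_def)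
    show "\<beta> i = 0" if "\<beta> \<in> ?z ` E" "i \<notin> W" for \<beta> i
      using that insert.prems(2) by (auto simp: E_def)
  qed
  then obtain x where x: "(\<Sum>\<beta>\<in>?z ` E. c (\<beta>(w := \<alpha>0 w)) * (\<Prod>i\<in>W. x i ^ \<beta> i)) \<noteq> 0" by blast
  have "(\<Sum>\<beta>\<in>?z ` E. c (\<beta>(w := \<alpha>0 w)) * (\<Prod>i\<in>W. x i ^ \<beta> i)) = (\<Sum>\<alpha>\<in>E. c \<alpha> * (\<Prod>i\<in>W. x i ^ \<alpha> i))"
  proof (subst sum.reindex[OF inj], rule sum.cong[OF refl])
    fix \<alpha> assume "\<alpha> \<in> E"
    then have "(?z \<alpha>)(w := \<alpha>0 w) = \<alpha>" by (auto simp: E_def fun_eq_iff)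
    moreover have "(\<Prod>i\<in>W. x i ^ (?z \<alpha>) i) = (\<Prod>i\<in>W. x i ^ \<alpha> i)" using insert.hyps by (intro prod.cong) auto
    ultimately show "((\<lambda>\<beta>. c (\<beta>(w := \<alpha>0 w)) * (\<Prod>i\<in>W. x i ^ \<beta> i)) \<circ> ?z) \<alpha> = c \<alpha> * (\<Prod>i\<in>W. x i ^ \<alpha> i)"
      by (simp only: comp_def)
  qed
  with x have xE: "(\<Sum>\<alpha>\<in>E. c \<alpha> * (\<Prod>i\<in>W. x i ^ \<alpha> i)) \<noteq> 0" by simp
  define p where "p = (\<Sum>\<alpha>\<in>A. monom (c \<alpha> * (\<Prod>i\<in>W. x i ^ \<alpha> i)) (\<alpha> w))"
  have "coeff p (\<alpha>0 w) = (\<Sum>\<alpha>\<in>A. if \<alpha> w = \<alpha>0 w then c \<alpha> * (\<Prod>i\<in>W. x i ^ \<alpha> i) else 0)"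
    by (simp add: p_def coeff_sum)
  also have "\<dots> = (\<Sum>\<alpha>\<in>E. c \<alpha> * (\<Prod>i\<in>W. x i ^ \<alpha> i))"
    unfolding E_def by (rule sum.inter_filter[OF insert.prems(1), symmetric])
  finally have "p \<noteq> 0" using xE by auto
  then obtain s where s: "poly p s \<noteq> 0" using poly_all_0_iff_0 by blast
  have "(\<Sum>\<alpha>\<in>A. c \<alpha> * (\<Prod>i\<in>insert w W. (x(w := s)) i ^ \<alpha> i)) = poly p s"
    unfolding p_def poly_sum poly_monom
  proof (rule sum.cong[OF refl])
    fix \<alpha>
    have "(\<Prod>i\<in>W. (x(w := s)) i ^ \<alpha> i) = (\<Prod>i\<in>W. x i ^ \<alpha> i)" using insert.hyps by (intro prod.cong) auto
    then show "c \<alpha> * (\<Prod>i\<in>insert w W. (x(w := s)) i ^ \<alpha> i) = c \<alpha> * (\<Prod>i\<in>W. x i ^ \<alpha> i) * s ^ \<alpha> w"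
      using insert.hyps by simp
  qed
  with s show ?case by (intro exI[of _ "x(w := s)"]) simp
qed

lemma mpoly_eval_nonzero:
  assumes "alg_poly c d"
  shows "\<exists>x :: real^'k::finite. mpoly_eval c x \<noteq> 0"
proof -
  obtain \<alpha>0 where "c \<alpha>0 \<noteq> 0" using assms by (auto simp: alg_poly_def)
  then obtain x where "(\<Sum>\<alpha>\<in>{\<alpha>. c \<alpha> \<noteq> 0}. c \<alpha> * (\<Prod>i\<in>UNIV. x i ^ \<alpha> i)) \<noteq> 0"
    using monomials_independent[of UNIV "{\<alpha>. c \<alpha> \<noteq> 0}" \<alpha>0 c] assms by (auto simp: alg_poly_def)
  then show ?thesis by (intro exI[of _ "\<chi> i. x i"]) (simp add: mpoly_eval_def)
qed

lemma sepoly_mpoly_eval: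
  assumes "alg_poly c d"
  shows "sepoly (UNIV :: 'k set) d (\<lambda>x. mpoly_eval c (\<chi> i. x i :: real^'k::finite))"
  unfolding mpoly_eval_def
proof (rule sepoly_sum)
  fix \<alpha> :: "'k \<Rightarrow> nat" assume "\<alpha> \<in> {\<alpha>. c \<alpha> \<noteq> 0}"
  then have le: "(\<Sum>i\<in>UNIV. \<alpha> i) \<le> d" using assms by (simp add: alg_poly_def)
  have "\<alpha> i \<le> d" for i using member_le_sum[of i UNIV \<alpha>] le by simp
  then have "sepoly UNIV d (\<lambda>x. \<Prod>i\<in>UNIV. poly (monom 1 (\<alpha> i)) (x i))"
    by (intro sepoly_prod_coords) (simp_all add: degree_monom_eq)
  from sepoly_mult[OF sepoly_const[of UNIV 0 "c \<alpha>"] this]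
  show "sepoly UNIV d (\<lambda>x. c \<alpha> * (\<Prod>i\<in>UNIV. (\<chi> i. x i :: real^'k) $ i ^ \<alpha> i))" by (simp add: poly_monom)
qed

subsection \<open>Local constancy of the root-tuple count\<close>

lemma eventually_curve_in_open:
  assumes "continuous_on UNIV c" "open U" "c (s0 :: real) \<in> U"
  shows "\<forall>\<^sub>F s in nhds s0. c s \<in> U"
proof -
  have "open (c -` U)" using assms by (intro open_vimage)
  then have "\<forall>\<^sub>F s in nhds s0. s \<in> c -` U" using assms(3) by (intro eventually_nhds_in_open) auto
  then show ?thesis by simp
qed

lemma pderiv_vpoly: "pderiv (vpoly N a) = vpoly (N - 1) (\<lambda>i. real (Suc i) * a (Suc i))"
  by (rule poly_eqI) (auto simp: coeff_pderiv coeff_vpoly)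

text \<open>Large roots are small roots of the reversed polynomial, whose constant term is the
  leading coefficient; this turns a nonzero leading coefficient into a uniform bound on the
  roots.\<close>

lemma peval_reverse:
  assumes "x \<noteq> 0"
  shows "peval N a x = x ^ (N - 1) * peval N (\<lambda>i. a (N - Suc i)) (1 / x)"
proof -
  have "peval N a x = (\<Sum>i<N. a (N - Suc i) * x ^ (N - Suc i))"
    unfolding peval_def by (rule sum.nat_diff_reindex[symmetric])
  also have "\<dots> = (\<Sum>i<N. x ^ (N - 1) * (a (N - Suc i) * (1 / x) ^ i))"
  proof (rule sum.cong[OF refl])
    fix i assume "i \<in> {..<N}"
    then have "x ^ (N - 1) = x ^ (N - Suc i) * x ^ i" by (simp flip: power_add)
    then show "a (N - Suc i) * x ^ (N - Suc i) = x ^ (N - 1) * (a (N - Suc i) * (1 / x) ^ i)"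
      using assms by (simp add: power_divide)
  qed
  finally show ?thesis by (simp add: peval_def sum_distrib_left)
qed

text \<open>Near each simple root the perturbed polynomial changes sign and has nonzero derivative,
  so it has exactly one root there. The rest of a large interval is compact and stays free of roots,
  and the nonzero leading coefficient keeps further roots from coming in from infinity.\<close>

lemma zeros_stable:
  fixes c :: "real \<Rightarrow> nat \<Rightarrow> real"
  assumes c: "continuous_on UNIV c" and N: "N > 0" and lead: "c s0 (N - 1) \<noteq> 0"
    and simple: "\<And>x. x \<in> zeros N (c s0) \<Longrightarrow> poly (pderiv (vpoly N (c s0))) x \<noteq> 0" and e0: "e0 > 0"
  shows "\<forall>\<^sub>F s in nhds s0. \<exists>h. bij_betw h (zeros N (c s0)) (zeros N (c s)) \<and> (\<forall>r\<in>zeros N (c s0). \<bar>h r - r\<bar> < e0)"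
proof -
  define R where "R = zeros N (c s0)"
  define p where "p s = vpoly N (c s)" for s
  have zp: "zeros N (c s) = {x. poly (p s) x = 0}" for s by (simp add: zeros_def peval_vpoly p_def)
  have finR: "finite R" unfolding R_def finite_zeros_iff using lead N by (intro exI[of _ "N - 1"]) auto
  have cc: "continuous_on UNIV (\<lambda>s. c s i)" for i
    by (rule continuous_on_compose2[OF continuous_on_product_coordinates c]) simp
  have cp: "continuous_on UNIV (\<lambda>s. poly (p s) x)" for x
    unfolding p_def peval_vpoly[symmetric] peval_def by (intro continuous_intros cc)
  \<comment> \<open>A radius at which the derivative has no zero on the closed intervals around the
    roots and these intervals are disjoint.\<close>
  have "\<forall>\<^sub>F e in at_right 0. \<forall>r\<in>R. (\<forall>x. \<bar>x - r\<bar> \<le> e \<longrightarrow> poly (pderiv (p s0)) x \<noteq> 0) \<and> (\<forall>r'\<in>R. r' \<noteq> r \<longrightarrow> 2 * e < \<bar>r - r'\<bar>)"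
  proof (intro eventually_ball_finite[OF finR] ballI eventually_conj)
    fix r assume r: "r \<in> R"
    have "\<forall>\<^sub>F x in at r. poly (pderiv (p s0)) x \<noteq> 0"
      using simple[of r] r by (intro tendsto_imp_eventually_ne[OF poly_isCont[unfolded isCont_def]]) (auto simp: R_def p_def)
    then obtain d where d: "d > 0" "\<And>x. x \<noteq> r \<Longrightarrow> dist x r < d \<Longrightarrow> poly (pderiv (p s0)) x \<noteq> 0"
      unfolding eventually_at by auto
    have nz: "poly (pderiv (p s0)) x \<noteq> 0" if "\<bar>x - r\<bar> < d" for x
      using d(2)[of x] simple[of r] r that by (cases "x = r") (auto simp: dist_real_def R_def p_def)
    show "\<forall>\<^sub>F e in at_right 0. \<forall>x. \<bar>x - r\<bar> \<le> e \<longrightarrow> poly (pderiv (p s0)) x \<noteq> 0"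
      unfolding eventually_at_right_field using d(1) nz by (intro exI[of _ d]) auto
    fix r' assume "r' \<in> R"
    show "\<forall>\<^sub>F e in at_right 0. r' \<noteq> r \<longrightarrow> 2 * e < \<bar>r - r'\<bar>"
    proof (cases "r' = r")
      case False
      then show ?thesis unfolding eventually_at_right_field by (intro exI[of _ "\<bar>r - r'\<bar> / 2"]) auto
    qed simp
  qed
  moreover have "\<forall>\<^sub>F e in at_right 0. e < e0 \<and> (0::real) < e"
    unfolding eventually_at_right_field using e0 by (intro exI[of _ e0]) auto
  ultimately have "\<forall>\<^sub>F e in at_right 0. e < e0 \<and> 0 < e \<and> (\<forall>r\<in>R. (\<forall>x. \<bar>x - r\<bar> \<le> e \<longrightarrow> poly (pderiv (p s0)) x \<noteq> 0) \<and> (\<forall>r'\<in>R. r' \<noteq> r \<longrightarrow> 2 * e < \<bar>r - r'\<bar>))"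
    by eventually_elim auto
  from eventually_happens'[OF _ this] obtain e where ee: "e < e0 \<and> 0 < e \<and> (\<forall>r\<in>R. (\<forall>x. \<bar>x - r\<bar> \<le> e \<longrightarrow> poly (pderiv (p s0)) x \<noteq> 0) \<and> (\<forall>r'\<in>R. r' \<noteq> r \<longrightarrow> 2 * e < \<bar>r - r'\<bar>))"
    by (auto simp: trivial_limit_at_right_real)
  then have e: "e < e0" "0 < e" by simp_all
  have e_deriv: "poly (pderiv (p s0)) x \<noteq> 0" if "r \<in> R" "\<bar>x - r\<bar> \<le> e" for r x using ee that by blast
  have e_sep: "2 * e < \<bar>r - r'\<bar>" if "r \<in> R" "r' \<in> R" "r' \<noteq> r" for r r' using ee that by blast
  define rev where "rev s i = c s (N - Suc i)" for s i
  have crev: "continuous_on UNIV rev" unfolding rev_def by (intro continuous_on_coordinatewise_then_product cc)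
  have "poly (vpoly N (rev s0)) 0 \<noteq> 0"
    using lead N by (simp add: poly_0_coeff_0 coeff_vpoly rev_def)
  then have "\<forall>\<^sub>F y in at 0. poly (vpoly N (rev s0)) y \<noteq> 0"
    by (intro tendsto_imp_eventually_ne[OF poly_isCont[unfolded isCont_def]])
  then obtain d where d: "d > 0" "\<And>y. y \<noteq> 0 \<Longrightarrow> \<bar>y\<bar> < d \<Longrightarrow> poly (vpoly N (rev s0)) y \<noteq> 0"
    unfolding eventually_at by (auto simp: dist_real_def)
  \<comment> \<open>The reversed polynomial is nonzero on the closed interval of radius
    \<open>\<delta>\<close>, which bounds nearby roots by 1 / \<open>\<delta>\<close>.\<close>
  define \<delta> where "\<delta> = d / 2"
  have \<delta>: "\<delta> > 0" using d by (simp add: \<delta>_def)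
  have "rev s0 \<in> {a. \<forall>y\<in>{-\<delta>..\<delta>}. peval N a y \<noteq> 0}"
  proof (safe)
    fix y assume y: "y \<in> {-\<delta>..\<delta>}" "peval N (rev s0) y = 0"
    have "\<bar>y\<bar> < d" using y d by (auto simp: \<delta>_def abs_less_iff)
    then show False using d(2)[of y] y(2) \<open>poly (vpoly N (rev s0)) 0 \<noteq> 0\<close> by (cases "y = 0") (auto simp: peval_vpoly)
  qed
  then have "\<forall>\<^sub>F s in nhds s0. rev s \<in> {a. \<forall>y\<in>{-\<delta>..\<delta>}. peval N a y \<noteq> 0}"
    by (intro eventually_curve_in_open crev open_nonroots) simp_all
  then have E2: "\<forall>\<^sub>F s in nhds s0. \<forall>x\<in>zeros N (c s). \<bar>x\<bar> < 1 / \<delta>"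
  proof (rule eventually_mono, intro ballI)
    fix s x assume s: "rev s \<in> {a. \<forall>y\<in>{-\<delta>..\<delta>}. peval N a y \<noteq> 0}" and x: "x \<in> zeros N (c s)"
    show "\<bar>x\<bar> < 1 / \<delta>"
    proof (rule ccontr)
      assume "\<not> ?thesis"
      then have "1 / \<delta> \<le> \<bar>x\<bar>" by simp
      moreover from this have "x \<noteq> 0" using \<delta> by auto
      ultimately have "\<bar>1 / x\<bar> \<le> \<delta>" using \<delta> by (simp add: field_simps)
      then have "1 / x \<in> {-\<delta>..\<delta>}" unfolding atLeastAtMost_iff by linarith
      then have "peval N (rev s) (1 / x) \<noteq> 0" using s by blast
      moreover have "rev s = (\<lambda>i. c s (N - Suc i))" by (simp add: rev_def fun_eq_iff)
      ultimately have "peval N (c s) x \<noteq> 0" using peval_reverse[OF \<open>x \<noteq> 0\<close>, of N "c s"] \<open>x \<noteq> 0\<close> by simp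
      then show False using x by (simp add: zeros_def)
    qed
  qed
  define A where "A = {-(1/\<delta>)..1/\<delta>} - (\<Union>r\<in>R. ball r e)"
  have "compact A" unfolding A_def by (intro compact_diff compact_Icc open_UN ballI open_ball)
  moreover have "c s0 \<in> {a. \<forall>x\<in>A. peval N a x \<noteq> 0}"
    using e(2) by (auto simp: A_def R_def zeros_def)
  ultimately have E1: "\<forall>\<^sub>F s in nhds s0. c s \<in> {a. \<forall>x\<in>A. peval N a x \<noteq> 0}"
    by (intro eventually_curve_in_open c open_nonroots)
  define dc where "dc s i = real (Suc i) * c s (Suc i)" for s i
  have pd: "pderiv (p s) = vpoly (N - 1) (dc s)" for s by (simp add: p_def pderiv_vpoly dc_def[abs_def])
  have pdp: "peval (N - Suc 0) (dc s) x = poly (pderiv (p s)) x" for s x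
    by (simp add: pd peval_vpoly)
  have cdc: "continuous_on UNIV dc"
    unfolding dc_def by (intro continuous_on_coordinatewise_then_product continuous_intros cc)
  have E3: "\<forall>\<^sub>F s in nhds s0. \<forall>r\<in>R. dc s \<in> {a. \<forall>x\<in>cball r e. peval (N - 1) a x \<noteq> 0}"
  proof (intro eventually_ball_finite[OF finR] ballI eventually_curve_in_open cdc open_nonroots compact_cball)
    fix r assume "r \<in> R"
    then show "dc s0 \<in> {a. \<forall>x\<in>cball r e. peval (N - 1) a x \<noteq> 0}"
      using e_deriv[of r] by (auto simp: pdp dist_real_def abs_minus_commute)
  qed
  \<comment> \<open>The mean value theorem expresses the values at r + e and r - e by the derivative
    at points on either side of r. These derivatives have equal sign, as no zero of the derivative
    lies between them, so the two values have opposite signs.\<close>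
  have E4: "\<forall>\<^sub>F s in nhds s0. \<forall>r\<in>R. poly (p s) (r - e) * poly (p s) (r + e) < 0"
  proof (intro eventually_ball_finite[OF finR] ballI)
    fix r assume r: "r \<in> R"
    have pr: "poly (p s0) r = 0" using r by (simp add: R_def zp)
    obtain z1 where z1: "r < z1" "z1 < r + e" "poly (p s0) (r + e) - poly (p s0) r = (r + e - r) * poly (pderiv (p s0)) z1"
      using poly_MVT[of r "r + e" "p s0"] e by auto
    obtain z2 where z2: "r - e < z2" "z2 < r" "poly (p s0) r - poly (p s0) (r - e) = (r - (r - e)) * poly (pderiv (p s0)) z2"
      using poly_MVT[of "r - e" r "p s0"] e by auto
    have "poly (pderiv (p s0)) z2 * poly (pderiv (p s0)) z1 > 0"
    proof (rule ccontr)
      assume "\<not> ?thesis"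
      moreover have "poly (pderiv (p s0)) z2 \<noteq> 0" "poly (pderiv (p s0)) z1 \<noteq> 0"
        using e_deriv[OF r] z1 z2 by auto
      ultimately have "poly (pderiv (p s0)) z2 * poly (pderiv (p s0)) z1 < 0" by (simp add: linorder_not_less less_le)
      then obtain z where "z2 < z" "z < z1" "poly (pderiv (p s0)) z = 0"
        using poly_IVT[of z2 z1 "pderiv (p s0)"] z1 z2 by auto
      then show False using e_deriv[OF r, of z] z1 z2 by auto
    qed
    then have "0 < e * e * (poly (pderiv (p s0)) z2 * poly (pderiv (p s0)) z1)" using e by simp
    moreover have "poly (p s0) (r - e) * poly (p s0) (r + e) = - (e * e * (poly (pderiv (p s0)) z2 * poly (pderiv (p s0)) z1))"
    proof -
      have "poly (p s0) (r + e) = e * poly (pderiv (p s0)) z1" "poly (p s0) (r - e) = - (e * poly (pderiv (p s0)) z2)"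
        using z1(3) z2(3) pr by simp_all
      then show ?thesis by simp
    qed
    ultimately have neg: "poly (p s0) (r - e) * poly (p s0) (r + e) < 0" by simp
    have "open ((\<lambda>s. poly (p s) (r - e) * poly (p s) (r + e)) -` {..<0})"
      by (intro open_vimage continuous_intros cp)
    then have "\<forall>\<^sub>F s in nhds s0. s \<in> (\<lambda>s. poly (p s) (r - e) * poly (p s) (r + e)) -` {..<0}"
      using neg by (intro eventually_nhds_in_open) auto
    then show "\<forall>\<^sub>F s in nhds s0. poly (p s) (r - e) * poly (p s) (r + e) < 0" by simp
  qed
  from E1 E2 E3 E4 show ?thesis
  proof eventually_elim
    fix s
    assume 1: "c s \<in> {a. \<forall>x\<in>A. peval N a x \<noteq> 0}" and 2: "\<forall>x\<in>zeros N (c s). \<bar>x\<bar> < 1 / \<delta>"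
      and 3: "\<forall>r\<in>R. dc s \<in> {a. \<forall>x\<in>cball r e. peval (N - 1) a x \<noteq> 0}"
      and 4: "\<forall>r\<in>R. poly (p s) (r - e) * poly (p s) (r + e) < 0"
    have ex: "\<exists>x. \<bar>x - r\<bar> < e \<and> poly (p s) x = 0" if r: "r \<in> R" for r
    proof -
      obtain x where "r - e < x" "x < r + e" "poly (p s) x = 0"
        using poly_IVT[of "r - e" "r + e" "p s"] 4 r e by auto
      then show ?thesis by (intro exI[of _ x]) (auto simp: abs_less_iff)
    qed
    define h where "h r = (SOME x. \<bar>x - r\<bar> < e \<and> poly (p s) x = 0)" for r
    have h: "\<bar>h r - r\<bar> < e" "poly (p s) (h r) = 0" if "r \<in> R" for r
      using someI_ex[OF ex[OF that]] by (auto simp: h_def)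
    have dnz: "poly (pderiv (p s)) x \<noteq> 0" if "r \<in> R" "\<bar>x - r\<bar> \<le> e" for r x
      using 3 that by (auto simp: pdp dist_real_def abs_minus_commute)
    have uniq: "x = y" if r: "r \<in> R" and x: "\<bar>x - r\<bar> < e" "poly (p s) x = 0" and y: "\<bar>y - r\<bar> < e" "poly (p s) y = 0" for r x y
    proof -
      have False if uv: "u < v" "\<bar>u - r\<bar> < e" "poly (p s) u = 0" "\<bar>v - r\<bar> < e" "poly (p s) v = 0" for u v
      proof -
        obtain z where z: "u < z" "z < v" "poly (p s) v - poly (p s) u = (v - u) * poly (pderiv (p s)) z"
          using poly_MVT[OF uv(1)] by blast
        then have "poly (pderiv (p s)) z = 0" using uv by simp
        moreover have "\<bar>z - r\<bar> \<le> e" using z uv by linarith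
        ultimately show False using dnz[OF r] by blast
      qed
      then show ?thesis using x y by (metis linorder_neqE_linordered_idom)
    qed
    have "bij_betw h R (zeros N (c s))"
    proof (rule bij_betwI')
      show "h r \<in> zeros N (c s)" if "r \<in> R" for r using h[OF that] by (simp add: zp)
      show "(h r = h r') = (r = r')" if "r \<in> R" "r' \<in> R" for r r'
      proof
        assume "h r = h r'"
        then have "\<bar>r - r'\<bar> < 2 * e" using h(1)[OF that(1)] h(1)[OF that(2)] by linarith
        then show "r = r'" using e_sep[OF that] by force
      qed simp
      show "\<exists>r\<in>R. x = h r" if x: "x \<in> zeros N (c s)" for x
      proof -
        have "x \<notin> A" using 1 x by (auto simp: zeros_def)
        moreover have "x \<in> {-(1/\<delta>)..1/\<delta>}" using bspec[OF 2 x] unfolding atLeastAtMost_iff by linarith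
        ultimately obtain r where r: "r \<in> R" "\<bar>x - r\<bar> < e"
          unfolding A_def by (metis DiffI UN_E abs_minus_commute dist_real_def mem_ball)
        have "poly (p s) x = 0" using x by (simp add: zp)
        then have "x = h r" by (rule uniq[OF r _ h[OF r(1)]])
        with r show ?thesis by blast
      qed
    qed
    moreover have "\<bar>h r - r\<bar> < e0" if "r \<in> R" for r using h(1)[OF that] e(1) by linarith
    ultimately show "\<exists>h. bij_betw h (zeros N (c s0)) (zeros N (c s)) \<and> (\<forall>r\<in>zeros N (c s0). \<bar>h r - r\<bar> < e0)"
      unfolding R_def by blast
  qed
qed

text \<open>Counts \<open>0\<close> for the zero polynomial, the only one with infinitely many zeros.\<close>

definition tuple_count :: "(real^'k::finite) set \<Rightarrow> nat \<Rightarrow> (nat \<Rightarrow> real) \<Rightarrow> nat" where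
  "tuple_count B N a = (if finite (zeros N a) then card {x \<in> root_tuples UNIV N a. vec_lambda x \<in> B} else 0)"

lemma root_tuples_UNIV: "root_tuples UNIV N a = {x. range x \<subseteq> zeros N a \<and> inj x}"
  by (auto simp: root_tuples_def)

lemma card_root_tuples_bij:
  assumes h: "bij_betw h R R'" and fin: "finite R"
    and B: "\<And>x :: 'k::finite \<Rightarrow> real. range x \<subseteq> R \<Longrightarrow> inj x \<Longrightarrow> (vec_lambda (h \<circ> x) \<in> B) = (vec_lambda x \<in> B)"
  shows "card {x :: 'k \<Rightarrow> real. (range x \<subseteq> R \<and> inj x) \<and> vec_lambda x \<in> B} = card {x :: 'k \<Rightarrow> real. (range x \<subseteq> R' \<and> inj x) \<and> vec_lambda x \<in> B}"
proof (rule bij_betw_same_card[of "\<lambda>x. h \<circ> x"], rule bij_betwI[where g = "\<lambda>x. inv_into R h \<circ> x"])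
  have injh: "inj_on h R" and img: "h ` R = R'" using h by (auto simp: bij_betw_def)
  show "(\<lambda>x. h \<circ> x) \<in> {x :: 'k \<Rightarrow> real. (range x \<subseteq> R \<and> inj x) \<and> vec_lambda x \<in> B} \<rightarrow> {x. (range x \<subseteq> R' \<and> inj x) \<and> vec_lambda x \<in> B}"
  proof (intro funcsetI CollectI)
    fix x :: "'k \<Rightarrow> real" assume x: "x \<in> {x. (range x \<subseteq> R \<and> inj x) \<and> vec_lambda x \<in> B}"
    then have "inj (h \<circ> x)" using inj_on_subset[OF injh, of "range x"] by (intro comp_inj_on) auto
    moreover have "range (h \<circ> x) \<subseteq> R'" using x img by auto
    ultimately show "(range (h \<circ> x) \<subseteq> R' \<and> inj (h \<circ> x)) \<and> vec_lambda (h \<circ> x) \<in> B" using x B[of x] by simp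
  qed
  have g: "range (inv_into R h \<circ> y) \<subseteq> R" "inj (inv_into R h \<circ> y)" "h \<circ> (inv_into R h \<circ> y) = y"
    if "range y \<subseteq> R'" "inj y" for y :: "'k \<Rightarrow> real"
  proof -
    have yi: "y i \<in> h ` R" for i using that img by auto
    show "range (inv_into R h \<circ> y) \<subseteq> R" using yi by (auto intro: inv_into_into)
    show eq: "h \<circ> (inv_into R h \<circ> y) = y" using yi by (auto simp: fun_eq_iff f_inv_into_f)
    show "inj (inv_into R h \<circ> y)" using that(2) eq by (metis inj_on_imageI2)
  qed
  show "(\<lambda>x. inv_into R h \<circ> x) \<in> {x :: 'k \<Rightarrow> real. (range x \<subseteq> R' \<and> inj x) \<and> vec_lambda x \<in> B} \<rightarrow> {x. (range x \<subseteq> R \<and> inj x) \<and> vec_lambda x \<in> B}"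
  proof (intro funcsetI CollectI)
    fix y :: "'k \<Rightarrow> real" assume "y \<in> {x. (range x \<subseteq> R' \<and> inj x) \<and> vec_lambda x \<in> B}"
    then show "(range (inv_into R h \<circ> y) \<subseteq> R \<and> inj (inv_into R h \<circ> y)) \<and> vec_lambda (inv_into R h \<circ> y) \<in> B"
      using g[of y] B[of "inv_into R h \<circ> y"] by simp
  qed
  show "h \<circ> (inv_into R h \<circ> y) = y" if "y \<in> {x. (range x \<subseteq> R' \<and> inj x) \<and> vec_lambda x \<in> B}" for y :: "'k \<Rightarrow> real"
    using g(3)[of y] that by auto
  show "inv_into R h \<circ> (h \<circ> x) = x" if "x \<in> {x. (range x \<subseteq> R \<and> inj x) \<and> vec_lambda x \<in> B}" for x :: "'k \<Rightarrow> real"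
    using that inv_into_f_f[OF injh] by (auto simp: fun_eq_iff)
qed

text \<open>A tuple off the frontier is interior to \<open>B\<close> or to its complement, so a
  small move of the roots does not change its membership; finitely many tuples allow one common
  radius, and the bijection of the roots carries tuples to tuples.\<close>

lemma tuple_count_locally_constant:
  fixes c :: "real \<Rightarrow> nat \<Rightarrow> real" and B :: "(real^'k::finite) set"
  assumes c: "continuous_on UNIV c" and N: "N > 0" and lead: "c s0 (N - 1) \<noteq> 0"
    and simple: "\<And>x. x \<in> zeros N (c s0) \<Longrightarrow> poly (pderiv (vpoly N (c s0))) x \<noteq> 0"
    and B: "\<And>x. x \<in> root_tuples UNIV N (c s0) \<Longrightarrow> vec_lambda x \<notin> frontier B"
  shows "\<forall>\<^sub>F s in nhds s0. tuple_count B N (c s) = tuple_count B N (c s0)"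
proof -
  define R where "R = zeros N (c s0)"
  have finR: "finite R" unfolding R_def finite_zeros_iff using lead N by (intro exI[of _ "N - 1"]) auto
  define T where "T = (root_tuples UNIV N (c s0) :: ('k \<Rightarrow> real) set)"
  have finT: "finite T" unfolding T_def using finR by (intro finite_root_tuples) (auto simp: R_def)
  have "\<exists>e>0. \<forall>y. dist y (vec_lambda x) < e \<longrightarrow> (y \<in> B) = (vec_lambda x \<in> B)" if "x \<in> T" for x
  proof -
    have "vec_lambda x \<notin> frontier B" using B that by (simp add: T_def)
    then have "vec_lambda x \<in> interior B \<or> vec_lambda x \<in> interior (- B)"
      by (auto simp: frontier_def interior_complement)
    then show ?thesis
    proof
      assume "vec_lambda x \<in> interior B"
      then obtain e where "e > 0" "ball (vec_lambda x) e \<subseteq> B" by (auto simp: mem_interior)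
      then show ?thesis by (intro exI[of _ e]) (auto simp: dist_commute subset_iff)
    next
      assume "vec_lambda x \<in> interior (- B)"
      then obtain e where "e > 0" "ball (vec_lambda x) e \<subseteq> - B" by (auto simp: mem_interior)
      then show ?thesis by (intro exI[of _ e]) (auto simp: dist_commute subset_iff)
    qed
  qed
  then obtain E where E: "\<And>x. x \<in> T \<Longrightarrow> E x > 0" "\<And>x y. x \<in> T \<Longrightarrow> dist y (vec_lambda x) < E x \<Longrightarrow> (y \<in> B) = (vec_lambda x \<in> B)"
    by metis
  \<comment> \<open>Inserting 1 keeps the minimum defined when there are no root tuples; dividing by
    \<open>Suc CARD('k)\<close> makes the sum of \<open>CARD('k)\<close> coordinate moves strictly
    smaller than that minimum.\<close>
  define \<epsilon> where "\<epsilon> = Min (insert 1 (E ` T)) / real (Suc CARD('k))"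
  have M0: "Min (insert 1 (E ` T)) > 0" using E(1) finT by (subst Min_gr_iff) auto
  have \<epsilon>: "\<epsilon> > 0" unfolding \<epsilon>_def using M0 by simp
  have ME: "Min (insert 1 (E ` T)) \<le> E x" if "x \<in> T" for x using that finT by (intro Min_le) auto
  have "\<forall>\<^sub>F s in nhds s0. \<exists>h. bij_betw h (zeros N (c s0)) (zeros N (c s)) \<and> (\<forall>r\<in>zeros N (c s0). \<bar>h r - r\<bar> < \<epsilon>)"
    by (rule zeros_stable[OF c N lead _ \<epsilon>]) (rule simple)
  then show ?thesis
  proof eventually_elim
    fix s assume "\<exists>h. bij_betw h (zeros N (c s0)) (zeros N (c s)) \<and> (\<forall>r\<in>zeros N (c s0). \<bar>h r - r\<bar> < \<epsilon>)"
    then obtain h where h: "bij_betw h R (zeros N (c s))" "\<And>r. r \<in> R \<Longrightarrow> \<bar>h r - r\<bar> < \<epsilon>" by (auto simp: R_def)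
    have fin: "finite (zeros N (c s))" using bij_betw_finite[OF h(1)] finR by simp
    have "(vec_lambda (h \<circ> x) \<in> B) = (vec_lambda x \<in> B)" if x: "range x \<subseteq> R" "inj x" for x :: "'k \<Rightarrow> real"
    proof (rule E(2))
      show xT: "x \<in> T" using x by (simp add: T_def root_tuples_UNIV R_def)
      have "dist (vec_lambda (h \<circ> x)) (vec_lambda x) \<le> (\<Sum>i\<in>UNIV. \<bar>(vec_lambda (h \<circ> x) - vec_lambda x) $ i\<bar>)"
        unfolding dist_norm by (rule norm_le_l1_cart)
      also have "\<dots> \<le> (\<Sum>i\<in>(UNIV :: 'k set). \<epsilon>)"
        using h(2) x(1) by (intro sum_mono less_imp_le) (auto simp: subset_iff)
      also have "\<dots> = real CARD('k) * \<epsilon>" by simp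
      also have "\<dots> < real (Suc CARD('k)) * \<epsilon>" using \<epsilon> by simp
      also have "\<dots> = Min (insert 1 (E ` T))" by (simp add: \<epsilon>_def del: of_nat_Suc)
      also have "\<dots> \<le> E x" by (rule ME[OF xT])
      finally show "dist (vec_lambda (h \<circ> x)) (vec_lambda x) < E x" .
    qed
    from card_root_tuples_bij[OF h(1) finR this]
    show "tuple_count B N (c s) = tuple_count B N (c s0)"
      using fin finR by (simp add: tuple_count_def root_tuples_UNIV R_def)
  qed
qed

subsection \<open>Integer coefficient vectors and volume\<close>

lemma measurable_vec_lambda: "vec_lambda \<in> measurable (PiM UNIV (\<lambda>_. borel :: real measure)) (borel :: (real^'k::finite) measure)"
proof (subst borel_measurable_euclidean_space, intro ballI)
  fix b :: "real^'k" assume "b \<in> Basis"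
  then obtain i where "b = axis i 1" by (auto simp: Basis_vec_def)
  then show "(\<lambda>x. vec_lambda x \<bullet> b) \<in> borel_measurable (PiM UNIV (\<lambda>_. borel))"
    by (simp add: inner_axis)
qed

lemma tuple_count_eq_tuple_sum:
  "ennreal (real (tuple_count B N a)) = tuple_sum UNIV N a (\<lambda>x. indicator B (vec_lambda x :: real^'k::finite))"
proof (cases "finite (zeros N a)")
  case True
  have "tuple_sum UNIV N a (\<lambda>x. indicator B (vec_lambda x :: real^'k)) = (\<Sum>x\<in>root_tuples UNIV N a. if vec_lambda x \<in> B then 1 else 0)"
    using True by (simp add: tuple_sum_def indicator_def of_bool_def)
  also have "\<dots> = (\<Sum>x\<in>{x \<in> root_tuples UNIV N a. vec_lambda x \<in> B}. 1)"
    by (rule sum.inter_filter[symmetric]) (use True in \<open>auto intro: finite_root_tuples\<close>)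
  finally show ?thesis using True by (simp add: tuple_count_def ennreal_of_nat_eq_real_of_nat)
qed (simp add: tuple_count_def tuple_sum_def)

lemma measurable_tuple_count:
  assumes "B \<in> sets (borel :: (real^'k::finite) measure)"
  shows "(\<lambda>a. ennreal (real (tuple_count B N a))) \<in> borel_measurable (PiM {..<N} (\<lambda>_. borel))"
  unfolding tuple_count_eq_tuple_sum
proof (rule measurable_tuple_sum)
  have "(\<lambda>x. indicator B (vec_lambda x :: real^'k) :: ennreal) \<in> borel_measurable (PiM UNIV (\<lambda>_. borel))"
    using assms by (intro measurable_compose[OF measurable_vec_lambda]) auto
  from measurable_compose[OF measurable_snd this]
  show "(\<lambda>(a, x). indicator B (vec_lambda x :: real^'k) :: ennreal) \<in> borel_measurable (PiM {..<N} (\<lambda>_. borel) \<Otimes>\<^sub>M PiM UNIV (\<lambda>_. borel))"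
    by (simp add: case_prod_unfold)
qed simp_all

lemma tuple_count_cong: "(\<And>x. peval N a x = 0 \<longleftrightarrow> peval N b x = 0) \<Longrightarrow> tuple_count B N a = tuple_count B N b"
proof -
  assume "\<And>x. peval N a x = 0 \<longleftrightarrow> peval N b x = 0"
  then have "zeros N a = zeros N b" by (auto simp: zeros_def)
  then show ?thesis by (simp add: tuple_count_def root_tuples_def)
qed

lemma tuple_count_zero_ext: "tuple_count B N (zero_ext {..<N} a) = tuple_count B N a"
proof (rule tuple_count_cong)
  fix x
  have "peval N (zero_ext {..<N} a) x = peval N a x" by (rule peval_cong) (simp add: zero_ext_def)
  then show "peval N (zero_ext {..<N} a) x = 0 \<longleftrightarrow> peval N a x = 0" by simp
qed

lemma tuple_count_scale: "c > 0 \<Longrightarrow> tuple_count B N (\<lambda>i. c * a i) = tuple_count B N a"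
proof (rule tuple_count_cong)
  fix x assume "c > 0"
  have "peval N (\<lambda>i. c * a i) x = c * peval N a x" by (simp add: peval_def sum_distrib_left mult.assoc)
  then show "peval N (\<lambda>i. c * a i) x = 0 \<longleftrightarrow> peval N a x = 0" using \<open>c > 0\<close> by simp
qed

lemma tuple_count_le: "tuple_count (B :: (real^'k::finite) set) N a \<le> N ^ CARD('k)"
proof (cases "finite (zeros N a)")
  case True
  have "card {x \<in> root_tuples UNIV N a. (vec_lambda x :: real^'k) \<in> B} \<le> card (PiE (UNIV :: 'k set) (\<lambda>_. zeros N a))"
    using True by (intro card_mono finite_PiE) (auto simp: root_tuples_def)
  also have "\<dots> = card (zeros N a) ^ CARD('k)" by (simp add: card_PiE)
  also have "\<dots> \<le> N ^ CARD('k)" using card_zeros[OF True] by (intro power_mono) auto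
  finally show ?thesis using True by (simp add: tuple_count_def)
qed (simp add: tuple_count_def)

text \<open>A double root is a two-entry tuple with equal entries, indexed by \<open>bool\<close>.
  This brings the double-root wall under the same elimination as the boundary walls.\<close>

lemma double_root_multiple:
  fixes p :: "real poly"
  assumes "poly p x = 0" "poly (pderiv p) x = 0"
  shows "\<exists>q. p = lin_prod (UNIV :: bool set) (\<lambda>_. x) * q"
proof -
  obtain q1 where q1: "p = [:- x, 1:] * q1" using assms(1) unfolding poly_eq_0_iff_dvd by (elim dvdE)
  have "poly q1 x = 0" using assms(2) unfolding q1 poly_pderiv_linear_mult .
  then obtain q where "q1 = [:- x, 1:] * q" unfolding poly_eq_0_iff_dvd by (elim dvdE)
  then have "p = lin_prod (UNIV :: bool set) (\<lambda>_. x) * q"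
    unfolding q1 by (simp add: lin_prod_def UNIV_bool mult_ac del: mult_pCons_left mult_pCons_right)
  then show ?thesis ..
qed

definition cube_volume :: "(real^'k::finite) set \<Rightarrow> nat \<Rightarrow> ennreal" where
  "cube_volume B N = (\<integral>\<^sup>+a. ennreal (real (tuple_count B N a)) * indicator (icube {..<N} 1) a \<partial>PiM {..<N} (\<lambda>_. lborel))"

text \<open>Wall 0 is the leading coefficient, wall 1 the double roots, wall j + 2 the boundary
  polynomial \<open>P j\<close>. Off all of them the count is locally constant, hence constant on
  the connected segment.\<close>

lemma tuple_count_segment:
  fixes B :: "(real^'k::finite) set"
  assumes N: "N > 0" and i: "i < N" and frB: "frontier B \<subseteq> (\<Union>j<m. {x. mpoly_eval (P j) x = 0})"
    and F0: "\<And>a. F 0 a = a (N - 1)"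
    and F1: "\<And>a x q. vpoly N a \<noteq> 0 \<Longrightarrow> vpoly N a = lin_prod (UNIV :: bool set) (\<lambda>_. x) * q \<Longrightarrow> F (Suc 0) a = 0"
    and F2: "\<And>j a x q. j < m \<Longrightarrow> vpoly N a \<noteq> 0 \<Longrightarrow> vpoly N a = lin_prod UNIV x * q \<Longrightarrow> mpoly_eval (P j) (vec_lambda x :: real^'k) = 0 \<Longrightarrow> F (j + 2) a = 0"
    and nz: "\<And>s l. s \<in> closed_segment (b i) (b i + u) \<Longrightarrow> l < m + 2 \<Longrightarrow> F l (b(i := s)) \<noteq> 0"
  shows "tuple_count B N (b(i := b i + u)) = tuple_count B N b"
proof -
  define c where "c s = b(i := s)" for s
  have cont: "continuous_on UNIV c"
  proof (rule continuous_on_coordinatewise_then_product)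
    fix j
    show "continuous_on UNIV (\<lambda>s. c s j)" by (cases "j = i") (auto simp: c_def)
  qed
  have "tuple_count B N (c (b i)) = tuple_count B N (c (b i + u))"
  proof (rule connected_local_const[where A = "closed_segment (b i) (b i + u)"], simp_all, intro ballI)
    fix s0 assume s0: "s0 \<in> closed_segment (b i) (b i + u)"
    note nz' = nz[OF s0, folded c_def]
    have lead: "c s0 (N - 1) \<noteq> 0" using nz'[of 0] by (simp add: F0)
    then have v0: "vpoly N (c s0) \<noteq> 0" using N by (auto simp: vpoly_eq_0_iff intro!: exI[of _ "N - 1"])
    have "\<forall>\<^sub>F s in nhds s0. tuple_count B N (c s) = tuple_count B N (c s0)"
    proof (rule tuple_count_locally_constant[OF cont N lead])
      fix x assume x: "x \<in> zeros N (c s0)"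
      show "poly (pderiv (vpoly N (c s0))) x \<noteq> 0"
      proof
        assume "poly (pderiv (vpoly N (c s0))) x = 0"
        moreover have "poly (vpoly N (c s0)) x = 0" using x by (simp add: zeros_def peval_vpoly)
        ultimately obtain q where "vpoly N (c s0) = lin_prod (UNIV :: bool set) (\<lambda>_. x) * q"
          using double_root_multiple by blast
        then show False using F1[OF v0] nz'[of "Suc 0"] by auto
      qed
    next
      fix x :: "'k \<Rightarrow> real" assume x: "x \<in> root_tuples UNIV N (c s0)"
      show "vec_lambda x \<notin> frontier B"
      proof
        assume "vec_lambda x \<in> frontier B"
        then obtain j where j: "j < m" "mpoly_eval (P j) (vec_lambda x) = 0" using frB by auto
        have "\<exists>q. vpoly N (c s0) = lin_prod UNIV x * q"
          using x by (intro lin_prod_dvd) (auto simp: root_tuples_def zeros_def peval_vpoly)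
        then show False using F2[OF j(1) v0 _ j(2)] nz'[of "j + 2"] j(1) by auto
      qed
    qed
    then have "\<forall>\<^sub>F s in nhds s0. tuple_count B N (c s0) = tuple_count B N (c s)" by (rule eventually_mono) simp
    then show "\<forall>\<^sub>F s in at s0 within closed_segment (b i) (b i + u). tuple_count B N (c s0) = tuple_count B N (c s)"
      unfolding eventually_at_filter by (rule eventually_mono) simp
  qed
  then show ?thesis by (simp add: c_def)
qed

text \<open>The constant is chosen before \<open>B\<close>, \<open>P\<close> and \<open>q\<close>:
  it is built from n, m, d and the size of the index type only.\<close>

proposition lattice_tuple_count:
  assumes n: "n \<ge> 2" and k: "CARD('k::finite) \<le> n"
  shows "\<exists>C\<ge>0. \<forall>(B :: (real^'k) set) (P :: nat \<Rightarrow> ('k \<Rightarrow> nat) \<Rightarrow> real) (q::nat).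
    B \<in> sets borel \<longrightarrow> (\<forall>j<m. alg_poly (P j) d) \<longrightarrow> frontier B \<subseteq> (\<Union>j<m. {x. mpoly_eval (P j) x = 0}) \<longrightarrow>
    \<bar>(\<Sum>a\<in>grid {..<Suc n} (\<lambda>_. lattice_pts q) (\<lambda>_. 0). real (tuple_count B (Suc n) a)) - (real q + 1/2) ^ Suc n * enn2real (cube_volume B (Suc n))\<bar>
      \<le> C * real (2 * q + 1) ^ n"
proof -
  define N where "N = Suc n"
  \<comment> \<open>A common degree bound: N^N * d for the boundary walls, N^N for the double-root
    wall, whose equation is linear, and 1 for the leading coefficient.\<close>
  define D where "D = N ^ N * Suc d"
  define K where "K = real (N ^ CARD('k))"
  define C where "C = real N * (K * real (m + 2) * real D * real N)"
  have "\<bar>(\<Sum>a\<in>grid {..<N} (\<lambda>_. lattice_pts q) (\<lambda>_. 0). real (tuple_count B N a)) - (real q + 1/2) ^ N * enn2real (cube_volume B N)\<bar>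
      \<le> C * real (2 * q + 1) ^ n"
    if B: "B \<in> sets borel" and P: "\<And>j. j < m \<Longrightarrow> alg_poly (P j) d" and fr: "frontier B \<subseteq> (\<Union>j<m. {x. mpoly_eval (P j) x = 0})"
    for B :: "(real^'k) set" and P :: "nat \<Rightarrow> ('k \<Rightarrow> nat) \<Rightarrow> real" and q
  proof -
    let ?wall = "\<lambda>F. sepoly {..<N} D F \<and> (\<exists>a. (\<forall>j. j \<notin> {..<N} \<longrightarrow> a j = 0) \<and> F a \<noteq> 0)"
    \<comment> \<open>The double-root wall: two roots indexed by \<open>bool\<close> and the
      equation that they coincide, with a cofactor of N - 2 coefficients.\<close>
    have "\<exists>F. sepoly {..<N - 2 + card (UNIV :: bool set)} ((N - 2 + card (UNIV :: bool set)) ^ (N - 2 + card (UNIV :: bool set)) * 1) F \<and>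
        (\<exists>a. (\<forall>j. j \<notin> {..<N - 2 + card (UNIV :: bool set)} \<longrightarrow> a j = 0) \<and> F a \<noteq> 0) \<and>
        (\<forall>a x q. vpoly (N - 2 + card (UNIV :: bool set)) a \<noteq> 0 \<longrightarrow> vpoly (N - 2 + card (UNIV :: bool set)) a = lin_prod (UNIV :: bool set) x * q \<longrightarrow> x True - x False = 0 \<longrightarrow> F a = 0)"
      by (rule root_tuple_wall[where ?x0.0 = "\<lambda>b. if b then 1 else 0"])
         (use n in \<open>auto simp: N_def intro!: sepoly_diff sepoly_coord\<close>)
    moreover have "N - 2 + card (UNIV :: bool set) = N" using n by (simp add: N_def)
    ultimately obtain Fd where Fd: "sepoly {..<N} (N ^ N * 1) Fd" "\<exists>a. (\<forall>j. j \<notin> {..<N} \<longrightarrow> a j = 0) \<and> Fd a \<noteq> 0"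
        "\<forall>a x q. vpoly N a \<noteq> 0 \<longrightarrow> vpoly N a = lin_prod (UNIV :: bool set) x * q \<longrightarrow> x True - x False = 0 \<longrightarrow> Fd a = 0"
      by (simp only:) blast
    define Q where "Q j F \<longleftrightarrow> ?wall F \<and> (\<forall>a x q. vpoly N a \<noteq> 0 \<longrightarrow> vpoly N a = lin_prod UNIV x * q \<longrightarrow> mpoly_eval (P j) (vec_lambda x :: real^'k) = 0 \<longrightarrow> F a = 0)"
      for j F
    have "\<exists>F. Q j F" if j: "j < m" for j
    proof -
      obtain y :: "real^'k" where y: "mpoly_eval (P j) y \<noteq> 0" using mpoly_eval_nonzero[OF P[OF j]] by blast
      define N' where "N' = N - CARD('k)"
      have N': "N' + CARD('k) = N" "N' > 0" using k by (auto simp: N_def N'_def)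
      have "\<exists>F. sepoly {..<N' + CARD('k)} ((N' + CARD('k)) ^ (N' + CARD('k)) * d) F \<and>
          (\<exists>a. (\<forall>j. j \<notin> {..<N' + CARD('k)} \<longrightarrow> a j = 0) \<and> F a \<noteq> 0) \<and>
          (\<forall>a x q. vpoly (N' + CARD('k)) a \<noteq> 0 \<longrightarrow> vpoly (N' + CARD('k)) a = lin_prod UNIV x * q \<longrightarrow> mpoly_eval (P j) (vec_lambda x :: real^'k) = 0 \<longrightarrow> F a = 0)"
      proof (rule root_tuple_wall[OF _ N'(2), where ?x0.0 = "vec_nth y"])
        show "sepoly UNIV d (\<lambda>x. mpoly_eval (P j) (vec_lambda x :: real^'k))"
          by (rule sepoly_mpoly_eval[OF P[OF j]])
        show "mpoly_eval (P j) (vec_lambda x :: real^'k) = mpoly_eval (P j) (vec_lambda z)" if "\<And>i. i \<in> UNIV \<Longrightarrow> x i = z i" for x z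
        proof -
          have "x = z" using that by auto
          then show ?thesis by simp
        qed
      qed (use y in simp_all)
      then obtain F where F: "sepoly {..<N} (N ^ N * d) F" "\<exists>a. (\<forall>j. j \<notin> {..<N} \<longrightarrow> a j = 0) \<and> F a \<noteq> 0"
        "\<forall>a x q. vpoly N a \<noteq> 0 \<longrightarrow> vpoly N a = lin_prod UNIV x * q \<longrightarrow> mpoly_eval (P j) (vec_lambda x :: real^'k) = 0 \<longrightarrow> F a = 0"
        unfolding N'(1) by blast
      have "sepoly {..<N} D F" by (rule sepoly_mono[OF F(1)]) (auto simp: D_def)
      then show ?thesis unfolding Q_def using F(2,3) by blast
    qed
    then have "\<forall>j\<in>{..<m}. \<exists>F. Q j F" by blast
    from bchoice[OF this] obtain FB where "\<forall>j\<in>{..<m}. Q j (FB j)" by blast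
    then have FB: "?wall (FB j)"
        "vpoly N a \<noteq> 0 \<Longrightarrow> vpoly N a = lin_prod UNIV x * q \<Longrightarrow> mpoly_eval (P j) (vec_lambda x :: real^'k) = 0 \<Longrightarrow> FB j a = 0"
      if "j < m" for j a x q
      using that unfolding Q_def by blast+
    define F where "F l a = (if l = 0 then a (N - 1) else if l = 1 then Fd a else FB (l - 2) a)" for l :: nat and a :: "nat \<Rightarrow> real"
    have "D > 0" unfolding D_def N_def by (intro mult_pos_pos zero_less_power) simp_all
    then have D1: "D \<ge> 1" by simp
    have wallF: "?wall (F l)" if "l < m + 2" for l
    proof -
      consider "l = 0" | "l = 1" | "l = (l - 2) + 2" "l - 2 < m" using \<open>l < m + 2\<close> by linarith
      then show ?thesis
      proof cases
        case 1
        have "sepoly {..<N} D (\<lambda>a. a (N - 1))" by (rule sepoly_coord[OF D1])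
        moreover have "\<exists>a::nat \<Rightarrow> real. (\<forall>j. j \<notin> {..<N} \<longrightarrow> a j = 0) \<and> a (N - 1) \<noteq> 0"
          by (intro exI[of _ "\<lambda>j. if j = N - 1 then 1 else 0"]) (auto simp: N_def)
        ultimately show ?thesis using 1 by (simp add: F_def[abs_def])
      next
        case 2
        have "sepoly {..<N} D Fd" by (rule sepoly_mono[OF Fd(1)]) (auto simp: D_def)
        then show ?thesis using 2 Fd(2) by (simp add: F_def[abs_def])
      next
        case 3
        then have "F l = FB (l - 2)" by (auto simp: F_def fun_eq_iff)
        then show ?thesis using FB(1)[OF 3(2)] by simp
      qed
    qed
    interpret wall_function "{..<N}" "{..<m + 2}" F D "\<lambda>a. real (tuple_count B N a)" K
    proof
      show "sepoly {..<N} D (F l)" "\<exists>a. (\<forall>j. j \<notin> {..<N} \<longrightarrow> a j = 0) \<and> F l a \<noteq> 0" if "l \<in> {..<m + 2}" for l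
        using wallF[of l] that by auto
      show "real (tuple_count B N a) \<le> K" for a unfolding K_def using tuple_count_le[of B N a] by simp
      fix b :: "nat \<Rightarrow> real" and i u
      assume i: "i \<in> {..<N}" and nz: "\<And>s l. s \<in> closed_segment (b i) (b i + u) \<Longrightarrow> l \<in> {..<m + 2} \<Longrightarrow> F l (b(i := s)) \<noteq> 0"
      have "tuple_count B N (b(i := b i + u)) = tuple_count B N b"
      proof (rule tuple_count_segment[OF _ _ fr, where F = F])
        show "F 0 a = a (N - 1)" for a by (simp add: F_def)
        show "F (Suc 0) a = 0" if "vpoly N a \<noteq> 0" "vpoly N a = lin_prod (UNIV :: bool set) (\<lambda>_. x) * q" for a x q
          using Fd(3)[rule_format, OF that] by (simp add: F_def)
        show "F (j + 2) a = 0" if "j < m" "vpoly N a \<noteq> 0" "vpoly N a = lin_prod UNIV x * q" "mpoly_eval (P j) (vec_lambda x :: real^'k) = 0" for j a x q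
          using FB(2)[OF that] by (simp add: F_def)
        show "F l (b(i := s)) \<noteq> 0" if "s \<in> closed_segment (b i) (b i + u)" "l < m + 2" for s l
          using nz that by simp
      qed (use i in \<open>auto simp: N_def\<close>)
      then show "real (tuple_count B N (b(i := b i + u))) = real (tuple_count B N b)" by simp
    qed auto
    have "\<bar>(\<Sum>a\<in>grid {..<N} (\<lambda>_. lattice_pts q) (\<lambda>_. 0). real (tuple_count B N a)) - (real q + 1/2) ^ card {..<N} *
        enn2real (\<integral>\<^sup>+a. ennreal (real (tuple_count B N (zero_ext {..<N} a))) * indicator (icube {..<N} 1) a \<partial>PiM {..<N} (\<lambda>_. lborel))\<bar>
      \<le> card {..<N} * (K * card {..<m + 2} * D * card {..<N} * real (2 * q + 1) ^ (card {..<N} - 1))"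
    proof (rule lattice_sum_approx)
      show "(\<lambda>a. ennreal (real (tuple_count B N (zero_ext {..<N} a)))) \<in> borel_measurable (PiM {..<N} (\<lambda>_. lborel))"
        using measurable_tuple_count[OF B, of N] by (simp add: tuple_count_zero_ext measurable_PiM_lborel)
      show "real (tuple_count B N (\<lambda>i. c * a i)) = real (tuple_count B N a)" if "c > 0" for a c
        using tuple_count_scale[OF that] by simp
    qed
    then show ?thesis
      by (simp add: tuple_count_zero_ext cube_volume_def C_def N_def mult_ac)
  qed
  moreover have "C \<ge> 0" by (simp add: C_def K_def)
  ultimately show ?thesis unfolding N_def by (intro exI[of _ C]) blast
qed

subsection \<open>The density\<close>

lemma distr_vec_lambda_lborel:
  "distr (PiM UNIV (\<lambda>_. lborel :: real measure)) borel vec_lambda = (lborel :: (real^'k::finite) measure)"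
proof (rule lborel_eqI[symmetric])
  have m: "vec_lambda \<in> measurable (PiM UNIV (\<lambda>_. lborel :: real measure)) (borel :: (real^'k) measure)"
    using measurable_vec_lambda by (simp add: measurable_PiM_lborel)
  fix l u :: "real^'k" assume le: "\<And>b. b \<in> Basis \<Longrightarrow> l \<bullet> b \<le> u \<bullet> b"
  have le': "l $ i \<le> u $ i" for i using le[of "axis i 1"] by (simp add: inner_axis axis_in_Basis_iff)
  have "emeasure (distr (PiM UNIV (\<lambda>_. lborel :: real measure)) borel vec_lambda) (box l u)
     = emeasure (PiM UNIV (\<lambda>_. lborel :: real measure)) (vec_lambda -` box l u \<inter> space (PiM UNIV (\<lambda>_. lborel :: real measure)))"
    by (rule emeasure_distr[OF m]) simp
  also have "vec_lambda -` box l u \<inter> space (PiM UNIV (\<lambda>_. lborel :: real measure)) = PiE UNIV (\<lambda>i. {l $ i<..<u $ i})"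
    by (auto simp: mem_box_cart space_PiM PiE_iff)
  also have "emeasure (PiM UNIV (\<lambda>_. lborel :: real measure)) \<dots> = (\<Prod>i\<in>UNIV. emeasure lborel {l $ i<..<u $ i})"
    by (rule lborel_prod.emeasure_PiM) auto
  also have "\<dots> = (\<Prod>i\<in>UNIV. ennreal (u $ i - l $ i))" using le' by simp
  also have "\<dots> = ennreal (\<Prod>i\<in>UNIV. u $ i - l $ i)" using le' by (intro prod_ennreal) simp
  also have "(\<Prod>i\<in>UNIV. u $ i - l $ i) = (\<Prod>b\<in>Basis. (u - l) \<bullet> b)"
  proof -
    have 1: "(Basis :: (real^'k) set) = range (\<lambda>i. axis i 1)" by (auto simp: Basis_vec_def)
    have 2: "inj (\<lambda>i :: 'k. axis i (1::real))" by (auto simp: inj_def axis_eq_axis)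
    show ?thesis unfolding 1 prod.reindex[OF 2] comp_def by (simp add: inner_axis)
  qed
  finally show "emeasure (distr (PiM UNIV (\<lambda>_. lborel :: real measure)) borel vec_lambda) (box l u) = (\<Prod>b\<in>Basis. (u - l) \<bullet> b)" .
qed simp

lemma nn_integral_lborel_vec:
  fixes f :: "real^'k::finite \<Rightarrow> ennreal"
  assumes "f \<in> borel_measurable borel"
  shows "(\<integral>\<^sup>+x. f x \<partial>lborel) = (\<integral>\<^sup>+x. f (vec_lambda x) \<partial>PiM UNIV (\<lambda>_. lborel))"
  unfolding distr_vec_lambda_lborel[symmetric]
  using measurable_vec_lambda assms by (intro nn_integral_distr) (simp_all add: measurable_PiM_lborel)

text \<open>Vieta: expand the product by the set S of factors from which -x_i is taken; the others
  contribute X^(k - card S).\<close>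

lemma coeff_lin_prod:
  "coeff (lin_prod (UNIV :: 'k::finite set) x) l = (if l \<le> CARD('k) then (-1) ^ (CARD('k) - l) * esym (vec_lambda x) (int CARD('k) - int l) else 0)"
proof -
  have "lin_prod (UNIV :: 'k set) x = (\<Prod>i\<in>UNIV. [:- x i:] + monom 1 1)"
    unfolding lin_prod_def by (rule prod.cong) (simp_all add: monom_altdef)
  also have "\<dots> = (\<Sum>S\<in>Pow UNIV. (\<Prod>i\<in>S. [:- x i:]) * (\<Prod>i\<in>UNIV - S. monom 1 1))"
    by (rule prod_add) simp
  also have "\<dots> = (\<Sum>S\<in>UNIV. monom ((-1) ^ card S * (\<Prod>i\<in>S. x i)) (CARD('k) - card S))"
  proof (rule sum.cong)
    fix S :: "'k set"
    have "(\<Prod>i\<in>S. [:- x i:]) = [:(-1) ^ card S * (\<Prod>i\<in>S. x i):]"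
      by (induction S rule: infinite_finite_induct) (simp_all add: one_pCons)
    moreover have "(\<Prod>i\<in>UNIV - S. monom (1::real) 1) = monom 1 (CARD('k) - card S)"
      by (simp add: monom_power card_Diff_subset)
    ultimately show "(\<Prod>i\<in>S. [:- x i:]) * (\<Prod>i\<in>UNIV - S. monom 1 1) = monom ((-1) ^ card S * (\<Prod>i\<in>S. x i)) (CARD('k) - card S)"
      by (simp add: smult_monom)
  qed simp
  finally have "coeff (lin_prod (UNIV :: 'k set) x) l = (\<Sum>S\<in>(UNIV :: 'k set set). if CARD('k) - card S = l then (-1) ^ card S * (\<Prod>i\<in>S. x i) else 0)"
    by (simp add: coeff_sum)
  also have "\<dots> = (\<Sum>S\<in>{S :: 'k set. CARD('k) - card S = l}. (-1) ^ card S * (\<Prod>i\<in>S. x i))"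
    using sum.inter_filter[of "UNIV :: 'k set set" "\<lambda>S. (-1) ^ card S * (\<Prod>i\<in>S. x i)" "\<lambda>S. CARD('k) - card S = l"] by simp
  also have "\<dots> = (if l \<le> CARD('k) then (-1) ^ (CARD('k) - l) * esym (vec_lambda x) (int CARD('k) - int l) else 0)"
  proof (cases "l \<le> CARD('k)")
    case True
    have le: "card S \<le> CARD('k)" for S :: "'k set" by (rule card_mono) auto
    have "{S :: 'k set. CARD('k) - card S = l} = {S. card S = CARD('k) - l}" using le True
      by (auto simp: le_diff_conv2)
    then have "(\<Sum>S\<in>{S :: 'k set. CARD('k) - card S = l}. (-1) ^ card S * (\<Prod>i\<in>S. x i)) = (\<Sum>S\<in>{S :: 'k set. card S = CARD('k) - l}. (-1) ^ (CARD('k) - l) * (\<Prod>i\<in>S. x i))"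
      by simp
    also have "\<dots> = (-1) ^ (CARD('k) - l) * esym (vec_lambda x) (int CARD('k) - int l)"
      using True by (simp add: esym_def sum_distrib_left nat_diff_distrib)
    finally show ?thesis using True by simp
  next
    case False
    then have "{S :: 'k set. CARD('k) - card S = l} = {}" by auto
    then show ?thesis using False by simp
  qed
  finally show ?thesis .
qed

text \<open>The sign (-1)^(k + i) is common to all terms of the i-th coefficient and disappears in
  absolute value; what remains is the linear form in the definition of \<open>Dset\<close>.\<close>

lemma coeff_tuple_poly_esym:
  assumes "i \<le> n" "CARD('k::finite) \<le> n"
  shows "coeff (tuple_poly (UNIV :: 'k set) (Suc (n - CARD('k))) x t) i =
    (-1) ^ (CARD('k) + i) * (\<Sum>j\<le>n - CARD('k). (-1) ^ j * esym (vec_lambda x) (int CARD('k) - int i + int j) * t j)"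
proof -
  let ?k = "CARD('k)"
  have "coeff (tuple_poly (UNIV :: 'k set) (Suc (n - ?k)) x t) i
      = (\<Sum>j\<le>i. coeff (vpoly (Suc (n - ?k)) t) j * coeff (lin_prod (UNIV :: 'k set) x) (i - j))"
    unfolding tuple_poly_def by (subst mult.commute) (rule coeff_mult)
  also have "\<dots> = (\<Sum>j\<in>{..i} \<inter> {..n - ?k}. t j * coeff (lin_prod (UNIV :: 'k set) x) (i - j))"
    by (intro sum.mono_neutral_cong_right) (auto simp: coeff_vpoly)
  also have "\<dots> = (\<Sum>j\<le>n - ?k. (-1) ^ (?k + i) * ((-1) ^ j * esym (vec_lambda x) (int ?k - int i + int j) * t j))"
  proof (rule sum.mono_neutral_cong_left)
    show "\<forall>j\<in>{..n - ?k} - {..i} \<inter> {..n - ?k}. (-1) ^ (?k + i) * ((-1) ^ j * esym (vec_lambda x :: real^'k) (int ?k - int i + int j) * t j) = 0"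
      by (auto simp: esym_def)
    fix j assume j: "j \<in> {..i} \<inter> {..n - ?k}"
    show "t j * coeff (lin_prod (UNIV :: 'k set) x) (i - j) = (-1) ^ (?k + i) * ((-1) ^ j * esym (vec_lambda x) (int ?k - int i + int j) * t j)"
    proof (cases "i - j \<le> ?k")
      case True
      have eq: "?k + i + j = (?k - (i - j)) + 2 * i" using True j by auto
      have "(-1 :: real) ^ (?k + i + j) = (-1) ^ (?k - (i - j))"
        unfolding eq by (simp add: power_add power_mult)
      then have s: "(-1 :: real) ^ (?k - (i - j)) = (-1) ^ (?k + i) * (-1) ^ j" by (simp add: power_add)
      have idx: "int ?k - int (i - j) = int ?k - int i + int j" using j by auto
      have c: "coeff (lin_prod (UNIV :: 'k set) x) (i - j) = (-1) ^ (?k - (i - j)) * esym (vec_lambda x) (int ?k - int (i - j))"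
        using True by (simp add: coeff_lin_prod)
      show ?thesis unfolding c s idx by (simp only: mult_ac)
    next
      case False
      then have "int ?k - int i + int j < 0" by auto
      then show ?thesis using False by (simp add: coeff_lin_prod esym_def)
    qed
  qed auto
  finally show ?thesis by (simp add: sum_distrib_left)
qed

lemma Dset_iff_icube:
  assumes "CARD('k::finite) \<le> n" "t \<in> extensional {..n - CARD('k)}"
  shows "t \<in> Dset n (vec_lambda x :: real^'k) \<longleftrightarrow> tuple_coeffs (UNIV :: 'k set) (Suc (n - CARD('k))) x t \<in> icube {..<Suc n} 1"
proof -
  have N: "Suc (n - CARD('k)) + CARD('k) = Suc n" using assms(1) by simp
  have "tuple_coeffs (UNIV :: 'k set) (Suc (n - CARD('k))) x t \<in> icube {..<Suc n} 1 \<longleftrightarrow>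
      (\<forall>i\<le>n. \<bar>coeff (tuple_poly (UNIV :: 'k set) (Suc (n - CARD('k))) x t) i\<bar> \<le> 1)"
    unfolding tuple_coeffs_def icube_def cf_def N by (auto simp: PiE_iff abs_le_iff less_Suc_eq_le)
  also have "\<dots> \<longleftrightarrow> (\<forall>i\<le>n. \<bar>\<Sum>j\<le>n - CARD('k). (-1) ^ j * esym (vec_lambda x :: real^'k) (int CARD('k) - int i + int j) * t j\<bar> \<le> 1)"
    by (simp add: coeff_tuple_poly_esym[OF _ assms(1)] abs_mult power_abs)
  finally show ?thesis using assms(2) by (auto simp: Dset_def PiE_iff)
qed

text \<open>The area formula is applied to the indicator of \<open>B\<close> times that of the cube.
  By Vieta the inner integral runs over \<open>Dset\<close>, and with the Jacobian it is 2^(n + 1)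
  times \<open>rho\<close>. The bound in the second claim is the maximal number of tuples times the
  volume of the cube; it does not involve \<open>B\<close>.\<close>

lemma cube_volume_rho:
  fixes B :: "(real^'k::{finite,linorder}) set"
  assumes k: "CARD('k) \<le> n" and B: "B \<in> sets borel"
  shows "enn2real (cube_volume B (Suc n)) = 2 ^ Suc n * (LINT x : B | lborel. rho n x)"
    and "cube_volume B (Suc n) \<le> ennreal (real (Suc n ^ CARD('k)) * 2 ^ Suc n)"
proof -
  define N' where "N' = Suc (n - CARD('k))"
  have N: "N' + card (UNIV :: 'k set) = Suc n" using k by (simp add: N'_def)
  have lt: "{..<N'} = {..n - CARD('k)}" by (auto simp: N'_def)
  let ?C = "icube {..<Suc n} 1"
  have fin: "finite {..<Suc n}" by simp
  have Cm: "?C \<in> sets (PiM {..<Suc n} (\<lambda>_. borel :: real measure))"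
    using icube_sets[OF fin, of 1] by (simp add: sets_PiM_lborel)
  let ?P = "PiM (UNIV :: 'k set) (\<lambda>_. borel :: real measure)"
  let ?T = "PiM {..<N'} (\<lambda>_. borel :: real measure)"
  have Bm: "(\<lambda>x. indicator B (vec_lambda x :: (real, 'k) vec) :: ennreal) \<in> borel_measurable ?P"
    using B by (intro measurable_compose[OF measurable_vec_lambda]) auto
  define W where "W = cube_volume B (Suc n)"
  have bd: "W \<le> ennreal (real (Suc n ^ CARD('k)) * 2 ^ Suc n)"
  proof -
    have "W \<le> (\<integral>\<^sup>+a. ennreal (real (Suc n ^ CARD('k))) * indicator ?C a \<partial>PiM {..<Suc n} (\<lambda>_. lborel))"
      unfolding W_def cube_volume_def
      by (intro nn_integral_mono mult_right_mono ennreal_leI) (use tuple_count_le[of B "Suc n"] in \<open>simp_all del: of_nat_power\<close>)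
    also have "\<dots> = ennreal (real (Suc n ^ CARD('k))) * ennreal ((2 * 1) ^ card {..<Suc n})"
      using icube_sets[OF fin, of 1] emeasure_icube[OF fin, of 1] by (subst nn_integral_cmult) auto
    also have "\<dots> = ennreal (real (Suc n ^ CARD('k)) * 2 ^ Suc n)" by (simp add: ennreal_mult del: of_nat_power power_Suc)
    finally show ?thesis .
  qed
  then show "cube_volume B (Suc n) \<le> ennreal (real (Suc n ^ CARD('k)) * 2 ^ Suc n)" by (simp only: W_def)
  define g where "g x = (\<integral>\<^sup>+t. indicator ?C (tuple_coeffs UNIV N' x t) * ennreal (jacobian UNIV N' x t) \<partial>PiM {..<N'} (\<lambda>_. lborel))" for x :: "'k \<Rightarrow> real"
  have tcm: "(\<lambda>p. tuple_coeffs (UNIV :: 'k set) N' (fst p) (snd p)) \<in> measurable (?P \<Otimes>\<^sub>M ?T) (PiM {..<Suc n} (\<lambda>_. borel))"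
    using measurable_tuple_coeffs[where N = N' and V = "UNIV :: 'k set", OF finite measurable_fst measurable_snd, unfolded N] by simp
  have jm: "(\<lambda>p. jacobian (UNIV :: 'k set) N' (fst p) (snd p)) \<in> borel_measurable (?P \<Otimes>\<^sub>M ?T)"
    by (rule measurable_jacobian[OF finite measurable_fst measurable_snd])
  have gm: "g \<in> borel_measurable ?P"
  proof -
    interpret sigma_finite_measure "PiM {..<N'} (\<lambda>_. lborel :: real measure)"
      by (rule lborel_prod.sigma_finite) simp
    have "(\<lambda>p. indicator ?C (tuple_coeffs (UNIV :: 'k set) N' (fst p) (snd p)) * ennreal (jacobian UNIV N' (fst p) (snd p))) \<in> borel_measurable (?P \<Otimes>\<^sub>M ?T)"
      by (intro borel_measurable_times_ennreal measurable_compose[OF tcm] measurable_compose[OF jm measurable_ennreal] borel_measurable_indicator Cm)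
    then have "(\<lambda>(x, t). indicator ?C (tuple_coeffs (UNIV :: 'k set) N' x t) * ennreal (jacobian UNIV N' x t)) \<in> borel_measurable (?P \<Otimes>\<^sub>M PiM {..<N'} (\<lambda>_. lborel))"
      by (simp add: case_prod_unfold measurable_pair_PiM_lborel)
    then show ?thesis unfolding g_def by (rule borel_measurable_nn_integral)
  qed
  have W: "W = (\<integral>\<^sup>+x. indicator B (vec_lambda x) * g x \<partial>PiM UNIV (\<lambda>_. lborel))"
  proof -
    define H where "H x a = indicator B (vec_lambda x :: (real, 'k) vec) * (indicator ?C a :: ennreal)" for x and a :: "nat \<Rightarrow> real"
    have "W = (\<integral>\<^sup>+a. tuple_sum UNIV (N' + card (UNIV :: 'k set)) a (\<lambda>x. H x a) \<partial>PiM {..<N' + card (UNIV :: 'k set)} (\<lambda>_. lborel))"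
      unfolding W_def cube_volume_def N tuple_count_eq_tuple_sum H_def
      by (intro nn_integral_cong) (simp add: tuple_sum_cmult[symmetric] mult.commute)
    also have "\<dots> = (\<integral>\<^sup>+x. \<integral>\<^sup>+t. H x (tuple_coeffs UNIV N' x t) * ennreal (jacobian UNIV N' x t) \<partial>PiM {..<N'} (\<lambda>_. lborel) \<partial>PiM UNIV (\<lambda>_. lborel))"
    proof (rule nn_integral_tuple_sum[OF finite])
      show "(\<lambda>(x, a). H x a) \<in> borel_measurable (?P \<Otimes>\<^sub>M PiM {..<N' + card (UNIV :: 'k set)} (\<lambda>_. borel))"
        unfolding H_def case_prod_unfold N
        by (intro borel_measurable_times_ennreal measurable_compose[OF measurable_fst Bm] measurable_compose[OF measurable_snd] borel_measurable_indicator Cm)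
    qed
    also have "\<dots> = (\<integral>\<^sup>+x. indicator B (vec_lambda x) * g x \<partial>PiM UNIV (\<lambda>_. lborel))"
    proof (rule nn_integral_cong)
      fix x assume "x \<in> space (PiM (UNIV :: 'k set) (\<lambda>_. lborel :: real measure))"
      then have x: "x \<in> space ?P" by (simp add: space_PiM)
      have "(\<lambda>t. indicator ?C (tuple_coeffs UNIV N' x t) * ennreal (jacobian UNIV N' x t)) \<in> borel_measurable ?T"
        using measurable_compose[OF measurable_Pair1'[OF x] tcm] measurable_compose[OF measurable_Pair1'[OF x] jm] Cm
        by (intro borel_measurable_times_ennreal measurable_compose[OF _ borel_measurable_indicator[OF Cm]] measurable_compose[OF _ measurable_ennreal]) auto
      then show "(\<integral>\<^sup>+t. H x (tuple_coeffs UNIV N' x t) * ennreal (jacobian UNIV N' x t) \<partial>PiM {..<N'} (\<lambda>_. lborel)) = indicator B (vec_lambda x) * g x"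
        unfolding g_def H_def mult.assoc by (intro nn_integral_cmult) (simp add: measurable_PiM_lborel)
    qed
    finally show ?thesis .
  qed
  have rho: "rho n (vec_lambda x) = enn2real (g x) / 2 ^ Suc n" for x :: "'k \<Rightarrow> real"
  proof -
    define f where "f t = (\<Prod>i\<in>UNIV. \<bar>\<Sum>j\<le>n - CARD('k). t j * (vec_lambda x $ i) ^ j\<bar>)" for t :: "nat \<Rightarrow> real"
    have f: "f t = (\<Prod>i\<in>UNIV. \<bar>peval N' t (x i)\<bar>)" for t by (simp add: f_def peval_def lt)
    have f0: "f t \<ge> 0" for t unfolding f by (intro prod_nonneg) auto
    have xs: "x \<in> space ?P" by (simp add: space_PiM)
    have fm: "f \<in> borel_measurable ?T"
      unfolding f by (intro borel_measurable_prod borel_measurable_abs measurable_peval) auto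
    have Dm: "tuple_coeffs UNIV N' x t \<in> ?C \<longleftrightarrow> t \<in> Dset n (vec_lambda x :: (real, 'k) vec)"
      if "t \<in> space (PiM {..<N'} (\<lambda>_. lborel :: real measure))" for t
      using Dset_iff_icube[OF k, of t x] that by (simp add: N'_def[symmetric] lt[symmetric] space_PiM PiE_iff)
    have im: "(\<lambda>t. indicator ?C (tuple_coeffs UNIV N' x t) :: ennreal) \<in> borel_measurable ?T"
      using measurable_compose[OF measurable_Pair1'[OF xs] tcm] Cm
      by (intro measurable_compose[OF _ borel_measurable_indicator[OF Cm]]) auto
    have im': "(\<lambda>t. indicat_real (Dset n (vec_lambda x :: (real, 'k) vec)) t * f t) \<in> borel_measurable (PiM {..<N'} (\<lambda>_. lborel))"
    proof -
      have "(\<lambda>t. indicat_real ?C (tuple_coeffs UNIV N' x t) * f t) \<in> borel_measurable (PiM {..<N'} (\<lambda>_. lborel))"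
        unfolding measurable_PiM_lborel
        using measurable_compose[OF measurable_Pair1'[OF xs] tcm] Cm
        by (intro borel_measurable_times fm measurable_compose[OF _ borel_measurable_indicator[OF Cm]]) auto
      also have "?this \<longleftrightarrow> ?thesis"
      proof (rule measurable_cong)
        fix t assume "t \<in> space (PiM {..<N'} (\<lambda>_. lborel :: real measure))"
        from Dm[OF this] show "indicat_real ?C (tuple_coeffs UNIV N' x t) * f t = indicat_real (Dset n (vec_lambda x :: (real, 'k) vec)) t * f t"
          by (simp add: indicator_def)
      qed
      finally show ?thesis .
    qed
    have "(LINT t : Dset n (vec_lambda x :: (real, 'k) vec) | (\<Pi>\<^sub>M j\<in>{..n - CARD('k)}. lborel). f t)
       = (LINT t | PiM {..<N'} (\<lambda>_. lborel). indicat_real (Dset n (vec_lambda x :: (real, 'k) vec)) t * f t)"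
      unfolding set_lebesgue_integral_def lt by simp
    also have "\<dots> = enn2real (\<integral>\<^sup>+t. ennreal (indicat_real (Dset n (vec_lambda x :: (real, 'k) vec)) t * f t) \<partial>PiM {..<N'} (\<lambda>_. lborel))"
      using f0 by (intro integral_eq_nn_integral im') auto
    also have "(\<integral>\<^sup>+t. ennreal (indicat_real (Dset n (vec_lambda x :: (real, 'k) vec)) t * f t) \<partial>PiM {..<N'} (\<lambda>_. lborel))
       = (\<integral>\<^sup>+t. indicator ?C (tuple_coeffs UNIV N' x t) * ennreal (f t) \<partial>PiM {..<N'} (\<lambda>_. lborel))"
      by (intro nn_integral_cong) (simp add: Dm indicator_def)
    finally have L: "(LINT t : Dset n (vec_lambda x :: (real, 'k) vec) | (\<Pi>\<^sub>M j\<in>{..n - CARD('k)}. lborel). f t)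
       = enn2real (\<integral>\<^sup>+t. indicator ?C (tuple_coeffs UNIV N' x t) * ennreal (f t) \<partial>PiM {..<N'} (\<lambda>_. lborel))" .
    have "g x = (\<integral>\<^sup>+t. ennreal (vdm UNIV x) * (indicator ?C (tuple_coeffs UNIV N' x t) * ennreal (f t)) \<partial>PiM {..<N'} (\<lambda>_. lborel))"
      unfolding g_def jacobian_def f[symmetric]
      by (intro nn_integral_cong) (simp add: ennreal_mult vdm_nonneg f0 mult_ac)
    also have "\<dots> = ennreal (vdm UNIV x) * (\<integral>\<^sup>+t. indicator ?C (tuple_coeffs UNIV N' x t) * ennreal (f t) \<partial>PiM {..<N'} (\<lambda>_. lborel))"
      unfolding measurable_PiM_lborel
      by (intro nn_integral_cmult) (use im fm in \<open>simp add: measurable_PiM_lborel borel_measurable_times_ennreal\<close>)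
    finally have "enn2real (g x) = vdm UNIV x * (LINT t : Dset n (vec_lambda x :: (real, 'k) vec) | (\<Pi>\<^sub>M j\<in>{..n - CARD('k)}. lborel). f t)"
      unfolding L by (simp add: enn2real_mult vdm_nonneg)
    then show ?thesis by (simp add: rho_def f_def vdm_def field_simps)
  qed
  have rhom: "rho n \<in> borel_measurable (borel :: ((real, 'k) vec) measure)"
  proof -
    have "(\<lambda>y::(real, 'k) vec. vec_nth y) \<in> measurable borel ?P"
      by (intro measurable_PiM_single') (auto intro!: borel_measurable_continuous_onI continuous_intros)
    from measurable_compose[OF this gm] have "(\<lambda>y::(real, 'k) vec. enn2real (g (vec_nth y)) / 2 ^ Suc n) \<in> borel_measurable borel"
      by (intro borel_measurable_divide borel_measurable_const measurable_compose[OF _ borel_measurable_enn2real]) auto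
    moreover have "rho n y = enn2real (g (vec_nth y)) / 2 ^ Suc n" for y :: "(real, 'k) vec" using rho[of "vec_nth y"] by simp
    ultimately show ?thesis by (simp cong: measurable_cong)
  qed
  have rho0: "rho n y \<ge> 0" for y :: "(real, 'k) vec" using rho[of "vec_nth y"] by simp
  \<comment> \<open>\<open>rho\<close> is a real number even where the inner integral is infinite;
    finiteness of the total shows that this happens on \<open>B\<close> only in a null set, so
    \<open>enn2real\<close> loses nothing.\<close>
  have AEfin: "AE x in PiM UNIV (\<lambda>_. lborel :: real measure). indicator B (vec_lambda x :: (real, 'k) vec) * g x \<noteq> \<infinity>"
  proof (rule nn_integral_PInf_AE)
    show "(\<lambda>x. indicator B (vec_lambda x :: (real, 'k) vec) * g x) \<in> borel_measurable (PiM UNIV (\<lambda>_. lborel))"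
      unfolding measurable_PiM_lborel by (intro borel_measurable_times_ennreal Bm gm)
    show "(\<integral>\<^sup>+x. indicator B (vec_lambda x) * g x \<partial>PiM UNIV (\<lambda>_. lborel)) \<noteq> \<infinity>"
      using bd unfolding W by (metis ennreal_neq_top infinity_ennreal_def neq_top_trans)
  qed
  have "(LINT x : B | lborel. rho n x) = enn2real (\<integral>\<^sup>+x. ennreal (indicat_real B x * rho n x) \<partial>lborel)"
    unfolding set_lebesgue_integral_def real_scaleR_def using B rhom rho0
    by (intro integral_eq_nn_integral) (auto intro!: borel_measurable_times)
  also have "(\<integral>\<^sup>+x. ennreal (indicat_real B x * rho n x) \<partial>lborel)
     = (\<integral>\<^sup>+x. ennreal (indicat_real B (vec_lambda x) * rho n (vec_lambda x)) \<partial>PiM UNIV (\<lambda>_. lborel))"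
    using B rhom by (intro nn_integral_lborel_vec measurable_compose[OF _ measurable_ennreal] borel_measurable_times) auto
  also have "\<dots> = (\<integral>\<^sup>+x. ennreal (1 / 2 ^ Suc n) * (indicator B (vec_lambda x) * g x) \<partial>PiM UNIV (\<lambda>_. lborel))"
  proof (rule nn_integral_cong_AE, rule AE_mp[OF AEfin], intro AE_I2 impI)
    fix x :: "'k \<Rightarrow> real" assume fin: "indicator B (vec_lambda x :: (real, 'k) vec) * g x \<noteq> \<infinity>"
    show "ennreal (indicat_real B (vec_lambda x) * rho n (vec_lambda x)) = ennreal (1 / 2 ^ Suc n) * (indicator B (vec_lambda x) * g x)"
    proof (cases "(vec_lambda x :: (real, 'k) vec) \<in> B")
      case True
      then have "g x = ennreal (enn2real (g x))" using fin by (simp add: less_top)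
      then have "ennreal (1 / 2 ^ Suc n) * g x = ennreal (1 / 2 ^ Suc n * enn2real (g x))" by (metis ennreal_mult'' enn2real_nonneg)
      then show ?thesis using True by (simp add: rho del: power_Suc)
    qed simp
  qed
  also have "\<dots> = ennreal (1 / 2 ^ Suc n) * W"
    unfolding W by (rule nn_integral_cmult) (unfold measurable_PiM_lborel, intro borel_measurable_times_ennreal Bm gm)
  finally have "(LINT x : B | lborel. rho n x) = enn2real W / 2 ^ Suc n" by (simp add: enn2real_mult del: power_Suc)
  then show "enn2real (cube_volume B (Suc n)) = 2 ^ Suc n * (LINT x : B | lborel. rho n x)" by (simp add: W_def)
qed

subsection \<open>Reducible polynomials\<close>

definition cheight :: "complex poly \<Rightarrow> real" where
  "cheight p = Max ((\<lambda>i. norm (coeff p i)) ` {..degree p})"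

lemma norm_coeff_le_cheight: "norm (coeff p i) \<le> cheight p"
proof (cases "i \<le> degree p")
  case True
  then show ?thesis unfolding cheight_def by (intro Max_ge) auto
next
  case False
  have "norm (coeff p 0) \<le> cheight p" unfolding cheight_def by (intro Max_ge) auto
  then show ?thesis using False by (simp add: coeff_eq_0 order_trans[OF norm_ge_zero])
qed

lemma cheight_nonneg: "0 \<le> cheight p"
  using norm_coeff_le_cheight[of p 0] norm_ge_zero order_trans by blast

lemma cheight_le: "(\<And>i. norm (coeff p i) \<le> h) \<Longrightarrow> cheight p \<le> h"
  unfolding cheight_def by (intro Max.boundedI) auto

lemma cheight_attained: "\<exists>i. cheight p = norm (coeff p i)"
proof -
  have "cheight p \<in> (\<lambda>i. norm (coeff p i)) ` {..degree p}" unfolding cheight_def by (intro Max_in) auto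
  then show ?thesis by blast
qed

lemma cheight_linear_mult_le: "cheight ([:- z, 1:] * q) \<le> 2 * max 1 (norm z) * cheight q"
proof (rule cheight_le)
  fix i
  let ?a = "if i = 0 then 0 else coeff q (i - 1)"
  have "norm (coeff ([:- z, 1:] * q) i) \<le> norm ?a + norm (z * coeff q i)"
    unfolding coeff_linear_mult by (rule norm_triangle_ineq4)
  moreover have "norm ?a \<le> max 1 (norm z) * cheight q"
    using norm_coeff_le_cheight[of q "i - 1"] cheight_nonneg[of q] mult_right_mono[of 1 "max 1 (norm z)" "cheight q"] by auto
  moreover have "norm (z * coeff q i) \<le> max 1 (norm z) * cheight q"
    unfolding norm_mult by (intro mult_mono norm_coeff_le_cheight) auto
  ultimately show "norm (coeff ([:- z, 1:] * q) i) \<le> 2 * max 1 (norm z) * cheight q" by linarith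
qed

text \<open>Undo the multiplication by X - z in its stable direction: from the top by q_(i-1) = p_i
  + z q_i if |z| is at most 1, from the bottom by z q_i = q_(i-1) - p_i otherwise. Either way the
  bound grows by one height per coefficient.\<close>

lemma cheight_le_linear_mult:
  assumes "q \<noteq> 0"
  shows "max 1 (norm z) * cheight q \<le> real (degree q + 2) * cheight ([:- z, 1:] * q)"
proof -
  define p where "p = [:- z, 1:] * q"
  define H where "H = cheight p"
  have H: "0 \<le> H" by (simp add: H_def cheight_nonneg)
  have c: "coeff p i = (if i = 0 then 0 else coeff q (i - 1)) - z * coeff q i" for i
    unfolding p_def by (rule coeff_linear_mult)
  have pH: "norm (coeff p i) \<le> H" for i unfolding H_def by (rule norm_coeff_le_cheight)
  obtain i0 where i0: "cheight q = norm (coeff q i0)" using cheight_attained by blast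
  show ?thesis
  proof (cases "norm z \<le> 1")
    case True
    have "norm (coeff q (Suc (degree q) - j)) \<le> real j * H" if "j \<le> Suc (degree q)" for j
      using that
    proof (induction j)
      case (Suc j)
      define i where "i = Suc (degree q) - j"
      have i: "i > 0" "i - 1 = Suc (degree q) - Suc j" using Suc.prems by (auto simp: i_def)
      have "coeff q (i - 1) = coeff p i + z * coeff q i" using c[of i] i by simp
      then have "norm (coeff q (i - 1)) \<le> norm (coeff p i) + norm z * norm (coeff q i)"
        by (metis norm_mult norm_triangle_ineq)
      also have "norm z * norm (coeff q i) \<le> 1 * (real j * H)"
        using Suc True H by (intro mult_mono) (auto simp: i_def)
      finally show ?case using pH[of i] i by (simp add: algebra_simps)
    qed (simp add: coeff_eq_0)
    note b = this
    have "norm (coeff q i0) \<le> real (degree q + 2) * H"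
    proof (cases "i0 \<le> Suc (degree q)")
      case True
      then have "norm (coeff q i0) \<le> real (Suc (degree q) - i0) * H" using b[of "Suc (degree q) - i0"] by simp
      also have "\<dots> \<le> real (degree q + 2) * H" using H by (intro mult_right_mono) auto
      finally show ?thesis .
    next
      case False
      then show ?thesis using H by (simp add: coeff_eq_0)
    qed
    then show ?thesis using True i0 by (simp add: H_def p_def)
  next
    case False
    then have z: "norm z > 1" by simp
    have b: "norm z * norm (coeff q i) \<le> real (Suc i) * H" for i
    proof (induction i)
      case 0
      have "coeff p 0 = - z * coeff q 0" using c[of 0] by simp
      then show ?case using pH[of 0] by (simp add: norm_mult)
    next
      case (Suc i)
      have "z * coeff q (Suc i) = coeff q i - coeff p (Suc i)" using c[of "Suc i"] by simp
      then have "norm z * norm (coeff q (Suc i)) \<le> norm (coeff q i) + norm (coeff p (Suc i))"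
        by (metis norm_mult norm_triangle_ineq4)
      also have "norm (coeff q i) \<le> norm z * norm (coeff q i)"
        using z mult_right_mono[of 1 "norm z" "norm (coeff q i)"] by simp
      finally show ?case using Suc pH[of "Suc i"] by (simp add: algebra_simps)
    qed
    have "norm z * norm (coeff q i0) \<le> real (degree q + 2) * H"
    proof (cases "i0 \<le> degree q")
      case True
      have "norm z * norm (coeff q i0) \<le> real (Suc i0) * H" by (rule b)
      also have "\<dots> \<le> real (degree q + 2) * H" using True H by (intro mult_right_mono) auto
      finally show ?thesis .
    next
      case False
      then show ?thesis using H by (simp add: coeff_eq_0)
    qed
    then show ?thesis using z i0 by (simp add: H_def p_def max_def)
  qed
qed

text \<open>Split off the complex roots of q one at a time. Taking X - z out of q costs 2 * max 1
  |z|, and putting it into the product returns max 1 |z| at the cost of n + 2; the size of the root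
  cancels.\<close>

lemma cheight_mult_le:
  assumes "p \<noteq> 0" "q \<noteq> 0" "degree p + degree q \<le> n"
  shows "cheight p * cheight q \<le> (2 * real (n + 2)) ^ degree q * cheight (p * q)"
  using assms
proof (induction "degree q" arbitrary: q)
  case 0
  then obtain c where c: "q = [:c:]" "c \<noteq> 0" using degree_eq_zeroE by (metis pCons_0_0)
  obtain i where i: "cheight p = norm (coeff p i)" using cheight_attained by blast
  have "cheight q = norm c" unfolding cheight_def using c by simp
  then have "cheight p * cheight q = norm (coeff (p * q) i)" using i c by (simp add: norm_mult mult.commute)
  also have "\<dots> \<le> cheight (p * q)" by (rule norm_coeff_le_cheight)
  finally show ?case using 0(1) by simp
next
  case (Suc d)
  have "\<not> constant (poly q)" using Suc.hyps(2) by (simp add: constant_degree)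
  then obtain z where "poly q z = 0" using fundamental_theorem_of_algebra by blast
  then obtain r where r: "q = [:- z, 1:] * r" unfolding poly_eq_0_iff_dvd by (elim dvdE)
  have r0: "r \<noteq> 0" using r Suc.prems by auto
  have dq: "degree q = Suc (degree r)" unfolding r using r0 by (subst degree_mult_eq) auto
  then have dr: "d = degree r" using Suc.hyps(2) by simp
  have IH: "cheight p * cheight r \<le> (2 * real (n + 2)) ^ degree r * cheight (p * r)"
    using Suc.prems Suc.hyps(2) dr r0 by (intro Suc.hyps(1)) auto
  have pr: "p * r \<noteq> 0" "degree (p * r) + 2 \<le> n + 2" using Suc.prems Suc.hyps(2) dr r0 by (auto simp: degree_mult_eq)
  have pq: "p * q = [:- z, 1:] * (p * r)" unfolding r by (simp only: mult_ac)
  have "cheight p * cheight q \<le> cheight p * (2 * max 1 (norm z) * cheight r)"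
    unfolding r by (intro mult_left_mono cheight_linear_mult_le cheight_nonneg)
  also have "\<dots> = 2 * max 1 (norm z) * (cheight p * cheight r)" by (simp only: mult_ac)
  also have "\<dots> \<le> 2 * max 1 (norm z) * ((2 * real (n + 2)) ^ degree r * cheight (p * r))"
    by (intro mult_left_mono IH) auto
  also have "\<dots> = 2 * (2 * real (n + 2)) ^ degree r * (max 1 (norm z) * cheight (p * r))" by (simp only: mult_ac)
  also have "\<dots> \<le> 2 * (2 * real (n + 2)) ^ degree r * (real (degree (p * r) + 2) * cheight ([:- z, 1:] * (p * r)))"
    by (intro mult_left_mono cheight_le_linear_mult pr) auto
  also have "\<dots> \<le> 2 * (2 * real (n + 2)) ^ degree r * (real (n + 2) * cheight ([:- z, 1:] * (p * r)))"
    using pr(2) by (intro mult_left_mono mult_right_mono of_nat_mono cheight_nonneg) auto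
  also have "\<dots> = (2 * real (n + 2)) ^ Suc (degree r) * cheight (p * q)" unfolding pq by (simp only: power_Suc mult_ac)
  finally show ?case unfolding dq .
qed

definition iheight :: "int poly \<Rightarrow> nat" where
  "iheight p = Max ((\<lambda>i. nat \<bar>coeff p i\<bar>) ` {..degree p})"

lemma iheight_le_iff: "iheight p \<le> h \<longleftrightarrow> (\<forall>i. \<bar>coeff p i\<bar> \<le> int h)"
proof
  assume h: "iheight p \<le> h"
  show "\<forall>i. \<bar>coeff p i\<bar> \<le> int h"
  proof
    fix i
    show "\<bar>coeff p i\<bar> \<le> int h"
    proof (cases "i \<le> degree p")
      case True
      then have "nat \<bar>coeff p i\<bar> \<le> iheight p" unfolding iheight_def by (intro Max_ge) auto
      then show ?thesis using h by linarith
    qed (simp add: coeff_eq_0)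
  qed
next
  assume "\<forall>i. \<bar>coeff p i\<bar> \<le> int h"
  then have "nat \<bar>coeff p i\<bar> \<le> h" for i by (simp add: nat_le_iff)
  then show "iheight p \<le> h" unfolding iheight_def by (intro Max.boundedI) auto
qed

lemma abs_coeff_le_iheight: "\<bar>coeff p i\<bar> \<le> int (iheight p)"
  using iheight_le_iff by blast

lemma iheight_pos: "p \<noteq> 0 \<Longrightarrow> 0 < iheight p"
proof (rule ccontr)
  assume "p \<noteq> 0" "\<not> 0 < iheight p"
  then have "coeff p (degree p) = 0" using abs_coeff_le_iheight[of p "degree p"] by simp
  with \<open>p \<noteq> 0\<close> show False by simp
qed

lemma cheight_of_int: "cheight (map_poly of_int p) = real (iheight p)"
proof (rule antisym)
  have nc: "norm (coeff (map_poly of_int p :: complex poly) i) = real_of_int \<bar>coeff p i\<bar>" for i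
    by (simp add: coeff_map_poly)
  show "cheight (map_poly of_int p) \<le> real (iheight p)"
  proof (rule cheight_le)
    fix i show "norm (coeff (map_poly of_int p :: complex poly) i) \<le> real (iheight p)"
      unfolding nc using abs_coeff_le_iheight[of p i] by (metis of_int_le_iff of_int_of_nat_eq)
  qed
  have "iheight p \<le> nat \<lfloor>cheight (map_poly of_int p)\<rfloor>"
    unfolding iheight_le_iff
  proof
    fix i
    have "real_of_int \<bar>coeff p i\<bar> \<le> cheight (map_poly of_int p)"
      using norm_coeff_le_cheight[of "map_poly of_int p" i] unfolding nc .
    then show "\<bar>coeff p i\<bar> \<le> int (nat \<lfloor>cheight (map_poly of_int p)\<rfloor>)"
      using cheight_nonneg[of "map_poly of_int p"] by (simp add: le_floor_iff)
  qed
  then show "real (iheight p) \<le> cheight (map_poly of_int p)"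
    using cheight_nonneg[of "map_poly of_int p"] by (simp add: le_nat_floor le_nat_iff) linarith
qed

lemma iheight_mult_le:
  assumes "f \<noteq> 0" "g \<noteq> 0" "degree f + degree g \<le> n"
  shows "iheight f * iheight g \<le> (2 * (n + 2)) ^ n * iheight (f * g)"
proof -
  let ?c = "map_poly (of_int :: int \<Rightarrow> complex)"
  have mult: "?c (f * g) = ?c f * ?c g" by (rule poly_eqI) (simp add: coeff_map_poly coeff_mult)
  have nz: "?c h \<noteq> 0" if "h \<noteq> 0" for h using that by (auto simp: poly_eq_iff coeff_map_poly)
  have deg: "degree (?c h) = degree h" for h by (rule degree_map_poly) simp
  have "real (iheight f) * real (iheight g) \<le> (2 * real (n + 2)) ^ degree g * real (iheight (f * g))"
    using cheight_mult_le[OF nz[OF assms(1)] nz[OF assms(2)]] assms(3) unfolding mult[symmetric] cheight_of_int deg by blast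
  also have "\<dots> \<le> (2 * real (n + 2)) ^ n * real (iheight (f * g))"
    using assms(3) by (intro mult_right_mono power_increasing) auto
  finally have "real (iheight f * iheight g) \<le> real ((2 * (n + 2)) ^ n * iheight (f * g))" by simp
  then show ?thesis by (simp only: of_nat_le_iff)
qed

definition int_polys :: "nat \<Rightarrow> nat \<Rightarrow> int poly set" where
  "int_polys d h = {p. degree p \<le> d \<and> iheight p \<le> h}"

lemma bij_int_polys: "bij_betw (\<lambda>p. \<lambda>i\<in>{..d}. coeff p i) (int_polys d h) (PiE {..d} (\<lambda>_. {-int h..int h}))"
proof (rule bij_betwI[where g = "\<lambda>a. Poly (map a [0..<Suc d])"])
  show "(\<lambda>p. \<lambda>i\<in>{..d}. coeff p i) \<in> int_polys d h \<rightarrow> PiE {..d} (\<lambda>_. {-int h..int h})"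
    by (auto simp: int_polys_def iheight_le_iff abs_le_iff minus_le_iff)
  show "(\<lambda>a. Poly (map a [0..<Suc d])) \<in> PiE {..d} (\<lambda>_. {-int h..int h}) \<rightarrow> int_polys d h"
  proof
    fix a assume a: "a \<in> PiE {..d} (\<lambda>_. {-int h..int h})"
    have c: "coeff (Poly (map a [0..<Suc d])) i = (if i \<le> d then a i else 0)" for i
      by (auto simp: nth_default_def nth_append less_Suc_eq_le simp del: upt_Suc)
    have "degree (Poly (map a [0..<Suc d])) \<le> d" by (rule degree_le) (simp add: c del: coeff_Poly_eq upt_Suc)
    moreover have "\<bar>coeff (Poly (map a [0..<Suc d])) i\<bar> \<le> int h" for i
      using a by (auto simp: c PiE_iff abs_le_iff minus_le_iff simp del: coeff_Poly_eq upt_Suc)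
    ultimately show "Poly (map a [0..<Suc d]) \<in> int_polys d h" by (simp add: int_polys_def iheight_le_iff del: coeff_Poly_eq upt_Suc)
  qed
  show "Poly (map (\<lambda>i\<in>{..d}. coeff p i) [0..<Suc d]) = p" if "p \<in> int_polys d h" for p
    using that by (intro poly_eqI) (auto simp: nth_default_def int_polys_def coeff_eq_0 simp del: upt_Suc)
  show "(\<lambda>i\<in>{..d}. coeff (Poly (map a [0..<Suc d])) i) = a" if "a \<in> PiE {..d} (\<lambda>_. {-int h..int h})" for a
    using that by (auto simp: nth_default_def fun_eq_iff PiE_iff extensional_def less_Suc_eq_le simp del: upt_Suc)
qed

lemma finite_int_polys [simp]: "finite (int_polys d h)"
  using bij_betw_finite[OF bij_int_polys[of d h]] by (simp add: finite_PiE)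

lemma card_int_polys: "card (int_polys d h) = (2 * h + 1) ^ Suc d"
  using bij_betw_same_card[OF bij_int_polys[of d h]] by (simp add: card_PiE nat_add_distrib nat_mult_distrib)

text \<open>The vectors of height exactly h are the difference of two cubes whose side lengths 2h +
  1 and 2h - 1 differ by 2.\<close>

lemma card_iheight_eq:
  assumes "h > 0"
  shows "card {p. degree p \<le> d \<and> iheight p = h} \<le> Suc d * 2 * (2 * h + 1) ^ d"
proof -
  have "{p. degree p \<le> d \<and> iheight p = h} = int_polys d h - int_polys d (h - 1)"
    using assms by (auto simp: int_polys_def)
  moreover have "int_polys d (h - 1) \<subseteq> int_polys d h" using assms by (auto simp: int_polys_def)
  ultimately have "card {p. degree p \<le> d \<and> iheight p = h} = (2 * h + 1) ^ Suc d - (2 * (h - 1) + 1) ^ Suc d"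
    by (simp add: card_Diff_subset card_int_polys)
  moreover have "2 * (h - 1) + 1 = (2 * h + 1) - 2" using assms by simp
  moreover have "(2 * h + 1) ^ Suc d \<le> (2 * h + 1 - 2) ^ Suc d + Suc d * 2 * (2 * h + 1) ^ d"
    using assms by (intro power_drop_le) simp
  ultimately show ?thesis by (simp only: le_diff_conv add.commute)
qed

section \<open>Counting products of two factors\<close>

definition reducible_polys :: "nat \<Rightarrow> nat \<Rightarrow> int poly set" where
  "reducible_polys n q = {p. degree p = n \<and> iheight p \<le> q \<and> (\<exists>f g. p = f * g \<and> degree f \<noteq> 0 \<and> degree g \<noteq> 0)}"

text \<open>Call f the factor of smaller degree, so that its degree r is at most n/2. If it has
  height h, the product bound leaves at most c q / h for the height of the cofactor.\<close>

lemma reducible_polys_cover: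
  assumes "q > 0" "n > 0"
  defines "c \<equiv> (2 * (n + 2)) ^ n"
  shows "reducible_polys n q \<subseteq> (\<Union>r\<in>{1..n div 2}. \<Union>h\<in>{1..c * q}.
    (\<lambda>(f, g). f * g) ` ({p. degree p \<le> r \<and> iheight p = h} \<times> int_polys (n - r) (c * q div h)))"
proof
  fix p assume "p \<in> reducible_polys n q"
  then obtain f0 g0 where p: "degree p = n" "iheight p \<le> q" and fg0: "p = f0 * g0" "degree f0 \<noteq> 0" "degree g0 \<noteq> 0"
    by (auto simp: reducible_polys_def)
  have "\<exists>f g. p = f * g \<and> degree f \<noteq> 0 \<and> degree g \<noteq> 0 \<and> degree f \<le> degree g"
  proof (cases "degree f0 \<le> degree g0")
    case False
    then show ?thesis using fg0 by (intro exI[of _ g0] exI[of _ f0]) (auto simp: mult.commute)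
  qed (use fg0 in blast)
  then obtain f g where fg: "p = f * g" "degree f \<noteq> 0" "degree g \<noteq> 0" "degree f \<le> degree g" by blast
  have nz: "f \<noteq> 0" "g \<noteq> 0" using fg by auto
  then have deg: "degree f + degree g = n" using p(1) fg(1) by (simp add: degree_mult_eq)
  have "iheight f * iheight g \<le> c * iheight p"
    unfolding c_def fg(1) using nz deg by (intro iheight_mult_le) auto
  also have "\<dots> \<le> c * q" using p by simp
  finally have hh: "iheight f * iheight g \<le> c * q" .
  have pos: "iheight f > 0" "iheight g > 0" using iheight_pos nz by auto
  have "iheight f * 1 \<le> iheight f * iheight g" using pos by (intro mult_le_mono2) simp
  then have "iheight f \<le> c * q" using hh by linarith
  moreover have "iheight g \<le> c * q div iheight f" using hh pos by (simp add: less_eq_div_iff_mult_less_eq mult.commute)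
  ultimately show "p \<in> (\<Union>r\<in>{1..n div 2}. \<Union>h\<in>{1..c * q}.
    (\<lambda>(f, g). f * g) ` ({p. degree p \<le> r \<and> iheight p = h} \<times> int_polys (n - r) (c * q div h)))"
    using fg deg pos by (intro UN_I[of "degree f"] UN_I[of "iheight f"] image_eqI[of _ _ "(f, g)"]) (auto simp: int_polys_def)
qed

lemma sum_inverse_squares_le: "(\<Sum>h\<in>{1..X}. 1 / (real h)\<^sup>2) \<le> 2 - 1 / real X" if "X > 0"
  using that
proof (induction X rule: nat_induct_non_zero)
  case (Suc X)
  have "1 / (real (Suc X))\<^sup>2 \<le> 1 / real X - 1 / real (Suc X)"
  proof -
    have "1 / (real (Suc X))\<^sup>2 \<le> 1 / (real X * real (Suc X))"
      using Suc.hyps by (intro divide_left_mono) (simp_all add: power2_eq_square)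
    also have "\<dots> = 1 / real X - 1 / real (Suc X)" using Suc.hyps by (simp add: field_simps)
    finally show ?thesis .
  qed
  then show ?case using Suc.IH Suc.hyps by simp
qed simp

lemma sum_inverse_le_ln: "(\<Sum>h\<in>{1..X}. 1 / real h) \<le> 1 + ln (real X)" if "X > 0"
  using that
proof (induction X rule: nat_induct_non_zero)
  case (Suc X)
  have "ln (real X / real (Suc X)) \<le> real X / real (Suc X) - 1"
    using Suc.hyps by (intro ln_le_minus_one) simp
  then have "1 / real (Suc X) \<le> ln (real (Suc X)) - ln (real X)"
    using Suc.hyps by (simp add: ln_div field_simps)
  then show ?case using Suc.IH Suc.hyps by simp
qed simp

text \<open>For given r and h there are O(h^r) first factors and O((X/h)^(n - r + 1)) cofactors. As
  r is at least 1 and at most n - e, this is O(h^(n - e) (X/h)^n), that is, O(X^n / h^e), and the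
  sum over h converges for e = 2.\<close>

lemma card_reducible_polys:
  assumes n: "n \<ge> 2"
  shows "\<exists>C\<ge>0. \<forall>q\<ge>3. real (card (reducible_polys n q)) \<le> C * real q ^ n * ln (real q) ^ lexp n"
proof -
  define c where "c = (2 * (n + 2)) ^ n"
  have c: "c > 0" by (simp add: c_def)
  \<comment> \<open>The largest e that r \<le> n div 2 \<le> n - e permits among 1 and 2: for n = 2
    the case r = 1 forces e = 1, the harmonic sum.\<close>
  define e where "e = (if n = 2 then 1 else 2 :: nat)"
  define A where "A = 2 * real (Suc n) * 3 ^ Suc n"
  define C where "C = real n * (A * real c ^ n * (3 + ln (real c)))"
  have lnc: "ln (real c) \<ge> 0" using c by simp
  have A0: "A \<ge> 0" by (simp add: A_def)
  have "real (card (reducible_polys n q)) \<le> C * real q ^ n * ln (real q) ^ lexp n" if q: "q \<ge> 3" for q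
  proof -
    define X where "X = c * q"
    have X: "X > 0" using c q by (simp add: X_def)
    define S where "S r h = (\<lambda>(f, g). f * g) ` ({p :: int poly. degree p \<le> r \<and> iheight p = h} \<times> int_polys (n - r) (X div h))" for r h
    have fin: "finite {p :: int poly. degree p \<le> r \<and> iheight p = h}" for r h
      by (rule finite_subset[OF _ finite_int_polys[of r h]]) (auto simp: int_polys_def)
    have finS: "finite (S r h)" for r h unfolding S_def using fin by auto
    have tm: "real (card (S r h)) \<le> A * (real X ^ n * (1 / real h ^ e))" if r: "r \<in> {1..n div 2}" and h: "h \<in> {1..X}" for r h
    proof -
      have h0: "h > 0" using h by simp
      define y where "y = real X / real h"
      have y: "y \<ge> 1" using h by (simp add: y_def)
      have Xy: "real X = y * real h" using h0 by (simp add: y_def)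
      have "card (S r h) \<le> card ({p :: int poly. degree p \<le> r \<and> iheight p = h} \<times> int_polys (n - r) (X div h))"
        unfolding S_def using fin by (intro card_image_le) auto
      also have "\<dots> = card {p :: int poly. degree p \<le> r \<and> iheight p = h} * (2 * (X div h) + 1) ^ Suc (n - r)"
        by (simp only: card_cartesian_product card_int_polys)
      also have "\<dots> \<le> (Suc r * 2 * (2 * h + 1) ^ r) * (2 * (X div h) + 1) ^ Suc (n - r)"
        by (intro mult_le_mono1 card_iheight_eq h0)
      finally have "real (card (S r h)) \<le> real ((Suc r * 2 * (2 * h + 1) ^ r) * (2 * (X div h) + 1) ^ Suc (n - r))"
        by (rule of_nat_mono)
      also have "\<dots> = (real (Suc r) * 2 * real (2 * h + 1) ^ r) * real (2 * (X div h) + 1) ^ Suc (n - r)"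
        by (simp only: of_nat_mult of_nat_power of_nat_numeral)
      also have "\<dots> \<le> (real (Suc n) * 2 * (3 * real h) ^ r) * (3 * y) ^ Suc (n - r)"
      proof (intro mult_mono power_mono)
        show "real (2 * h + 1) \<le> 3 * real h" using h0 by simp
        have "real (X div h) \<le> y" unfolding y_def by (rule of_nat_div_le_of_nat)
        then show "real (2 * (X div h) + 1) \<le> 3 * y" using y by simp
      qed (use r y in auto)
      also have "\<dots> = 2 * real (Suc n) * (3 ^ r * 3 ^ Suc (n - r)) * (real h ^ r * y ^ Suc (n - r))"
        by (simp only: power_mult_distrib mult_ac)
      also have "(3 :: real) ^ r * 3 ^ Suc (n - r) = 3 ^ Suc n"
      proof -
        have "r + Suc (n - r) = Suc n" using r by auto
        then show ?thesis by (metis power_add)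
      qed
      also have "2 * real (Suc n) * 3 ^ Suc n * (real h ^ r * y ^ Suc (n - r)) \<le> A * (real h ^ (n - e) * y ^ n)"
        unfolding A_def using r h0 y n
        by (intro mult_left_mono mult_mono power_increasing) (auto simp: e_def)
      also have "real h ^ (n - e) * y ^ n = real X ^ n * (1 / real h ^ e)"
      proof -
        have "real h ^ n = real h ^ (n - e) * real h ^ e" using n by (simp add: e_def flip: power_add)
        then show ?thesis using h0 by (simp add: Xy power_mult_distrib)
      qed
      finally show ?thesis .
    qed
    have "reducible_polys n q \<subseteq> (\<Union>r\<in>{1..n div 2}. \<Union>h\<in>{1..X}. S r h)"
      unfolding S_def X_def c_def using reducible_polys_cover[of q n] q n by simp
    then have "card (reducible_polys n q) \<le> card (\<Union>r\<in>{1..n div 2}. \<Union>h\<in>{1..X}. S r h)"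
      using finS by (intro card_mono) auto
    also have "\<dots> \<le> (\<Sum>r\<in>{1..n div 2}. card (\<Union>h\<in>{1..X}. S r h))" by (rule card_UN_le) simp
    also have "\<dots> \<le> (\<Sum>r\<in>{1..n div 2}. \<Sum>h\<in>{1..X}. card (S r h))" by (intro sum_mono card_UN_le) simp
    finally have "real (card (reducible_polys n q)) \<le> real (\<Sum>r\<in>{1..n div 2}. \<Sum>h\<in>{1..X}. card (S r h))"
      by (rule of_nat_mono)
    also have "\<dots> = (\<Sum>r\<in>{1..n div 2}. \<Sum>h\<in>{1..X}. real (card (S r h)))" by simp
    also have "\<dots> \<le> (\<Sum>r\<in>{1..n div 2}. \<Sum>h\<in>{1..X}. A * (real X ^ n * (1 / real h ^ e)))"
      by (intro sum_mono tm)
    also have "\<dots> = real (n div 2) * (A * real X ^ n * (\<Sum>h\<in>{1..X}. 1 / real h ^ e))"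
      by (simp add: sum_distrib_left mult.assoc)
    also have "\<dots> \<le> real n * (A * real X ^ n * ((3 + ln (real c)) * ln (real q) ^ lexp n))"
    proof (intro mult_mono mult_left_mono)
      have "exp 1 \<le> (3 :: real)" using exp_le by simp
      \<comment> \<open>q is at least 3, hence above exp 1, so the logarithm is at least 1 and
        absorbs constants.\<close>
      then have lq: "ln (real q) \<ge> 1" using q by (subst ln_ge_iff) auto
      show "(\<Sum>h\<in>{1..X}. 1 / real h ^ e) \<le> (3 + ln (real c)) * ln (real q) ^ lexp n"
      proof (cases "n = 2")
        case True
        have "(\<Sum>h\<in>{1..X}. 1 / real h ^ e) \<le> 1 + ln (real X)" using sum_inverse_le_ln[OF X] True by (simp add: e_def)
        also have "\<dots> = 1 + ln (real c) + ln (real q)" using c q by (simp add: X_def ln_mult)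
        also have "\<dots> \<le> (3 + ln (real c)) * ln (real q)"
        proof -
          have "ln (real c) * 1 \<le> ln (real c) * ln (real q)" using lq lnc by (intro mult_left_mono)
          then show ?thesis using lq by (simp add: algebra_simps)
        qed
        finally show ?thesis using True by (simp add: lexp_def)
      next
        case False
        have "(\<Sum>h\<in>{1..X}. 1 / real h ^ e) \<le> 2 - 1 / real X" using sum_inverse_squares_le[OF X] False by (simp add: e_def)
        also have "\<dots> \<le> 3 + ln (real c)"
        proof -
          have "0 \<le> 1 / real X" by simp
          then show ?thesis using lnc by linarith
        qed
        finally show ?thesis using False by (simp add: lexp_def)
      qed
      show "0 \<le> real X ^ n" "0 \<le> A" "0 \<le> A * real X ^ n" using A0 by simp_all
    qed (use A0 in \<open>auto intro!: mult_nonneg_nonneg sum_nonneg\<close>)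
    also have "\<dots> = C * real q ^ n * ln (real q) ^ lexp n"
      by (simp add: C_def X_def power_mult_distrib mult_ac)
    finally show ?thesis .
  qed
  moreover have "C \<ge> 0" using A0 lnc by (simp add: C_def)
  ultimately show ?thesis by blast
qed

subsection \<open>Prime polynomials\<close>

abbreviation rat_poly :: "int poly \<Rightarrow> rat poly" where "rat_poly \<equiv> map_poly rat_of_int"
abbreviation real_poly :: "int poly \<Rightarrow> real poly" where "real_poly \<equiv> map_poly real_of_int"

lemma rat_poly_mult: "rat_poly (p * q) = rat_poly p * rat_poly q"
  by (rule poly_eqI) (simp add: coeff_map_poly coeff_mult)

lemma rat_poly_smult: "rat_poly (smult c p) = smult (of_int c) (rat_poly p)"
  by (rule poly_eqI) (simp add: coeff_map_poly)

lemma rat_poly_inj: "rat_poly p = rat_poly q \<longleftrightarrow> p = q"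
  by (auto simp: poly_eq_iff coeff_map_poly)

lemma degree_rat_poly: "degree (rat_poly p) = degree p"
  by (rule degree_map_poly) simp

lemma smult_left_cancel: "smult k p = smult k q \<Longrightarrow> k \<noteq> 0 \<Longrightarrow> p = q" for k :: "'a::idom"
  by (simp add: poly_eq_iff)

lemma clear_denominators: "\<exists>c A. c \<noteq> 0 \<and> smult (of_int c) a = rat_poly A"
proof (induction a)
  case 0
  show ?case by (intro exI[of _ 1] exI[of _ 0]) simp
next
  case (pCons x a)
  then obtain c A where cA: "c \<noteq> 0" "smult (of_int c) a = rat_poly A" by blast
  obtain u v where x: "x = of_int u / of_int v" "v \<noteq> 0"
    by (metis quotient_of_denom_pos less_irrefl quotient_of_div surj_pair)
  have "smult (of_int (v * c)) (pCons x a) = rat_poly (pCons (u * c) (smult v A))"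
    using x cA(2) by (simp add: map_poly_pCons rat_poly_smult flip: cA(2))
  then show ?case using cA(1) x(2) by (intro exI[of _ "v * c"] exI[of _ "pCons (u * c) (smult v A)"]) simp
qed

text \<open>Gauss's lemma. Clearing denominators gives c d p = A B; since p has content 1, |c d| is
  the product of the contents of A and B, so p is the product of their primitive parts up to the
  sign s.\<close>

lemma primitive_rat_factor:
  assumes cp: "content p = 1" and ab: "rat_poly p = a * b"
  shows "\<exists>f g. p = f * g \<and> degree f = degree a \<and> degree g = degree b"
proof -
  obtain c A where c: "c \<noteq> 0" "smult (of_int c) a = rat_poly A" using clear_denominators by blast
  obtain d B where d: "d \<noteq> 0" "smult (of_int d) b = rat_poly B" using clear_denominators by blast
  have degA: "degree A = degree a" using arg_cong[OF c(2), of degree] c(1) by (simp add: degree_rat_poly)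
  have degB: "degree B = degree b" using arg_cong[OF d(2), of degree] d(1) by (simp add: degree_rat_poly)
  have "rat_poly (smult (c * d) p) = rat_poly (A * B)"
    unfolding rat_poly_smult rat_poly_mult ab c(2)[symmetric] d(2)[symmetric] by (simp add: mult_ac)
  then have eq: "smult (c * d) p = A * B" by (simp add: rat_poly_inj)
  have "content (smult (c * d) p) = content A * content B" unfolding eq by (rule content_mult)
  then have cont: "\<bar>c * d\<bar> = content A * content B" using cp by simp
  define s where "s = sgn (c * d)"
  have s: "s * s = 1" "s * (c * d) = \<bar>c * d\<bar>" using c(1) d(1) by (auto simp: s_def sgn_if abs_if)
  have "smult \<bar>c * d\<bar> p = smult s (A * B)" unfolding s(2)[symmetric] eq[symmetric] by simp
  also have "A * B = smult \<bar>c * d\<bar> (primitive_part A * primitive_part B)"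
    unfolding cont by (metis content_times_primitive_part mult_smult_left mult_smult_right smult_smult)
  finally have "smult \<bar>c * d\<bar> p = smult \<bar>c * d\<bar> (smult s (primitive_part A) * primitive_part B)"
    by (simp add: mult.commute)
  then have "p = smult s (primitive_part A) * primitive_part B"
    by (rule smult_left_cancel) (use c(1) d(1) in simp)
  moreover have "degree (smult s (primitive_part A)) = degree a" proof -
    have "s \<noteq> 0" using s(1) by auto
    then show ?thesis using degA by simp
  qed
  moreover have "degree (primitive_part B) = degree b" using degB by simp
  ultimately show ?thesis by blast
qed

lemma not_irreducible_factor:
  assumes "content p = 1" "degree p \<noteq> 0" "\<not> irreducible (rat_poly p)"
  shows "\<exists>f g. p = f * g \<and> degree f \<noteq> 0 \<and> degree g \<noteq> 0"
proof -
  have nz: "rat_poly p \<noteq> 0" using assms(2) degree_rat_poly[of p] by auto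
  then have nu: "\<not> is_unit (rat_poly p)" using assms(2) by (simp add: is_unit_iff_degree degree_rat_poly)
  with nz obtain a b where ab: "rat_poly p = a * b" "\<not> is_unit a" "\<not> is_unit b"
    using assms(3) by (auto simp: irreducible_def)
  have "a \<noteq> 0" "b \<noteq> 0" using ab(1) nz by auto
  then have "degree a \<noteq> 0" "degree b \<noteq> 0" using ab(2,3) by (auto simp: is_unit_iff_degree)
  then show ?thesis using primitive_rat_factor[OF assms(1) ab(1)] by metis
qed

text \<open>Both polynomials are rational multiples of the minimal polynomial of x, and content 1
  with positive leading coefficient fixes the factor. Hence root tuples of different prime
  polynomials are disjoint, and \<open>Phi\<close> is a sum over polynomials.\<close>

lemma prime_poly_unique:
  assumes p: "prime_poly p" "poly (real_poly p) x = 0" and q: "prime_poly q" "poly (real_poly q) x = 0"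
  shows "p = q"
proof -
  let ?R = "map_poly real_of_rat"
  have RR: "?R (rat_poly r) = real_poly r" for r
    by (rule poly_eqI) (simp add: coeff_map_poly)
  have Rmult: "?R (a * b) = ?R a * ?R b" for a b
    by (rule poly_eqI) (simp add: coeff_map_poly coeff_mult of_rat_sum of_rat_mult)
  have Radd: "?R (a + b) = ?R a + ?R b" for a b
    by (rule poly_eqI) (simp add: coeff_map_poly of_rat_add)
  have p0: "rat_poly p \<noteq> 0" using p(1) by (auto simp: prime_poly_def)
  define P where "P a \<longleftrightarrow> a \<noteq> 0 \<and> poly (?R a) x = 0" for a
  have "P (rat_poly p)" using p p0 by (simp add: P_def RR)
  \<comment> \<open>A nonzero rational polynomial of least degree that vanishes at x; division with
    remainder makes it divide every other such polynomial.\<close>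
  then obtain M where M: "P M" "\<And>a. P a \<Longrightarrow> degree M \<le> degree a"
    using ex_has_least_nat[of P "rat_poly p" degree] by blast
  have M0: "M \<noteq> 0" "poly (?R M) x = 0" using M(1) by (auto simp: P_def)
  have dvd: "M dvd a" if "poly (?R a) x = 0" for a
  proof -
    have "a = (a div M) * M + a mod M" by simp
    then have "?R a = ?R (a div M) * ?R M + ?R (a mod M)" by (metis Radd Rmult)
    then have "poly (?R (a mod M)) x = 0" using that M0 by simp
    then have "a mod M = 0" using M(2)[of "a mod M"] degree_mod_less'[OF M0(1), of a] by (force simp: P_def)
    then show ?thesis by (simp add: mod_eq_0_iff_dvd)
  qed
  have Mu: "\<not> is_unit M"
  proof
    assume "is_unit M"
    then obtain c where "M = [:c:]" "c dvd 1" unfolding is_unit_poly_iff by blast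
    then show False using M0 by (auto simp: map_poly_pCons)
  qed
  have assoc: "\<exists>c. c \<noteq> 0 \<and> rat_poly r = smult c M" if r: "prime_poly r" "poly (real_poly r) x = 0" for r
  proof -
    obtain u where u: "rat_poly r = M * u" using dvd[of "rat_poly r"] r(2) by (auto simp: RR elim: dvdE)
    then have "is_unit u" using r(1) Mu unfolding prime_poly_def irreducible_def by metis
    then obtain c where "u = [:c:]" "c dvd 1" unfolding is_unit_poly_iff by blast
    moreover from this have "c \<noteq> 0" by auto
    ultimately show ?thesis using u by (intro exI[of _ c]) simp
  qed
  obtain c where c: "c \<noteq> 0" "rat_poly p = smult c M" using assoc[OF p] by blast
  obtain d where d: "d \<noteq> 0" "rat_poly q = smult d M" using assoc[OF q] by blast
  obtain u v where uv: "c / d = of_int u / of_int v" "v \<noteq> 0"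
    by (metis quotient_of_denom_pos less_irrefl quotient_of_div surj_pair)
  have "rat_poly p = smult (c / d) (rat_poly q)" using c d by simp
  then have "smult (of_int v) (rat_poly p) = smult (of_int u) (rat_poly q)" using uv by simp
  then have eq: "smult v p = smult u q" unfolding rat_poly_smult[symmetric] rat_poly_inj .
  have cont: "content p = 1" "content q = 1" and lead: "lead_coeff p > 0" "lead_coeff q > 0"
    using p(1) q(1) by (auto simp: prime_poly_def)
  have "\<bar>v\<bar> = \<bar>u\<bar>" using arg_cong[OF eq, of content] cont by simp
  moreover have "v * lead_coeff p = u * lead_coeff q"
    using arg_cong[OF eq, of lead_coeff] uv(2) \<open>\<bar>v\<bar> = \<bar>u\<bar>\<close> by (auto split: if_splits)
  ultimately have "u = v" using lead uv(2) by (smt (verit) mult_less_0_iff zero_less_mult_iff)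
  then show ?thesis using eq uv(2) by (metis smult_left_cancel)
qed

subsection \<open>Summation over contents\<close>

definition coeff_vec :: "int poly \<Rightarrow> nat \<Rightarrow> real" where
  "coeff_vec p i = real_of_int (coeff p i)"

definition poly_count :: "(real^'k::finite) set \<Rightarrow> nat \<Rightarrow> int poly \<Rightarrow> nat" where
  "poly_count B n p = tuple_count B (Suc n) (coeff_vec p)"

lemma vpoly_coeff_vec: "degree p \<le> n \<Longrightarrow> vpoly (Suc n) (coeff_vec p) = real_poly p"
  by (rule poly_eqI) (auto simp: coeff_vpoly coeff_vec_def coeff_map_poly coeff_eq_0)

lemma zeros_coeff_vec: "degree p \<le> n \<Longrightarrow> zeros (Suc n) (coeff_vec p) = {x. poly (real_poly p) x = 0}"
  by (simp add: zeros_def peval_vpoly vpoly_coeff_vec)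

lemma poly_count_0: "poly_count B n 0 = 0"
proof -
  have "infinite (zeros (Suc n) (coeff_vec 0))" by (simp add: finite_zeros_iff coeff_vec_def)
  then show ?thesis by (simp add: poly_count_def tuple_count_def)
qed

lemma poly_count_smult:
  assumes "g \<noteq> 0"
  shows "poly_count B n (smult g p) = poly_count B n p"
  unfolding poly_count_def
proof (rule tuple_count_cong)
  fix x
  have "peval (Suc n) (coeff_vec (smult g p)) x = of_int g * peval (Suc n) (coeff_vec p) x"
    by (simp add: peval_def coeff_vec_def sum_distrib_left mult.assoc del: sum.lessThan_Suc)
  then show "peval (Suc n) (coeff_vec (smult g p)) x = 0 \<longleftrightarrow> peval (Suc n) (coeff_vec p) x = 0"
    using assms by simp
qed

lemma poly_count_le: "poly_count (B :: (real^'k::finite) set) n p \<le> Suc n ^ CARD('k)"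
  unfolding poly_count_def by (rule tuple_count_le)

lemma poly_count_const:
  assumes "degree p = 0"
  shows "poly_count (B :: (real^'k::finite) set) n p = 0"
proof (cases "p = 0")
  case False
  obtain c where c: "p = [:c:]" using assms by (rule degree_eq_zeroE)
  have "zeros (Suc n) (coeff_vec p) = {}"
    using zeros_coeff_vec[of p n] c False by (simp add: map_poly_pCons)
  then show ?thesis by (simp add: poly_count_def tuple_count_def root_tuples_def PiE_eq_empty_iff)
qed (simp add: poly_count_0)

lemma card_roots_in_region:
  fixes B :: "(real^'k::finite) set"
  assumes "p \<noteq> 0" "degree p \<le> n"
  shows "card {x \<in> B. inj (\<lambda>i. x $ i) \<and> (\<forall>i. poly (real_poly p) (x $ i) = 0)} = poly_count B n p"
    and "finite {x \<in> B. inj (\<lambda>i. x $ i) \<and> (\<forall>i. poly (real_poly p) (x $ i) = 0)}"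
proof -
  have "real_poly p \<noteq> 0" using assms(1) by (auto simp: poly_eq_iff coeff_map_poly)
  then have fin: "finite (zeros (Suc n) (coeff_vec p))"
    unfolding zeros_coeff_vec[OF assms(2)] by (rule poly_roots_finite)
  have eq: "{x \<in> B. inj (\<lambda>i. x $ i) \<and> (\<forall>i. poly (real_poly p) (x $ i) = 0)} = vec_lambda ` {x \<in> root_tuples UNIV (Suc n) (coeff_vec p). vec_lambda x \<in> B}"
    (is "?A = vec_lambda ` ?T")
  proof (intro equalityI subsetI)
    fix x assume "x \<in> ?A"
    then have "vec_nth x \<in> ?T" by (auto simp: root_tuples_UNIV zeros_coeff_vec[OF assms(2)])
    then have "vec_lambda (vec_nth x) \<in> vec_lambda ` ?T" by (rule imageI)
    then show "x \<in> vec_lambda ` ?T" by simp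
  next
    fix x assume "x \<in> vec_lambda ` ?T"
    then obtain y where y: "x = vec_lambda y" "y \<in> ?T" by (rule imageE)
    have "vec_nth x = y" using y(1) by (simp add: vec_lambda_inverse)
    then show "x \<in> ?A" using y by (auto simp: root_tuples_UNIV zeros_coeff_vec[OF assms(2)] image_subset_iff)
  qed
  have "inj (vec_lambda :: ('k \<Rightarrow> real) \<Rightarrow> real^'k)" by (auto simp: inj_def vec_eq_iff fun_eq_iff)
  then have "card ?A = card ?T" unfolding eq by (intro card_image) (auto intro: inj_on_subset)
  then show "card ?A = poly_count B n p" using fin by (simp add: poly_count_def tuple_count_def)
  show "finite ?A" unfolding eq using fin by (intro finite_imageI finite_subset[OF _ finite_root_tuples[OF finite fin]]) auto
qed

lemma Pstar_int_polys:
  assumes "Q \<ge> 0"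
  shows "Pstar n Q = {p \<in> int_polys n (nat \<lfloor>Q\<rfloor>). prime_poly p}"
proof -
  have "real_of_int \<bar>c\<bar> \<le> Q \<longleftrightarrow> \<bar>c\<bar> \<le> int (nat \<lfloor>Q\<rfloor>)" for c :: int
    using assms by (simp add: le_floor_iff)
  then show ?thesis by (auto simp: Pstar_def int_polys_def iheight_le_iff)
qed

lemma prime_poly_nonzero: "prime_poly p \<Longrightarrow> p \<noteq> 0"
  by (auto simp: prime_poly_def)

lemma Phi_eq_sum:
  fixes B :: "(real^'k::finite) set"
  assumes "Q \<ge> 0"
  shows "Phi n Q B = (\<Sum>p\<in>Pstar n Q. poly_count B n p)"
proof -
  let ?A = "\<lambda>p. {x \<in> B. inj (\<lambda>i. x $ i) \<and> (\<forall>i. poly (real_poly p) (x $ i) = 0)}"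
  have P: "p \<noteq> 0 \<and> degree p \<le> n \<and> prime_poly p" if "p \<in> Pstar n Q" for p
    using that prime_poly_nonzero by (auto simp: Pstar_def)
  have "Phi n Q B = card (\<Union>p\<in>Pstar n Q. ?A p)"
    unfolding Phi_def by (rule arg_cong[where f = card]) auto
  also have "\<dots> = (\<Sum>p\<in>Pstar n Q. card (?A p))"
  proof (rule card_UN_disjoint)
    show "finite (Pstar n Q)" unfolding Pstar_int_polys[OF assms] by simp
    show "\<forall>p\<in>Pstar n Q. finite (?A p)" using P card_roots_in_region(2)[where 'k = 'k] by blast
    show "\<forall>p\<in>Pstar n Q. \<forall>q\<in>Pstar n Q. p \<noteq> q \<longrightarrow> ?A p \<inter> ?A q = {}"
      using P prime_poly_unique by blast
  qed
  also have "\<dots> = (\<Sum>p\<in>Pstar n Q. poly_count B n p)"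
    using P card_roots_in_region(1)[where 'k = 'k] by (intro sum.cong) auto
  finally show ?thesis .
qed

lemma sum_int_polys_grid:
  "(\<Sum>p\<in>int_polys n q. real (poly_count B n p)) = (\<Sum>a\<in>grid {..<Suc n} (\<lambda>_. lattice_pts q) (\<lambda>_. 0). real (tuple_count B (Suc n) a))"
proof (rule sum.reindex_bij_witness[where i = "\<lambda>a. Poly (map (\<lambda>i. \<lfloor>a i\<rfloor>) [0..<Suc n])" and j = coeff_vec])
  fix p assume p: "p \<in> int_polys n q"
  show "Poly (map (\<lambda>i. \<lfloor>coeff_vec p i\<rfloor>) [0..<Suc n]) = p"
    using p by (intro poly_eqI) (auto simp: nth_default_def coeff_vec_def int_polys_def coeff_eq_0 simp del: upt_Suc)
  show "coeff_vec p \<in> grid {..<Suc n} (\<lambda>_. lattice_pts q) (\<lambda>_. 0)"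
    using p by (auto simp: grid_def coeff_vec_def lattice_pts_def int_polys_def iheight_le_iff abs_le_iff minus_le_iff coeff_eq_0)
  show "real (tuple_count B (Suc n) (coeff_vec p)) = real (poly_count B n p)" by (simp add: poly_count_def)
next
  fix a assume a: "a \<in> grid {..<Suc n} (\<lambda>_. lattice_pts q) (\<lambda>_. 0)"
  have ai: "\<exists>z. a i = real_of_int z \<and> \<bar>z\<bar> \<le> int q" if "i < Suc n" for i
  proof -
    have "a i \<in> real_of_int ` {- int q..int q}" using a that by (auto simp: grid_def lattice_pts_def)
    then show ?thesis by (elim imageE) (auto intro!: exI)
  qed
  have c: "coeff (Poly (map (\<lambda>i. \<lfloor>a i\<rfloor>) [0..<Suc n])) i = (if i < Suc n then \<lfloor>a i\<rfloor> else 0)" for i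
    by (auto simp: nth_default_def simp del: upt_Suc)
  show "coeff_vec (Poly (map (\<lambda>i. \<lfloor>a i\<rfloor>) [0..<Suc n])) = a"
  proof (rule ext)
    fix i
    show "coeff_vec (Poly (map (\<lambda>i. \<lfloor>a i\<rfloor>) [0..<Suc n])) i = a i"
      using a ai[of i] unfolding coeff_vec_def c by (auto simp: grid_def)
  qed
  have "degree (Poly (map (\<lambda>i. \<lfloor>a i\<rfloor>) [0..<Suc n])) \<le> n" by (rule degree_le) (simp add: c del: coeff_Poly_eq upt_Suc)
  moreover have "\<bar>coeff (Poly (map (\<lambda>i. \<lfloor>a i\<rfloor>) [0..<Suc n])) i\<bar> \<le> int q" for i
    unfolding c using ai[of i] by auto
  ultimately show "Poly (map (\<lambda>i. \<lfloor>a i\<rfloor>) [0..<Suc n]) \<in> int_polys n q"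
    by (simp add: int_polys_def iheight_le_iff del: coeff_Poly_eq upt_Suc)
qed

definition prim_sum :: "(real^'k::finite) set \<Rightarrow> nat \<Rightarrow> nat \<Rightarrow> real" where
  "prim_sum B n q = (\<Sum>p\<in>{p \<in> int_polys n q. content p = 1}. real (poly_count B n p))"

text \<open>Write p as its content g times a primitive polynomial: the height is divided by g, and
  the roots, hence the count, are the same. The zero polynomial counts 0.\<close>

lemma sum_by_content:
  "(\<Sum>p\<in>int_polys n q. real (poly_count B n p)) = (\<Sum>g\<in>{1..q}. prim_sum B n (q div g))"
proof -
  have "(\<Sum>p\<in>int_polys n q. real (poly_count B n p)) = (\<Sum>p\<in>int_polys n q - {0}. real (poly_count B n p))"
    by (intro sum.mono_neutral_right) (auto simp: poly_count_0)
  also have "\<dots> = (\<Sum>(g, p)\<in>(SIGMA g:{1..q}. {p \<in> int_polys n (q div g). content p = 1}). real (poly_count B n p))"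
  proof (rule sum.reindex_bij_witness[where i = "\<lambda>(g, p). smult (int g) p" and j = "\<lambda>p. (nat (content p), primitive_part p)"])
    fix p assume p: "p \<in> int_polys n q - {0}"
    then have c: "content p > 0" by (metis DiffE abs_ge_zero content_eq_zero_iff normalize_content normalize_int_def insertI1 order_le_neq_trans)
    show "(case (nat (content p), primitive_part p) of (g, p) \<Rightarrow> smult (int g) p) = p" using c by simp
    have le: "content p * \<bar>coeff (primitive_part p) i\<bar> \<le> int q" for i
    proof -
      have "coeff p i = content p * coeff (primitive_part p) i"
        by (metis coeff_smult content_times_primitive_part)
      then have "\<bar>coeff p i\<bar> = content p * \<bar>coeff (primitive_part p) i\<bar>" using c by (simp add: abs_mult)
      moreover have "\<bar>coeff p i\<bar> \<le> int q" using p by (simp add: int_polys_def iheight_le_iff)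
      ultimately show ?thesis by simp
    qed
    have "primitive_part p \<noteq> 0" using p by simp
    then obtain i where "coeff (primitive_part p) i \<noteq> 0" by (auto simp: poly_eq_iff)
    then have "content p * 1 \<le> content p * \<bar>coeff (primitive_part p) i\<bar>" using c by (intro mult_left_mono) auto
    then have cq: "content p \<le> int q" using le[of i] by simp
    have "\<bar>coeff (primitive_part p) i\<bar> \<le> int (q div nat (content p))" for i
    proof -
      have "\<bar>coeff (primitive_part p) i\<bar> = content p * \<bar>coeff (primitive_part p) i\<bar> div content p" using c by simp
      also have "\<dots> \<le> int q div content p" using le[of i] c by (rule zdiv_mono1)
      finally show ?thesis using c by (simp add: zdiv_int)
    qed
    then show "(nat (content p), primitive_part p) \<in> (SIGMA g:{1..q}. {p \<in> int_polys n (q div g). content p = 1})"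
      using p c cq by (auto simp: int_polys_def iheight_le_iff)
    show "(case (nat (content p), primitive_part p) of (g, p) \<Rightarrow> real (poly_count B n p)) = real (poly_count B n p)"
      using poly_count_smult[of "content p" B n "primitive_part p", symmetric] p c by simp
  next
    fix x assume "x \<in> (SIGMA g:{1..q}. {p \<in> int_polys n (q div g). content p = 1})"
    then obtain g p where x: "x = (g, p)" "g \<ge> 1" "g \<le> q" "degree p \<le> n" "iheight p \<le> q div g" "content p = 1"
      by (auto simp: int_polys_def)
    have "p \<noteq> 0" using x(6) by auto
    show "(nat (content (case x of (g, p) \<Rightarrow> smult (int g) p)), primitive_part (case x of (g, p) \<Rightarrow> smult (int g) p)) = x"
      using x by (simp add: primitive_part_smult primitive_part_prim unit_factor_nat_def sgn_if)
    have "\<bar>coeff (smult (int g) p) i\<bar> \<le> int q" for i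
    proof -
      have "\<bar>coeff (smult (int g) p) i\<bar> = int g * \<bar>coeff p i\<bar>" by (simp add: abs_mult)
      also have "\<dots> \<le> int g * int (q div g)" using x(5) by (intro mult_left_mono) (auto simp: iheight_le_iff)
      also have "\<dots> \<le> int q" by (metis of_nat_le_iff of_nat_mult times_div_less_eq_dividend)
      finally show ?thesis .
    qed
    then show "(case x of (g, p) \<Rightarrow> smult (int g) p) \<in> int_polys n q - {0}"
      using x \<open>p \<noteq> 0\<close> by (auto simp: int_polys_def iheight_le_iff)
  qed
  also have "\<dots> = (\<Sum>g\<in>{1..q}. prim_sum B n (q div g))"
    unfolding prim_sum_def by (rule sum.Sigma[symmetric]) auto
  finally show ?thesis .
qed

section \<open>Inversion of the sum over dilations\<close>

lemma summable_zeta: "s \<ge> 2 \<Longrightarrow> summable (\<lambda>m. 1 / real (Suc m) ^ s)"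
proof (rule summable_comparison_test')
  show "summable (\<lambda>m. 1 / real (Suc m) ^ 2)"
    using inverse_power_summable[of 2, where 'a = real]
    by (subst summable_Suc_iff[of "\<lambda>m. 1 / real m ^ 2"]) (simp add: inverse_eq_divide)
  show "norm (1 / real (Suc m) ^ s) \<le> 1 / real (Suc m) ^ 2" if "s \<ge> 2" for m
    using that by (simp add: divide_left_mono power_increasing del: of_nat_Suc)
qed

lemma zeta_nat_ge_1:
  assumes "s \<ge> 2"
  shows "1 \<le> zeta_nat s"
proof -
  have "(\<Sum>m<1. 1 / real (Suc m) ^ s) \<le> zeta_nat s"
    unfolding zeta_nat_def by (rule sum_le_suminf[OF summable_zeta[OF assms]]) auto
  then show ?thesis by simp
qed

lemma summable_tail_squares: "summable (\<lambda>m. 1 / real (Suc (Suc m)) ^ 2)"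
  by (subst summable_Suc_iff[of "\<lambda>m. 1 / real (Suc m) ^ 2"]) (rule summable_zeta[of 2], simp)

text \<open>The first term is 1/4, and the rest telescopes to at most 1/2. That the bound is below 1
  lets the induction in \<open>invert_dilation_sum\<close> close.\<close>

lemma suminf_tail_squares: "(\<Sum>m. 1 / real (Suc (Suc m)) ^ 2) \<le> 3 / 4"
proof (rule suminf_le_const)
  show "summable (\<lambda>m. 1 / real (Suc (Suc m)) ^ 2)"
    by (rule summable_tail_squares)
  have "(\<Sum>m<Suc M. 1 / real (Suc (Suc m)) ^ 2) \<le> 3 / 4 - 1 / real (Suc (Suc M))" for M
  proof (induction M)
    case (Suc M)
    have "1 / real (Suc (Suc (Suc M))) ^ 2 \<le> 1 / (real (Suc (Suc M)) * real (Suc (Suc (Suc M))))"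
      by (intro divide_left_mono) (simp_all add: power2_eq_square)
    also have "\<dots> = 1 / real (Suc (Suc M)) - 1 / real (Suc (Suc (Suc M)))" by (simp add: field_simps)
    finally show ?case using Suc by simp
  qed (simp add: power2_eq_square)
  then have "(\<Sum>m<Suc M. 1 / real (Suc (Suc m)) ^ 2) \<le> 3 / 4" for M
    by (rule order_trans) simp
  moreover have "(\<Sum>m<M. 1 / real (Suc (Suc m)) ^ 2) \<le> (\<Sum>m<Suc M. 1 / real (Suc (Suc m)) ^ 2)" for M
    by simp
  ultimately show "(\<Sum>m<M. 1 / real (Suc (Suc m)) ^ 2) \<le> 3 / 4" for M using order_trans by blast
qed

text \<open>Makes the induction on the integer part of x well-founded: its recursive calls are at x
  / g with g at least 2.\<close>

lemma floor_half_less: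
  fixes x y :: real
  assumes "y \<le> x / 2" "1 \<le> x"
  shows "nat \<lfloor>y\<rfloor> < nat \<lfloor>x\<rfloor>"
proof -
  have 1: "1 \<le> \<lfloor>x\<rfloor>" using assms(2) by simp
  have "y < real_of_int \<lfloor>x\<rfloor>" using assms(1) 1 real_of_int_floor_add_one_gt[of x] by linarith
  then have "\<lfloor>y\<rfloor> < \<lfloor>x\<rfloor>" by (simp add: floor_less_iff)
  then show ?thesis using 1 by linarith
qed

text \<open>Inversion of \<open>T x = (\<Sum>g. f (x / g))\<close> without the Moebius function: the terms with \<open>g \<ge> 2\<close>
  have total weight at most \<open>\<zeta> 2 - 1 \<le> 3/4\<close>, so an error bound propagates by induction on \<open>\<lfloor>x\<rfloor>\<close>.\<close>

lemma invert_dilation_sum: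
  fixes f :: "real \<Rightarrow> real" and V c :: real
  assumes n: "n \<ge> 2" and V: "V \<ge> 0"
    and f0: "\<And>x. 0 < x \<Longrightarrow> x < 1 \<Longrightarrow> f x = 0"
    and T: "\<And>x. 1 \<le> x \<Longrightarrow> \<bar>(\<Sum>g\<in>{1..nat \<lfloor>x\<rfloor>}. f (x / real g)) - x ^ Suc n * V\<bar> \<le> c * x ^ n"
    and x: "x > 0"
  shows "\<bar>f x - x ^ Suc n * V / zeta_nat (Suc n)\<bar> \<le> (4 * c + V) * x ^ n"
proof -
  \<comment> \<open>The induction step needs c + (3/4) C \<le> C, that is, C \<ge> 4 c; the summand
    \<open>V\<close> covers x < 1, where f is 0 and the error is the main term itself.\<close>
  define C where "C = 4 * c + V"
  define z where "z = zeta_nat (Suc n)"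
  have z: "z \<ge> 1" unfolding z_def using n by (intro zeta_nat_ge_1) simp
  have c0: "c \<ge> 0" using T[of 1] abs_ge_zero order_trans by fastforce
  have C: "C \<ge> 0" "V \<le> C" using c0 V by (auto simp: C_def)
  define E where "E x = f x - x ^ Suc n * V / z" for x
  have "\<bar>E x\<bar> \<le> C * x ^ n" using x
  proof (induction "nat \<lfloor>x\<rfloor>" arbitrary: x rule: less_induct)
    case less
    show ?case
    proof (cases "x < 1")
      case True
      have "\<bar>E x\<bar> = x ^ Suc n * (V / z)" using f0[OF less.prems True] less.prems V z by (simp add: E_def)
      also have "\<dots> \<le> x ^ n * V"
      proof (rule mult_mono)
        show "x ^ Suc n \<le> x ^ n" using True less.prems by (intro power_decreasing) auto
        show "V / z \<le> V" using z V by (simp add: divide_le_eq mult_le_cancel_left1)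
      qed (use less.prems V z in auto)
      also have "\<dots> \<le> x ^ n * C" using C less.prems by (intro mult_left_mono) auto
      finally show ?thesis by (simp add: mult.commute)
    next
      case False
      then have x1: "x \<ge> 1" by simp
      \<comment> \<open>The errors at all x / g add up to the error of the dilation sum: f (x / g)
        is 0 for g beyond x, and the main terms add up to zeta times the one at x, which cancels the
        denominator.\<close>
      have sm: "(\<lambda>m. E (x / real (Suc m))) sums ((\<Sum>g\<in>{1..nat \<lfloor>x\<rfloor>}. f (x / real g)) - x ^ Suc n * V)"
      proof -
        have "(\<lambda>m. if m \<in> {..<nat \<lfloor>x\<rfloor>} then f (x / real (Suc m)) else 0) sums (\<Sum>m<nat \<lfloor>x\<rfloor>. f (x / real (Suc m)))"
          by (rule sums_If_finite_set) simp
        moreover have "(\<lambda>m. if m \<in> {..<nat \<lfloor>x\<rfloor>} then f (x / real (Suc m)) else 0) = (\<lambda>m. f (x / real (Suc m)))"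
        proof (rule ext)
          fix m
          show "(if m \<in> {..<nat \<lfloor>x\<rfloor>} then f (x / real (Suc m)) else 0) = f (x / real (Suc m))"
          proof (cases "m < nat \<lfloor>x\<rfloor>")
            case False
            then have "x < real (Suc m)" using x1 by linarith
            then have "x / real (Suc m) < 1" by simp
            then show ?thesis using False f0[of "x / real (Suc m)"] less.prems by simp
          qed simp
        qed
        moreover have "(\<Sum>m<nat \<lfloor>x\<rfloor>. f (x / real (Suc m))) = (\<Sum>g\<in>{1..nat \<lfloor>x\<rfloor>}. f (x / real g))"
          by (rule sum.reindex_bij_witness[where i = "\<lambda>g. g - 1" and j = Suc]) auto
        ultimately have 1: "(\<lambda>m. f (x / real (Suc m))) sums (\<Sum>g\<in>{1..nat \<lfloor>x\<rfloor>}. f (x / real g))" by simp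
        have "(\<lambda>m. x ^ Suc n * V / z * (1 / real (Suc m) ^ Suc n)) sums (x ^ Suc n * V / z * z)"
          unfolding z_def zeta_nat_def using n by (intro sums_mult summable_sums summable_zeta) simp
        moreover have "(\<lambda>m. x ^ Suc n * V / z * (1 / real (Suc m) ^ Suc n)) = (\<lambda>m. (x / real (Suc m)) ^ Suc n * V / z)"
          by (rule ext) (simp add: power_divide mult_ac del: power_Suc of_nat_Suc)
        moreover have "x ^ Suc n * V / z * z = x ^ Suc n * V" using z by simp
        ultimately have 2: "(\<lambda>m. (x / real (Suc m)) ^ Suc n * V / z) sums (x ^ Suc n * V)" by simp
        show ?thesis unfolding E_def using sums_diff[OF 1 2] .
      qed
      have bound: "\<bar>E (x / real (Suc (Suc m)))\<bar> \<le> C * x ^ n * (1 / real (Suc (Suc m)) ^ 2)" for m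
      proof -
        let ?y = "x / real (Suc (Suc m))"
        have y: "?y > 0" using less.prems by simp
        have "?y \<le> x / 2" using less.prems by (intro divide_left_mono) auto
        then have "nat \<lfloor>?y\<rfloor> < nat \<lfloor>x\<rfloor>" by (rule floor_half_less[OF _ x1])
        then have "\<bar>E ?y\<bar> \<le> C * ?y ^ n" using y by (rule less.hyps)
        also have "?y ^ n = x ^ n * (1 / real (Suc (Suc m)) ^ n)" by (simp add: power_divide)
        \<comment> \<open>As n is at least 2, the weights 1/g^n are dominated by 1/g^2.\<close>
        also have "\<dots> \<le> x ^ n * (1 / real (Suc (Suc m)) ^ 2)"
          using n less.prems by (intro mult_left_mono divide_left_mono power_increasing) auto
        finally show ?thesis using C by (simp add: mult_left_mono mult.assoc)
      qed
      have sq: "summable (\<lambda>m. C * x ^ n * (1 / real (Suc (Suc m)) ^ 2))"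
        by (intro summable_mult summable_tail_squares)
      have "E (x / real (Suc 0)) = (\<Sum>m. E (x / real (Suc m))) - (\<Sum>m. E (x / real (Suc (Suc m))))"
        using suminf_split_head[OF sums_summable[OF sm]] by simp
      then have Ex: "E x = ((\<Sum>g\<in>{1..nat \<lfloor>x\<rfloor>}. f (x / real g)) - x ^ Suc n * V) - (\<Sum>m. E (x / real (Suc (Suc m))))"
        using sums_unique[OF sm] by simp
      have sn: "summable (\<lambda>m. norm (E (x / real (Suc (Suc m)))))"
        using bound by (intro summable_comparison_test'[OF sq]) auto
      have "\<bar>\<Sum>m. E (x / real (Suc (Suc m)))\<bar> \<le> (\<Sum>m. norm (E (x / real (Suc (Suc m)))))"
        using summable_norm[OF sn] by simp
      also have "\<dots> \<le> (\<Sum>m. C * x ^ n * (1 / real (Suc (Suc m)) ^ 2))"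
        using bound by (intro suminf_le sn sq) simp
      also have "\<dots> = C * x ^ n * (\<Sum>m. 1 / real (Suc (Suc m)) ^ 2)"
        by (intro suminf_mult summable_tail_squares)
      also have "\<dots> \<le> C * x ^ n * (3 / 4)"
        using C less.prems by (intro mult_left_mono suminf_tail_squares) auto
      finally have "\<bar>E x\<bar> \<le> c * x ^ n + C * x ^ n * (3 / 4)" using T[OF x1] unfolding Ex by linarith
      also have "\<dots> \<le> C * x ^ n"
      proof -
        have "c * x ^ n * 4 \<le> C * x ^ n" using V less.prems by (simp add: C_def algebra_simps)
        then show ?thesis by simp
      qed
      finally show ?thesis .
    qed
  qed
  then show ?thesis by (simp add: E_def C_def z_def)
qed

subsection \<open>The asymptotic formula\<close>

lemma power_diff_bound:
  fixes a b M :: real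
  assumes "0 \<le> a" "a \<le> M" "0 \<le> b" "b \<le> M"
  shows "\<bar>a ^ Suc n - b ^ Suc n\<bar> \<le> real (Suc n) * \<bar>a - b\<bar> * M ^ n"
proof (induction n)
  case (Suc n)
  have "\<bar>a ^ Suc (Suc n) - b ^ Suc (Suc n)\<bar> = \<bar>a * (a ^ Suc n - b ^ Suc n) + (a - b) * b ^ Suc n\<bar>"
    by (simp add: algebra_simps)
  also have "\<dots> \<le> a * \<bar>a ^ Suc n - b ^ Suc n\<bar> + \<bar>a - b\<bar> * b ^ Suc n"
    using assms by (intro order_trans[OF abs_triangle_ineq]) (simp add: abs_mult)
  also have "\<dots> \<le> M * (real (Suc n) * \<bar>a - b\<bar> * M ^ n) + \<bar>a - b\<bar> * M ^ Suc n"
    using assms Suc by (intro add_mono mult_mono power_mono) (auto simp del: power_Suc)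
  also have "\<dots> = real (Suc (Suc n)) * \<bar>a - b\<bar> * M ^ Suc n" by (simp add: algebra_simps)
  finally show ?case .
qed simp

lemma prim_sum_0: "prim_sum B n 0 = 0"
proof -
  have "p = 0" if "p \<in> int_polys n 0" for p
  proof (rule poly_eqI)
    fix i
    have "iheight p \<le> 0" using that by (simp add: int_polys_def)
    then have "\<bar>coeff p i\<bar> \<le> int 0" unfolding iheight_le_iff by blast
    then show "coeff p i = coeff 0 i" by simp
  qed
  then have "{p \<in> int_polys n 0. content p = 1} = {}" by fastforce
  then show ?thesis unfolding prim_sum_def by (simp del: Collect_empty_eq)
qed

lemma nat_floor_divide: "x \<ge> 0 \<Longrightarrow> nat \<lfloor>x / real g\<rfloor> = nat \<lfloor>x\<rfloor> div g"
  using floor_divide_real_eq_div[of "int g" x] by (simp add: nat_div_distrib)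

text \<open>The inversion constant involves the volume V of the set in question; replacing it by the
  bound \<open>W\<close>, which is the same for all \<open>B\<close>, keeps the constant
  uniform.\<close>

lemma prim_sum_asymptotics:
  assumes n: "n \<ge> 2" and k: "CARD('k) \<le> n"
  shows "\<exists>C\<ge>0. \<forall>(B :: (real^'k::{finite,linorder}) set) (P :: nat \<Rightarrow> ('k \<Rightarrow> nat) \<Rightarrow> real) Q. B \<in> sets borel \<longrightarrow> (\<forall>j<m. alg_poly (P j) d) \<longrightarrow>
     frontier B \<subseteq> (\<Union>j<m. {x. mpoly_eval (P j) x = 0}) \<longrightarrow> Q \<ge> 1 \<longrightarrow>
     \<bar>prim_sum B n (nat \<lfloor>Q\<rfloor>) - Q ^ Suc n * enn2real (cube_volume B (Suc n)) / zeta_nat (Suc n)\<bar> \<le> C * Q ^ n"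
proof -
  obtain C where C: "C \<ge> 0" "\<And>(B :: ((real,'k) vec) set) (P :: nat \<Rightarrow> ('k \<Rightarrow> nat) \<Rightarrow> real) q. B \<in> sets borel \<Longrightarrow> (\<forall>j<m. alg_poly (P j) d) \<Longrightarrow>
     frontier B \<subseteq> (\<Union>j<m. {x. mpoly_eval (P j) x = 0}) \<Longrightarrow>
     \<bar>(\<Sum>a\<in>grid {..<Suc n} (\<lambda>_. lattice_pts q) (\<lambda>_. 0). real (tuple_count B (Suc n) a)) -
      (real q + 1/2) ^ Suc n * enn2real (cube_volume B (Suc n))\<bar> \<le> C * real (2 * q + 1) ^ n"
    using lattice_tuple_count[OF n k, of m d] by blast
  define W where "W = real (Suc n ^ CARD('k)) * 2 ^ Suc n"
  have W: "W \<ge> 0" by (simp add: W_def)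
  \<comment> \<open>The first term comes from 2q + 1 \<le> 3x in the lattice estimate, the second
    from replacing q + 1/2 by x: they differ by at most 1/2, and both are at most 2x.\<close>
  define c where "c = C * 3 ^ n + real (Suc n) * (1/2) * 2 ^ n * W"
  show ?thesis
  proof (intro exI[of _ "4 * c + W"] conjI allI impI)
    show "0 \<le> 4 * c + W" using C(1) W by (simp add: c_def)
    fix B :: "((real,'k) vec) set" and P :: "nat \<Rightarrow> ('k \<Rightarrow> nat) \<Rightarrow> real" and Q :: real
    assume B: "B \<in> sets borel" "\<forall>j<m. alg_poly (P j) d" "frontier B \<subseteq> (\<Union>j<m. {x. mpoly_eval (P j) x = 0})"
      and Q: "Q \<ge> 1"
    define V where "V = enn2real (cube_volume B (Suc n))"
    have V: "V \<ge> 0" "V \<le> W"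
      using cube_volume_rho(2)[OF k B(1)] W by (auto simp: V_def W_def intro: enn2real_leI)
    have "\<bar>prim_sum B n (nat \<lfloor>Q\<rfloor>) - Q ^ Suc n * V / zeta_nat (Suc n)\<bar> \<le> (4 * c + V) * Q ^ n"
    proof (rule invert_dilation_sum[OF n V(1), of "\<lambda>x. prim_sum B n (nat \<lfloor>x\<rfloor>)"])
      show "0 < Q" using Q by simp
      show "prim_sum B n (nat \<lfloor>x\<rfloor>) = 0" if "0 < x" "x < 1" for x :: real
      proof -
        have "\<lfloor>x\<rfloor> = 0" using that by (simp add: floor_eq_iff)
        then show ?thesis by (simp add: prim_sum_0)
      qed
      fix x :: real assume x: "1 \<le> x"
      define q where "q = nat \<lfloor>x\<rfloor>"
      have q: "real q \<le> x" "x < real q + 1" using x unfolding q_def by linarith+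
      have S: "(\<Sum>g\<in>{1..nat \<lfloor>x\<rfloor>}. prim_sum B n (nat \<lfloor>x / real g\<rfloor>)) =
          (\<Sum>a\<in>grid {..<Suc n} (\<lambda>_. lattice_pts q) (\<lambda>_. 0). real (tuple_count B (Suc n) a))"
        using x unfolding sum_int_polys_grid[symmetric] sum_by_content by (simp add: nat_floor_divide q_def)
      have "\<bar>(\<Sum>g\<in>{1..nat \<lfloor>x\<rfloor>}. prim_sum B n (nat \<lfloor>x / real g\<rfloor>)) - (real q + 1/2) ^ Suc n * V\<bar> \<le> C * real (2 * q + 1) ^ n"
        unfolding S V_def by (rule C(2)[OF B])
      also have "\<dots> \<le> C * (3 * x) ^ n" using C(1) q x by (intro mult_left_mono power_mono) auto
      finally have 1: "\<bar>(\<Sum>g\<in>{1..nat \<lfloor>x\<rfloor>}. prim_sum B n (nat \<lfloor>x / real g\<rfloor>)) - (real q + 1/2) ^ Suc n * V\<bar> \<le> C * 3 ^ n * x ^ n"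
        by (simp add: power_mult_distrib mult.assoc)
      have "\<bar>(real q + 1/2) ^ Suc n - x ^ Suc n\<bar> \<le> real (Suc n) * \<bar>real q + 1/2 - x\<bar> * (2 * x) ^ n"
        using q x by (intro power_diff_bound) auto
      also have "\<dots> \<le> real (Suc n) * (1/2) * (2 * x) ^ n"
      proof (intro mult_right_mono mult_left_mono)
        show "\<bar>real q + 1/2 - x\<bar> \<le> 1/2" using q by linarith
      qed (use x in auto)
      finally have "\<bar>(real q + 1/2) ^ Suc n - x ^ Suc n\<bar> * V \<le> real (Suc n) * (1/2) * (2 * x) ^ n * W"
        by (rule mult_mono) (use x V in auto)
      then have 2: "\<bar>(real q + 1/2) ^ Suc n * V - x ^ Suc n * V\<bar> \<le> real (Suc n) * (1/2) * 2 ^ n * W * x ^ n"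
        using abs_mult[of "(real q + 1/2) ^ Suc n - x ^ Suc n" V] V(1)
        by (simp add: right_diff_distrib power_mult_distrib mult_ac del: power_Suc of_nat_Suc)
      show "\<bar>(\<Sum>g\<in>{1..nat \<lfloor>x\<rfloor>}. prim_sum B n (nat \<lfloor>x / real g\<rfloor>)) - x ^ Suc n * V\<bar> \<le> c * x ^ n"
        using 1 2 unfolding c_def distrib_right by linarith
    qed
    also have "\<dots> \<le> (4 * c + W) * Q ^ n" using V Q by (intro mult_right_mono) auto
    finally show "\<bar>prim_sum B n (nat \<lfloor>Q\<rfloor>) - Q ^ Suc n * enn2real (cube_volume B (Suc n)) / zeta_nat (Suc n)\<bar> \<le> (4 * c + W) * Q ^ n"
      unfolding V_def .
  qed
qed

text \<open>Negation preserves content, height and roots and exchanges the signs of the leading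
  coefficient; this is the factor 2 in the denominator of the asymptotic formula.\<close>

lemma prim_sum_half:
  "prim_sum B n q = 2 * (\<Sum>p\<in>{p \<in> int_polys n q. content p = 1 \<and> lead_coeff p > 0}. real (poly_count B n p))"
    (is "_ = 2 * sum ?f ?P")
proof -
  let ?N = "{p \<in> int_polys n q. content p = 1 \<and> lead_coeff p < 0}"
  have "lead_coeff p > 0 \<or> lead_coeff p < 0" if "content p = 1" for p :: "int poly"
    using that content_0 leading_coeff_0_iff linorder_neq_iff zero_neq_one by metis
  then have "{p \<in> int_polys n q. content p = 1} = ?P \<union> ?N" by blast
  then have "prim_sum B n q = sum ?f ?P + sum ?f ?N"
    unfolding prim_sum_def by (simp add: sum.union_disjoint disjoint_iff)
  moreover have "sum ?f ?N = sum ?f ?P"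
  proof (rule sum.reindex_bij_witness[where i = uminus and j = uminus])
    have c: "content (- p) = content p" for p :: "int poly" using content_smult[of "-1" p] by simp
    have "poly_count B n (- p) = poly_count B n p" for p using poly_count_smult[of "-1" B n p] by simp
    then show "real (poly_count B n (- p)) = real (poly_count B n p)" for p by simp
    show "- p \<in> ?P" if "p \<in> ?N" for p using that c[of p] by (auto simp: int_polys_def iheight_le_iff)
    show "- p \<in> ?N" if "p \<in> ?P" for p using that c[of p] by (auto simp: int_polys_def iheight_le_iff)
  qed auto
  ultimately show ?thesis by simp
qed

text \<open>A primitive polynomial of degree n with positive leading coefficient that is not prime
  factors over the integers by Gauss's lemma. The polynomials of degree below n are O(Q^n) in number
  and are estimated wholesale. Each polynomial carries at most (n + 1)^k tuples.\<close>

lemma Phi_prim_sum: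
  assumes n: "n \<ge> 2"
  shows "\<exists>C\<ge>0. \<forall>(B :: (real^'k::finite) set) Q. Q \<ge> 3 \<longrightarrow>
     \<bar>prim_sum B n (nat \<lfloor>Q\<rfloor>) - 2 * real (Phi n Q B)\<bar> \<le> C * Q ^ n * ln Q ^ lexp n"
proof -
  obtain C where C: "C \<ge> 0" "\<And>q. q \<ge> 3 \<Longrightarrow> real (card (reducible_polys n q)) \<le> C * real q ^ n * ln (real q) ^ lexp n"
    using card_reducible_polys[OF n] by blast
  define K where "K = real (Suc n ^ CARD('k))"
  have K: "K \<ge> 0" by (simp add: K_def)
  show ?thesis
  proof (intro exI[of _ "2 * K * (3 ^ n + C)"] conjI allI impI)
    show "0 \<le> 2 * K * (3 ^ n + C)" using C(1) K by simp
    fix B :: "((real,'k) vec) set" and Q :: real assume Q: "3 \<le> Q"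
    define q where "q = nat \<lfloor>Q\<rfloor>"
    have q: "real q \<le> Q" "3 \<le> q" using Q by (auto simp: q_def le_nat_iff le_floor_iff)
    have ln1: "1 \<le> ln Q" using Q exp_le by (subst ln_ge_iff) auto
    define S where "S = {p \<in> int_polys n q. content p = 1 \<and> lead_coeff p > 0}"
    define R where "R = int_polys (n - 1) q \<union> reducible_polys n q"
    have fR: "finite (reducible_polys n q)"
      by (rule finite_subset[OF _ finite_int_polys[of n q]]) (auto simp: reducible_polys_def int_polys_def)
    have fS: "finite S" by (simp add: S_def)
    have PS: "Pstar n Q \<subseteq> S" using Q by (auto simp: Pstar_int_polys S_def prime_poly_def q_def)
    have "(\<Sum>p\<in>S. real (poly_count B n p)) - real (Phi n Q B) = (\<Sum>p\<in>S - Pstar n Q. real (poly_count B n p))"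
      using Q fS PS by (simp add: Phi_eq_sum sum_diff)
    also have "\<dots> = (\<Sum>p\<in>(S - Pstar n Q) \<inter> R. real (poly_count B n p))"
    proof (rule sum.mono_neutral_right)
      show "\<forall>p\<in>S - Pstar n Q - (S - Pstar n Q) \<inter> R. real (poly_count B n p) = 0"
      proof
        fix p assume "p \<in> S - Pstar n Q - (S - Pstar n Q) \<inter> R"
        then have p: "p \<in> S" "p \<notin> Pstar n Q" "p \<notin> R" by auto
        have "degree p = 0"
        proof (rule ccontr)
          assume d: "degree p \<noteq> 0"
          have "\<not> prime_poly p" using p(1,2) Q by (auto simp: Pstar_int_polys S_def q_def)
          then have "\<not> irreducible (rat_poly p)" using p(1) by (auto simp: prime_poly_def S_def)
          then have "\<exists>f g. p = f * g \<and> degree f \<noteq> 0 \<and> degree g \<noteq> 0"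
            using not_irreducible_factor[of p] d p(1) by (auto simp: S_def)
          moreover have "degree p \<le> n" "iheight p \<le> q" using p(1) by (auto simp: S_def int_polys_def)
          ultimately show False using p(3) by (auto simp: R_def int_polys_def reducible_polys_def)
        qed
        then show "real (poly_count B n p) = 0" by (simp add: poly_count_const)
      qed
    qed (use fS in auto)
    finally have D: "(\<Sum>p\<in>S. real (poly_count B n p)) - real (Phi n Q B) = (\<Sum>p\<in>(S - Pstar n Q) \<inter> R. real (poly_count B n p))" .
    have "(\<Sum>p\<in>(S - Pstar n Q) \<inter> R. real (poly_count B n p)) \<le> (\<Sum>p\<in>R. real (poly_count B n p))"
      using fR by (intro sum_mono2) (auto simp: R_def)
    also have "\<dots> \<le> (\<Sum>p\<in>R. K)" unfolding K_def by (intro sum_mono of_nat_mono poly_count_le)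
    also have "\<dots> = real (card R) * K" by simp
    also have "\<dots> \<le> (3 ^ n * Q ^ n * ln Q ^ lexp n + C * Q ^ n * ln Q ^ lexp n) * K"
    proof (rule mult_right_mono[OF _ K])
      have "real (card R) \<le> real (card (int_polys (n - 1) q)) + real (card (reducible_polys n q))"
        unfolding R_def using card_Un_le[of "int_polys (n - 1) q" "reducible_polys n q"] by linarith
      also have "\<dots> \<le> 3 ^ n * Q ^ n * ln Q ^ lexp n + C * Q ^ n * ln Q ^ lexp n"
      proof (rule add_mono)
        have "real (card (int_polys (n - 1) q)) = (2 * real q + 1) ^ n" using n by (simp add: card_int_polys add.commute)
        also have "\<dots> \<le> (3 * Q) ^ n" using q by (intro power_mono) auto
        also have "\<dots> = 3 ^ n * Q ^ n * 1" by (simp add: power_mult_distrib)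
        also have "\<dots> \<le> 3 ^ n * Q ^ n * ln Q ^ lexp n" using ln1 Q by (intro mult_left_mono) auto
        finally show "real (card (int_polys (n - 1) q)) \<le> 3 ^ n * Q ^ n * ln Q ^ lexp n" .
        have "real (card (reducible_polys n q)) \<le> C * real q ^ n * ln (real q) ^ lexp n" by (rule C(2)[OF q(2)])
        also have "\<dots> \<le> C * Q ^ n * ln Q ^ lexp n"
          using C(1) q Q by (intro mult_mono mult_left_mono power_mono) auto
        finally show "real (card (reducible_polys n q)) \<le> C * Q ^ n * ln Q ^ lexp n" .
      qed
      finally show "real (card R) \<le> 3 ^ n * Q ^ n * ln Q ^ lexp n + C * Q ^ n * ln Q ^ lexp n" .
    qed
    also have "\<dots> = K * (3 ^ n + C) * Q ^ n * ln Q ^ lexp n" by (simp add: algebra_simps)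
    finally have up: "(\<Sum>p\<in>S. real (poly_count B n p)) - real (Phi n Q B) \<le> K * (3 ^ n + C) * Q ^ n * ln Q ^ lexp n"
      unfolding D .
    have lo: "0 \<le> (\<Sum>p\<in>S. real (poly_count B n p)) - real (Phi n Q B)" unfolding D by (simp add: sum_nonneg)
    have "prim_sum B n (nat \<lfloor>Q\<rfloor>) = 2 * (\<Sum>p\<in>S. real (poly_count B n p))"
      unfolding S_def q_def by (rule prim_sum_half)
    then show "\<bar>prim_sum B n (nat \<lfloor>Q\<rfloor>) - 2 * real (Phi n Q B)\<bar> \<le> 2 * K * (3 ^ n + C) * Q ^ n * ln Q ^ lexp n"
      using up lo by (simp add: mult.assoc)
  qed
qed

theorem theorem1:
  fixes n :: nat
  assumes "n \<ge> 2" and "CARD('k) \<le> n"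
  shows "\<forall>m d::nat. \<exists>C Q0::real. \<forall>(B :: (real^'k::{finite,linorder}) set) (P :: nat \<Rightarrow> (('k \<Rightarrow> nat) \<Rightarrow> real)) (Q::real).
     B \<in> sets borel \<and> (\<forall>j<m. alg_poly (P j) d) \<and>
     frontier B \<subseteq> (\<Union>j<m. {x. mpoly_eval (P j) x = 0}) \<and> Q \<ge> Q0 \<longrightarrow>
     \<bar>real (Phi n Q B) - (2 * Q) ^ (n + 1) / (2 * zeta_nat (n + 1)) * (LINT x : B | lborel. rho n x)\<bar>
       \<le> C * Q ^ n * (ln Q) ^ lexp n"
proof (intro allI)
  fix m d :: nat
  obtain C1 where C1: "C1 \<ge> 0" "\<And>(B :: ((real,'k) vec) set) (P :: nat \<Rightarrow> ('k \<Rightarrow> nat) \<Rightarrow> real) Q. B \<in> sets borel \<Longrightarrow>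
      (\<forall>j<m. alg_poly (P j) d) \<Longrightarrow> frontier B \<subseteq> (\<Union>j<m. {x. mpoly_eval (P j) x = 0}) \<Longrightarrow> Q \<ge> 1 \<Longrightarrow>
     \<bar>prim_sum B n (nat \<lfloor>Q\<rfloor>) - Q ^ Suc n * enn2real (cube_volume B (Suc n)) / zeta_nat (Suc n)\<bar> \<le> C1 * Q ^ n"
    using prim_sum_asymptotics[OF assms, of m d] by blast
  obtain C2 where C2: "C2 \<ge> 0" "\<And>(B :: ((real,'k) vec) set) Q. Q \<ge> 3 \<Longrightarrow>
     \<bar>prim_sum B n (nat \<lfloor>Q\<rfloor>) - 2 * real (Phi n Q B)\<bar> \<le> C2 * Q ^ n * ln Q ^ lexp n"
    using Phi_prim_sum[OF assms(1), where 'k = 'k] by blast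
  show "\<exists>C Q0::real. \<forall>(B :: ((real,'k) vec) set) (P :: nat \<Rightarrow> (('k \<Rightarrow> nat) \<Rightarrow> real)) (Q::real).
     B \<in> sets borel \<and> (\<forall>j<m. alg_poly (P j) d) \<and>
     frontier B \<subseteq> (\<Union>j<m. {x. mpoly_eval (P j) x = 0}) \<and> Q \<ge> Q0 \<longrightarrow>
     \<bar>real (Phi n Q B) - (2 * Q) ^ (n + 1) / (2 * zeta_nat (n + 1)) * (LINT x : B | lborel. rho n x)\<bar>
       \<le> C * Q ^ n * (ln Q) ^ lexp n"
  \<comment> \<open>The halves arise because the primitive sum is twice \<open>Phi\<close>; from Q =
    3 on, ln Q is at least 1, so the error without a logarithm is absorbed.\<close>
  proof (rule exI[of _ "(C1 + C2) / 2"], rule exI[of _ 3], intro allI impI, elim conjE)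
    fix B :: "((real,'k) vec) set" and P :: "nat \<Rightarrow> ('k \<Rightarrow> nat) \<Rightarrow> real" and Q :: real
    assume B: "B \<in> sets borel" "\<forall>j<m. alg_poly (P j) d" "frontier B \<subseteq> (\<Union>j<m. {x. mpoly_eval (P j) x = 0})"
      and Q: "3 \<le> Q"
    let ?V = "enn2real (cube_volume B (Suc n))"
    have ln1: "1 \<le> ln Q" using Q exp_le by (subst ln_ge_iff) auto
    \<comment> \<open>The power 2^(n + 1) in front of Q^(n + 1) is cancelled by the normalisation of
      \<open>rho\<close>, leaving the volume taken over the cube of half-side 1.\<close>
    have V: "(2 * Q) ^ (n + 1) / (2 * zeta_nat (n + 1)) * (LINT x : B | lborel. rho n x) = (Q ^ Suc n * ?V / zeta_nat (Suc n)) / 2"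
      unfolding cube_volume_rho(1)[OF assms(2) B(1)] by (simp add: power_mult_distrib field_simps)
    have "\<bar>prim_sum B n (nat \<lfloor>Q\<rfloor>) - Q ^ Suc n * ?V / zeta_nat (Suc n)\<bar> \<le> C1 * Q ^ n * 1"
      using C1(2)[OF B] Q by simp
    also have "\<dots> \<le> C1 * Q ^ n * ln Q ^ lexp n" using ln1 Q C1(1) by (intro mult_left_mono) auto
    finally show "\<bar>real (Phi n Q B) - (2 * Q) ^ (n + 1) / (2 * zeta_nat (n + 1)) * (LINT x : B | lborel. rho n x)\<bar>
       \<le> (C1 + C2) / 2 * Q ^ n * (ln Q) ^ lexp n"
      using C2(2)[OF Q, of B] unfolding V by (simp add: distrib_right add_divide_distrib abs_le_iff del: power_Suc)
  qed
qed

end
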